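(* Let $M$ be a moon polyomino and $\mathbf r$ a vector of non-negative integers. Let $\mathcal F_{01}^{ne}(M,l,\mathbf r)$ be the set of $0$-$1$-fillings of $M$ in which the length of the longest ne-chain equals $l$ and row $i$ contains exactly $\mathbf r_i$ non-zero entries (for every $i$). Then for every permutation $\sigma$ of the column indices of $M$ such that $\sigma M$ is again a moon polyomino, $$|\mathcal F_{01}^{ne}(M,l,\mathbf r)|=|\mathcal F_{01}^{ne}(\sigma M,l,\mathbf r)|.$$ Furthermore, the number of $0$-$1$-fillings of a moon polyomino $M$ with a given number of non-zero entries and a given length of the longest ne-chain depends only on the content of $M$ (and on these two numbers).
   Context: A polyomino is a finite subset of $\mathbb Z^2$, whose elements are called cells; a column (row) is the set of its cells on a vertical (horizontal) line. It is convex if for any two cells in the same column (row) all elements of $\mathbb Z^2$ between them are cells. It is intersection-free if for any two columns, the set of row coordinates of one is contained in that of the other. A moon polyomino is a convex, intersection-free polyomino. For a permutation $\sigma$ of the column indices, $\sigma M=\{(\sigma i,j):(i,j)\in M\}$ (columns are translated horizontally, keeping their vertical positions). The content of $M$ is the multiset of column heights (listed in decreasing order). A $0$-$1$-filling assigns $0$ or $1$ to each cell. A chain is a sequence of cells with non-zero entries such that the smallest rectangle containing all of them is contained in $M$; an ne-chain of length $k$ is such a chain of $k$ cells, each strictly to the right of and strictly above the preceding one. *)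

theory Defs
  imports Complex_Main "HOL.Hull" "HOL-Library.FuncSet" "HOL-Library.Multiset"
    "HOL-Combinatorics.Permutations"
begin

text \<open>
  A cell is a pair \<open>(i, j)\<close> with column index \<open>i\<close> (increasing to the right) and row index \<open>j\<close>
  (increasing upwards). Connectedness is not required, and the empty polyomino is admitted.
\<close>

type_synonym cell = "int \<times> int"

definition polyomino :: "cell set \<Rightarrow> bool" where
  "polyomino M \<longleftrightarrow> finite M"

definition column :: "cell set \<Rightarrow> int \<Rightarrow> cell set" where
  "column M i = {c \<in> M. fst c = i}"

definition row :: "cell set \<Rightarrow> int \<Rightarrow> cell set" where
  "row M j = {c \<in> M. snd c = j}"

text \<open>The indices of the nonempty columns and rows.\<close>

definition column_indices :: "cell set \<Rightarrow> int set" where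
  "column_indices M = fst ` M"

definition row_indices :: "cell set \<Rightarrow> int set" where
  "row_indices M = snd ` M"

definition convex_polyomino :: "cell set \<Rightarrow> bool" where
  "convex_polyomino M \<longleftrightarrow>
     (\<forall>i j j' k. (i, j) \<in> M \<and> (i, j') \<in> M \<and> j \<le> k \<and> k \<le> j' \<longrightarrow> (i, k) \<in> M) \<and>
     (\<forall>i i' j k. (i, j) \<in> M \<and> (i', j) \<in> M \<and> i \<le> k \<and> k \<le> i' \<longrightarrow> (k, j) \<in> M)"

definition intersection_free :: "cell set \<Rightarrow> bool" where
  "intersection_free M \<longleftrightarrow>
     (\<forall>i \<in> column_indices M. \<forall>i' \<in> column_indices M.
        snd ` column M i \<subseteq> snd ` column M i' \<or> snd ` column M i' \<subseteq> snd ` column M i)"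

definition moon_polyomino :: "cell set \<Rightarrow> bool" where
  "moon_polyomino M \<longleftrightarrow> polyomino M \<and> convex_polyomino M \<and> intersection_free M"

definition permute_columns :: "(int \<Rightarrow> int) \<Rightarrow> cell set \<Rightarrow> cell set" where
  "permute_columns \<sigma> M = {(\<sigma> i, j) | i j. (i, j) \<in> M}"

definition content :: "cell set \<Rightarrow> nat multiset" where
  "content M = {# card (column M i). i \<in># mset_set (column_indices M) #}"

text \<open>A filling is extensional: it is \<open>undefined\<close> outside \<open>M\<close>, so that fillings can be counted.\<close>

definition fillings01 :: "cell set \<Rightarrow> (cell \<Rightarrow> nat) set" where
  "fillings01 M = M \<rightarrow>\<^sub>E {0, 1}"

definition nonzero_cells :: "cell set \<Rightarrow> (cell \<Rightarrow> nat) \<Rightarrow> cell set" where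
  "nonzero_cells M f = {c \<in> M. f c \<noteq> 0}"

definition rectangle :: "cell set \<Rightarrow> bool" where
  "rectangle R \<longleftrightarrow> (\<exists>a b c d. R = {a..b} \<times> {c..d})"

text \<open>
  Rectangles are closed under intersection, so for a finite set \<open>S\<close> the smallest rectangle
  containing \<open>S\<close> is \<open>rectangle hull S\<close>; it is empty if \<open>S\<close> is.
\<close>

definition is_chain :: "cell set \<Rightarrow> (cell \<Rightarrow> nat) \<Rightarrow> cell list \<Rightarrow> bool" where
  "is_chain M f cs \<longleftrightarrow> set cs \<subseteq> nonzero_cells M f \<and> rectangle hull (set cs) \<subseteq> M"

definition ne_chain :: "cell set \<Rightarrow> (cell \<Rightarrow> nat) \<Rightarrow> cell list \<Rightarrow> bool" where
  "ne_chain M f cs \<longleftrightarrow> is_chain M f cs \<and>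
     successively (\<lambda>c c'. fst c < fst c' \<and> snd c < snd c') cs"

text \<open>
  For finite \<open>M\<close> the maximum is over a finite set, see \<open>finite_ne_chains\<close> below, which is nonempty
  because of the empty chain; so a filling without nonzero entries has longest ne-chain of length 0.
\<close>

definition longest_ne_chain :: "cell set \<Rightarrow> (cell \<Rightarrow> nat) \<Rightarrow> nat" where
  "longest_ne_chain M f = Max {length cs | cs. ne_chain M f cs}"

definition F01_ne :: "cell set \<Rightarrow> nat \<Rightarrow> (int \<Rightarrow> nat) \<Rightarrow> (cell \<Rightarrow> nat) set" where
  "F01_ne M l r = {f \<in> fillings01 M. longest_ne_chain M f = l \<and>
     (\<forall>j \<in> row_indices M. card (nonzero_cells (row M j) f) = r j)}"

definition F01_ne_total :: "cell set \<Rightarrow> nat \<Rightarrow> nat \<Rightarrow> (cell \<Rightarrow> nat) set" where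
  "F01_ne_total M l n = {f \<in> fillings01 M. longest_ne_chain M f = l \<and>
     card (nonzero_cells M f) = n}"

lemma rectangle_Int:
  assumes "rectangle R" "rectangle S"
  shows "rectangle (R \<inter> S)"
proof -
  obtain a b c d a' b' c' d' where "R = {a..b} \<times> {c..d}" "S = {a'..b'} \<times> {c'..d'}"
    using assms unfolding rectangle_def by metis
  then have "R \<inter> S = {max a a'..min b b'} \<times> {max c c'..min d d'}" by auto
  then show ?thesis unfolding rectangle_def by blast
qed

lemma ne_chain_Nil: "ne_chain M f []"
proof -
  have "rectangle {}" unfolding rectangle_def by (intro exI[of _ 1] exI[of _ 0]) auto
  then have "rectangle hull {} = {}" by (rule hull_same)
  then show ?thesis by (simp add: ne_chain_def is_chain_def)
qed

lemma finite_ne_chains: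
  assumes "finite M"
  shows "finite {cs. ne_chain M f cs}"
proof (rule finite_subset[OF _ finite_subset_distinct[OF assms]])
  show "{cs. ne_chain M f cs} \<subseteq> {cs. set cs \<subseteq> M \<and> distinct cs}"
  proof clarify
    fix cs assume *: "ne_chain M f cs"
    have "sorted_wrt (\<lambda>c c'. fst c < fst c' \<and> snd c < snd c') cs"
      using * unfolding ne_chain_def
      by (subst (asm) successively_conv_sorted_wrt) (auto intro!: transpI)
    then have "distinct cs" by (induction cs) auto
    moreover have "set cs \<subseteq> M" using * by (auto simp: ne_chain_def is_chain_def nonzero_cells_def)
    ultimately show "set cs \<subseteq> M \<and> distinct cs" by blast
  qed
qed

end

theory Submission
  imports Defs "HOL-Library.Infinite_Set"
begin

text \<open>
  Whether a filling has an ne-chain of a given length depends only on the set of its nonzero cells.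
  Fillings with non-negative integers and given row sums are therefore counted by a triangular system
  in the numbers of sets of cells with given row counts, so a statement about the former implies one
  about the latter. Standardization turns integer fillings of a rectangle into permutations. Knuth
  moves keep the longest increasing subsequence in every interval of values, dual Knuth moves in
  every interval of positions, and the two kinds of moves are realized by commuting involutions. Every
  permutation is connected by moves of both kinds to its rotation by 180 degrees, since both are
  connected to the same direct sum of decreasing blocks. As all classes of the one kind meet all
  classes of the other kind inside a two-sided class equally often, there is a bijection that keeps
  the longest chains in the row intervals and reverses the order of those in the column intervals.
  Applied first to all columns and then to all but the last one, it keeps the former and shifts the
  latter by one column.

  In a moon polyomino let \<open>R\<close> be the maximal rectangle whose rows are those of a given column, and
  suppose that this column is the leftmost one of \<open>R\<close>. A maximal rectangle of the polyomino meets \<open>R\<close>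
  either in full rows or in full columns other than the given one. Hence the given column can be
  moved to the right end of \<open>R\<close>, and repeated moves sort the columns by size. If only the total
  number of nonzero cells matters, the rows can be sorted, too.
\<close>

section \<open>Longest ne-chains of point sets\<close>

text \<open>A 0-1-filling read row by row is a word that decreases strictly in each row, but longest
  increasing subsequences only show whether a word decreases weakly, since a repeated letter is
  numbered like a descent. Nothing ensures that the bijection on words respects strictness; the
  detour over fillings with non-negative integers repairs this. A second limit shapes all
  statements: only strips are controlled, that is all columns over an interval of rows, or all rows
  over an interval of columns. This suffices because the part of a chain inside a block of columns
  can be replaced by a chain of the same rows (\<open>max_ne_glue\<close>). The common form of a
  permutation and its rotation has this origin: column insertion leads to the column word of a
  tableau, and the inverse of such a permutation reduces to decreasing blocks whose lengths are the
  column lengths. The block permutation is an involution, so the second reduction amounts to dual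
  moves. Rotation reverses the sequence of blocks; what remains is the exchange of two adjacent
  blocks.\<close>

definition ne_less :: "'a::linorder \<times> 'b::linorder \<Rightarrow> 'a \<times> 'b \<Rightarrow> bool" where
  "ne_less c d \<longleftrightarrow> fst c < fst d \<and> snd c < snd d"

definition ne_comparable :: "'a::linorder \<times> 'b::linorder \<Rightarrow> 'a \<times> 'b \<Rightarrow> bool" where
  "ne_comparable c d \<longleftrightarrow> ne_less c d \<or> ne_less d c"

text \<open>Chains are sets with a symmetric relation on their elements: transposition keeps this
  relation, and so does rotation by 180 degrees, which reverses \<open>ne_less\<close>.\<close>

definition ne_set :: "('a::linorder \<times> 'b::linorder) set \<Rightarrow> bool" where
  "ne_set X \<longleftrightarrow> (\<forall>c\<in>X. \<forall>d\<in>X. c \<noteq> d \<longrightarrow> ne_comparable c d)"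

definition max_ne :: "('a::linorder \<times> 'b::linorder) set \<Rightarrow> nat" where
  "max_ne S = Max (card ` {X. X \<subseteq> S \<and> ne_set X})"

definition ord_convex :: "'a::linorder set \<Rightarrow> bool" where
  "ord_convex J \<longleftrightarrow> (\<forall>x\<in>J. \<forall>y\<in>J. \<forall>z. x \<le> z \<and> z \<le> y \<longrightarrow> z \<in> J)"

lemma ord_convexD: "ord_convex J \<Longrightarrow> x \<in> J \<Longrightarrow> y \<in> J \<Longrightarrow> x \<le> z \<Longrightarrow> z \<le> y \<Longrightarrow> z \<in> J"
  unfolding ord_convex_def by blast

lemma ord_convex_Int: "ord_convex I \<Longrightarrow> ord_convex J \<Longrightarrow> ord_convex (I \<inter> J)"
  unfolding ord_convex_def by blast

lemma ord_convex_atLeastAtMost [simp]: "ord_convex {a..b}"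
  unfolding ord_convex_def by auto

lemma ne_comparable_irrefl [simp]: "\<not> ne_comparable c c"
  by (simp add: ne_comparable_def ne_less_def)

lemma ne_comparable_sym: "ne_comparable c d \<longleftrightarrow> ne_comparable d c"
  by (auto simp: ne_comparable_def)

lemma ne_comparable_Pair:
  "ne_comparable (a, b) (c, d) \<longleftrightarrow> a < c \<and> b < d \<or> c < a \<and> d < b"
  by (auto simp: ne_comparable_def ne_less_def)

lemma ne_set_subset: "ne_set X \<Longrightarrow> Y \<subseteq> X \<Longrightarrow> ne_set Y"
  unfolding ne_set_def by blast

lemma ne_set_less_iff:
  "ne_set X \<Longrightarrow> c \<in> X \<Longrightarrow> d \<in> X \<Longrightarrow> fst c < fst d \<longleftrightarrow> snd c < snd d"
  unfolding ne_set_def ne_comparable_def ne_less_def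
  by (metis less_asym less_irrefl)

lemma finite_ne_subsets: "finite S \<Longrightarrow> finite {X. X \<subseteq> S \<and> ne_set X}"
  by (rule finite_subset[of _ "Pow S"]) auto

lemma max_ne_ge: "finite S \<Longrightarrow> X \<subseteq> S \<Longrightarrow> ne_set X \<Longrightarrow> card X \<le> max_ne S"
  unfolding max_ne_def by (rule Max_ge) (auto intro: finite_ne_subsets)

lemma max_ne_witness:
  assumes "finite S" obtains X where "X \<subseteq> S" "ne_set X" "card X = max_ne S"
proof -
  have "{} \<in> {X. X \<subseteq> S \<and> ne_set X}" by (simp add: ne_set_def)
  then have "max_ne S \<in> card ` {X. X \<subseteq> S \<and> ne_set X}"
    unfolding max_ne_def using finite_ne_subsets[OF assms] by (intro Max_in) auto
  then show ?thesis using that by auto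
qed

lemma max_ne_le:
  assumes "finite S" "finite T"
    and "\<And>X. X \<subseteq> S \<Longrightarrow> ne_set X \<Longrightarrow> \<exists>Y\<subseteq>T. ne_set Y \<and> card X \<le> card Y"
  shows "max_ne S \<le> max_ne T"
proof -
  obtain X where X: "X \<subseteq> S" "ne_set X" "card X = max_ne S" using max_ne_witness[OF assms(1)] .
  then obtain Y where "Y \<subseteq> T" "ne_set Y" "card X \<le> card Y" using assms(3) by blast
  then show ?thesis using max_ne_ge[OF assms(2), of Y] X by simp
qed

lemma max_ne_mono: "finite T \<Longrightarrow> S \<subseteq> T \<Longrightarrow> max_ne S \<le> max_ne T"
  by (rule max_ne_le) (auto intro: finite_subset)

lemma max_ne_le_1_iff:
  assumes "finite S" shows "max_ne S \<le> 1 \<longleftrightarrow> (\<forall>c\<in>S. \<forall>d\<in>S. \<not> ne_less c d)"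
proof
  assume le: "max_ne S \<le> 1"
  show "\<forall>c\<in>S. \<forall>d\<in>S. \<not> ne_less c d"
  proof (intro ballI notI)
    fix c d assume cd: "c \<in> S" "d \<in> S" "ne_less c d"
    then have "c \<noteq> d" by (auto simp: ne_less_def)
    moreover have "card {c, d} \<le> max_ne S"
      using cd assms by (intro max_ne_ge) (auto simp: ne_set_def ne_comparable_def)
    ultimately show False using le by simp
  qed
next
  assume none: "\<forall>c\<in>S. \<forall>d\<in>S. \<not> ne_less c d"
  obtain X where X: "X \<subseteq> S" "ne_set X" "card X = max_ne S" using max_ne_witness[OF assms] .
  have "\<forall>c\<in>X. \<forall>d\<in>X. c = d" using X none unfolding ne_set_def ne_comparable_def by blast
  then have "card X \<le> Suc 0"
    using card_le_Suc0_iff_eq[of X] finite_subset[OF X(1) assms] by blast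
  then show "max_ne S \<le> 1" using X(3) by linarith
qed

text \<open>Comparability is irreflexive, so cells with equal images are incomparable and
  \<open>h\<close> is injective on every chain. This covers transposition, rotation, translation and
  the passage from ranks to letters.\<close>

lemma max_ne_image:
  assumes "finite S"
    and "\<And>c d. c \<in> S \<Longrightarrow> d \<in> S \<Longrightarrow> ne_comparable (h c) (h d) \<longleftrightarrow> ne_comparable c d"
  shows "max_ne (h ` S) = max_ne S"
proof (rule antisym)
  show "max_ne (h ` S) \<le> max_ne S"
  proof (rule max_ne_le)
    fix X assume X: "X \<subseteq> h ` S" "ne_set X"
    then obtain Y where Y: "Y \<subseteq> S" "inj_on h Y" "X = h ` Y"
      by (auto simp: subset_image_inj)
    have "ne_set Y"
      unfolding ne_set_def
    proof (intro ballI impI)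
      fix c d assume cd: "c \<in> Y" "d \<in> Y" "c \<noteq> d"
      then have "h c \<noteq> h d" using Y by (auto dest: inj_onD)
      then have "ne_comparable (h c) (h d)" using X Y cd by (auto simp: ne_set_def)
      then show "ne_comparable c d" using assms(2) Y cd by blast
    qed
    then show "\<exists>Y\<subseteq>S. ne_set Y \<and> card X \<le> card Y" using Y by (auto simp: card_image)
  qed (use assms in auto)
  show "max_ne S \<le> max_ne (h ` S)"
  proof (rule max_ne_le)
    fix X assume X: "X \<subseteq> S" "ne_set X"
    have inj: "inj_on h X"
    proof (rule inj_onI, rule ccontr)
      fix c d assume cd: "c \<in> X" "d \<in> X" "h c = h d" "c \<noteq> d"
      then have "ne_comparable c d" using X by (auto simp: ne_set_def)
      then have "ne_comparable (h c) (h d)" using assms(2)[of c d] X cd by blast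
      then show False using cd by simp
    qed
    have "ne_set (h ` X)" using X assms(2) unfolding ne_set_def by (auto; metis subsetD)
    then show "\<exists>Y\<subseteq>h ` S. ne_set Y \<and> card X \<le> card Y"
      using X inj by (intro exI[of _ "h ` X"]) (auto simp: card_image)
  qed (use assms in auto)
qed

lemma max_ne_swap: "finite S \<Longrightarrow> max_ne (prod.swap ` S) = max_ne S"
  by (rule max_ne_image) (auto simp: ne_comparable_Pair)

text \<open>The part of a chain inside \<open>T\<close> lies in the rows \<open>J\<close> from its
  lowest to its highest cell, and a chain of \<open>T'\<close> in the same rows can take its place:
  the remaining cells in \<open>L\<close> are left of \<open>T\<close> and hence below
  \<open>J\<close>, those in \<open>U\<close> are right of \<open>T\<close> and hence above
  \<open>J\<close>.\<close>

lemma max_ne_glue_le: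
  fixes L T U T' :: "('a::linorder \<times> 'b::linorder) set"
  assumes fin: "finite (L \<union> T \<union> U \<union> T')"
    and LT: "\<And>c d. c \<in> L \<Longrightarrow> d \<in> T \<union> T' \<Longrightarrow> fst c < fst d"
    and TU: "\<And>c d. c \<in> T \<union> T' \<Longrightarrow> d \<in> U \<Longrightarrow> fst c < fst d"
    and eq: "\<And>J. ord_convex J \<Longrightarrow> max_ne (T \<inter> UNIV \<times> J) \<le> max_ne (T' \<inter> UNIV \<times> J)"
  shows "max_ne (L \<union> T \<union> U) \<le> max_ne (L \<union> T' \<union> U)"
proof (rule max_ne_le)
  fix X assume X: "X \<subseteq> L \<union> T \<union> U" "ne_set X"
  define XT where "XT = X \<inter> T"
  have finXT: "finite XT" using fin by (auto simp: XT_def)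
  show "\<exists>Y\<subseteq>L \<union> T' \<union> U. ne_set Y \<and> card X \<le> card Y"
  proof (cases "XT = {}")
    case True
    then have "X \<subseteq> L \<union> T' \<union> U" using X by (auto simp: XT_def)
    then show ?thesis using X by blast
  next
    case False
    define J where "J = {Min (snd ` XT)..Max (snd ` XT)}"
    have XTJ: "XT \<subseteq> T \<inter> UNIV \<times> J"
    proof
      fix c assume c: "c \<in> XT"
      then have "snd c \<in> J" using finXT by (simp add: J_def)
      then show "c \<in> T \<inter> UNIV \<times> J" using c by (cases c) (auto simp: XT_def)
    qed
    have "ne_set XT" using X ne_set_subset unfolding XT_def by blast
    then have "card XT \<le> max_ne (T \<inter> UNIV \<times> J)"
      using XTJ fin by (intro max_ne_ge) auto
    also have "\<dots> \<le> max_ne (T' \<inter> UNIV \<times> J)" by (rule eq) (simp add: J_def)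
    finally have "card XT \<le> max_ne (T' \<inter> UNIV \<times> J)" .
    then obtain Z where Z: "Z \<subseteq> T' \<inter> UNIV \<times> J" "ne_set Z" "card XT \<le> card Z"
    proof -
      have "finite (T' \<inter> UNIV \<times> J)" using fin by blast
      then show ?thesis using \<open>card XT \<le> max_ne (T' \<inter> UNIV \<times> J)\<close> that
        by (metis max_ne_witness)
    qed
    have "Min (snd ` XT) \<in> snd ` XT" "Max (snd ` XT) \<in> snd ` XT"
      using finXT False by (simp_all add: Min_in Max_in)
    then obtain lo hi where lo: "lo \<in> XT" "snd lo = Min (snd ` XT)" and hi: "hi \<in> XT" "snd hi = Max (snd ` XT)"
      by (metis imageE)
    define Y where "Y = (X - T) \<union> Z"
    have cmpL: "ne_comparable c z" if "c \<in> X - T" "c \<in> L" "z \<in> Z" for c z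
    proof -
      have "fst c < fst lo" using LT that lo by (auto simp: XT_def)
      then have "snd c < snd lo" using ne_set_less_iff[OF X(2)] that lo by (auto simp: XT_def)
      also have "snd lo \<le> snd z" using Z that lo by (auto simp: J_def)
      finally have "snd c < snd z" .
      moreover have "fst c < fst z" using LT that Z by blast
      ultimately show ?thesis by (simp add: ne_comparable_def ne_less_def)
    qed
    have cmpU: "ne_comparable c z" if "c \<in> X - T" "c \<in> U" "z \<in> Z" for c z
    proof -
      have "fst hi < fst c" using TU that hi by (auto simp: XT_def)
      then have "snd hi < snd c" using ne_set_less_iff[OF X(2)] that hi by (auto simp: XT_def)
      moreover have "snd z \<le> snd hi" using Z that hi by (auto simp: J_def)
      ultimately have "snd z < snd c" by simp
      moreover have "fst z < fst c" using TU that Z by blast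
      ultimately show ?thesis by (simp add: ne_comparable_def ne_less_def)
    qed
    have cmp: "ne_comparable c z" if "c \<in> X - T" "z \<in> Z" for c z
      using cmpL cmpU that X by blast
    have "ne_set Y"
      unfolding Y_def ne_set_def
    proof (intro ballI impI)
      fix c d assume "c \<in> X - T \<union> Z" "d \<in> X - T \<union> Z" "c \<noteq> d"
      then show "ne_comparable c d"
        using cmp[of c d] cmp[of d c] X(2) Z(2) unfolding ne_set_def
        by (metis Diff_iff Un_iff ne_comparable_sym)
    qed
    moreover have "card X \<le> card Y"
    proof -
      have finX: "finite X" using X fin by (meson finite_Un finite_subset)
      have finZ: "finite Z" using Z fin by (meson finite_Int finite_Un finite_subset)
      have "(X - T) \<inter> Z = {}" using cmp ne_comparable_irrefl by blast
      then have "card Y = card (X - T) + card Z"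
        unfolding Y_def using finX finZ by (intro card_Un_disjoint) auto
      moreover have "card X = card (X - T) + card XT"
        using card_Int_Diff[OF finX, of T] by (simp add: XT_def)
      ultimately show ?thesis using Z by simp
    qed
    moreover have "Y \<subseteq> L \<union> T' \<union> U" using X Z by (auto simp: Y_def)
    ultimately show ?thesis by blast
  qed
qed (use fin in auto)

lemma max_ne_glue:
  fixes L T U T' :: "('a::linorder \<times> 'b::linorder) set"
  assumes "finite (L \<union> T \<union> U \<union> T')"
    and "\<And>c d. c \<in> L \<Longrightarrow> d \<in> T \<union> T' \<Longrightarrow> fst c < fst d"
    and "\<And>c d. c \<in> T \<union> T' \<Longrightarrow> d \<in> U \<Longrightarrow> fst c < fst d"
    and "\<And>J. ord_convex J \<Longrightarrow> max_ne (T \<inter> UNIV \<times> J) = max_ne (T' \<inter> UNIV \<times> J)"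
  shows "max_ne (L \<union> T \<union> U) = max_ne (L \<union> T' \<union> U)"
proof (rule antisym)
  show "max_ne (L \<union> T \<union> U) \<le> max_ne (L \<union> T' \<union> U)"
    using assms by (intro max_ne_glue_le) simp_all
  show "max_ne (L \<union> T' \<union> U) \<le> max_ne (L \<union> T \<union> U)"
    using assms by (intro max_ne_glue_le) (simp_all add: Un_commute Un_assoc Un_left_commute disj_commute)
qed

lemma max_ne_glue_rows:
  fixes L T U T' :: "('a::linorder \<times> 'b::linorder) set"
  assumes fin: "finite (L \<union> T \<union> U \<union> T')"
    and "\<And>c d. c \<in> L \<Longrightarrow> d \<in> T \<union> T' \<Longrightarrow> snd c < snd d"
    and "\<And>c d. c \<in> T \<union> T' \<Longrightarrow> d \<in> U \<Longrightarrow> snd c < snd d"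
    and eq: "\<And>A. ord_convex A \<Longrightarrow> max_ne (T \<inter> A \<times> UNIV) = max_ne (T' \<inter> A \<times> UNIV)"
  shows "max_ne (L \<union> T \<union> U) = max_ne (L \<union> T' \<union> U)"
proof -
  let ?s = "(`) prod.swap :: _ \<Rightarrow> ('b \<times> 'a) set"
  have sw: "?s S \<inter> UNIV \<times> A = ?s (S \<inter> A \<times> UNIV)" for S and A :: "'a set" by auto
  have "max_ne (?s L \<union> ?s T \<union> ?s U) = max_ne (?s L \<union> ?s T' \<union> ?s U)"
  proof (rule max_ne_glue)
    show "max_ne (?s T \<inter> UNIV \<times> A) = max_ne (?s T' \<inter> UNIV \<times> A)" if "ord_convex A" for A
      unfolding sw using fin eq[OF that] by (simp add: max_ne_swap)
    show "fst c < fst d" if "c \<in> ?s L" "d \<in> ?s T \<union> ?s T'" for c d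
      using that assms(2) by fastforce
    show "fst c < fst d" if "c \<in> ?s T \<union> ?s T'" "d \<in> ?s U" for c d
      using that assms(3) by fastforce
  qed (use fin in auto)
  then have "max_ne (?s (L \<union> T \<union> U)) = max_ne (?s (L \<union> T' \<union> U))" by (simp add: image_Un)
  then show ?thesis using fin by (simp add: max_ne_swap)
qed

section \<open>Knuth moves and dual Knuth moves on permutations\<close>

definition graph :: "nat \<Rightarrow> (nat \<Rightarrow> 'a) \<Rightarrow> (nat \<times> 'a) set" where
  "graph N w = (\<lambda>i. (i, w i)) ` {..<N}"

definition between :: "nat \<Rightarrow> nat \<Rightarrow> nat \<Rightarrow> bool" where
  "between x y z \<longleftrightarrow> x < y \<and> y < z \<or> z < y \<and> y < x"

text \<open>A median at an end of the window witnesses the exchange of the other two entries: 213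
  and 231 are exchanged, and so are 132 and 312. Monotone windows stay fixed. The window alone
  decides, so the move is a total function and can be an involution.\<close>

definition knuth_swap :: "nat \<Rightarrow> (nat \<Rightarrow> nat) \<Rightarrow> nat \<Rightarrow> nat" where
  "knuth_swap i w =
     (if between (w (i + 1)) (w i) (w (i + 2)) then transpose (i + 1) (i + 2)
      else if between (w i) (w (i + 2)) (w (i + 1)) then transpose i (i + 1) else id)"

definition knuth :: "nat \<Rightarrow> (nat \<Rightarrow> nat) \<Rightarrow> nat \<Rightarrow> nat" where
  "knuth i w = w \<circ> knuth_swap i w"

definition dual_knuth :: "nat \<Rightarrow> (nat \<Rightarrow> nat) \<Rightarrow> nat \<Rightarrow> nat" where
  "dual_knuth j w = inv (knuth j (inv w))"

lemma between_sym: "between x y z = between z y x"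
  by (auto simp: between_def)

lemma between_imp: "between x y z \<Longrightarrow> \<not> between y x z \<and> \<not> between x z y \<and> \<not> between z x y \<and> \<not> between y z x"
  by (auto simp: between_def)

lemma knuth_swap_permutes: "i + 2 < N \<Longrightarrow> knuth_swap i w permutes {..<N}"
  unfolding knuth_swap_def by (auto intro!: permutes_swap_id permutes_id)

lemma knuth_swap_invol [simp]: "knuth_swap i w \<circ> knuth_swap i w = id"
  unfolding knuth_swap_def by auto

lemma inv_knuth_swap [simp]: "inv (knuth_swap i w) = knuth_swap i w"
  by (rule inv_unique_comp) simp_all

lemma bij_knuth_swap: "bij (knuth_swap i w)"
  by (rule o_bij[of "knuth_swap i w"]) simp_all

lemma knuth_permutes: "w permutes {..<N} \<Longrightarrow> i + 2 < N \<Longrightarrow> knuth i w permutes {..<N}"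
  unfolding knuth_def by (intro permutes_compose knuth_swap_permutes)

lemma dual_knuth_permutes: "w permutes {..<N} \<Longrightarrow> i + 2 < N \<Longrightarrow> dual_knuth i w permutes {..<N}"
  unfolding dual_knuth_def by (intro permutes_inv knuth_permutes)

lemma knuth_swap_cong:
  assumes "\<And>a b. a \<in> {i, i+1, i+2} \<Longrightarrow> b \<in> {i, i+1, i+2} \<Longrightarrow> w a < w b \<longleftrightarrow> u a < u b"
  shows "knuth_swap i w = knuth_swap i u"
proof -
  have "between (w (i + 1)) (w i) (w (i + 2)) = between (u (i + 1)) (u i) (u (i + 2))"
    "between (w i) (w (i + 2)) (w (i + 1)) = between (u i) (u (i + 2)) (u (i + 1))"
    unfolding between_def using assms by auto
  then show ?thesis unfolding knuth_swap_def by simp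
qed

text \<open>The witness keeps its place and \<open>between\<close> is symmetric in the two exchanged
  values, so the moved window selects the same exchange again.\<close>

lemma knuth_swap_knuth [simp]: "knuth_swap i (knuth i w) = knuth_swap i w"
proof -
  consider "between (w (i + 1)) (w i) (w (i + 2))" | "between (w i) (w (i + 2)) (w (i + 1))"
    | "\<not> between (w (i + 1)) (w i) (w (i + 2))" "\<not> between (w i) (w (i + 2)) (w (i + 1))" by blast
  then show ?thesis
  proof cases
    case 1
    then have *: "knuth_swap i w = transpose (i + 1) (i + 2)" by (simp add: knuth_swap_def)
    show ?thesis unfolding knuth_def * using 1
      by (simp add: knuth_swap_def transpose_def between_sym)
  next
    case 2
    then have *: "knuth_swap i w = transpose i (i + 1)" using between_imp[OF 2]
      by (simp add: knuth_swap_def)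
    show ?thesis unfolding knuth_def * using 2 between_imp[OF 2]
      by (simp add: knuth_swap_def transpose_def between_sym)
  next
    case 3
    then have *: "knuth_swap i w = id" by (simp add: knuth_swap_def)
    show ?thesis unfolding knuth_def * by (simp add: *)
  qed
qed

lemma knuth_knuth [simp]: "knuth i (knuth i w) = w"
proof -
  have "knuth i (knuth i w) = w \<circ> (knuth_swap i w \<circ> knuth_swap i w)"
    by (simp add: knuth_def[of i "knuth i w"]) (simp add: knuth_def comp_assoc)
  then show ?thesis by simp
qed

lemma dual_knuth_dual_knuth: "bij w \<Longrightarrow> dual_knuth j (dual_knuth j w) = w"
  unfolding dual_knuth_def
  by (metis bij_comp bij_imp_bij_inv bij_knuth_swap inv_inv_eq knuth_def knuth_knuth)

text \<open>A swap of two adjacent positions performed by \<^term>\<open>knuth i\<close> is witnessed by the third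
  position of the window, so it is not seen by any set of values that meets the window in at most
  two points.\<close>

lemma knuth_swap_keeps_order:
  assumes "bij w" and "\<not> w ` {i, i+1, i+2} \<subseteq> V" "ord_convex V" "x \<in> V" "y \<in> V"
  shows "knuth_swap i w (inv w x) < knuth_swap i w (inv w y) \<longleftrightarrow> inv w x < inv w y"
proof -
  define a b where "a = inv w x" and "b = inv w y"
  have ab: "w a = x" "w b = y" using assms(1) by (simp_all add: a_def b_def bij_is_surj surj_f_inv_f)
  have V: "u \<in> V" if "between x u y" for u
    using that assms(3-5) unfolding between_def by (meson less_imp_le ord_convexD)
  consider (1) "between (w (i + 1)) (w i) (w (i + 2))" | (2) "between (w i) (w (i + 2)) (w (i + 1))"
    | (3) "\<not> between (w (i + 1)) (w i) (w (i + 2))" "\<not> between (w i) (w (i + 2)) (w (i + 1))" by blast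
  then have "knuth_swap i w a < knuth_swap i w b \<longleftrightarrow> a < b"
  proof cases
    case 1
    then have *: "knuth_swap i w = transpose (i + 1) (i + 2)" by (simp add: knuth_swap_def)
    have "\<not> (a = i + 1 \<and> b = i + 2)" "\<not> (a = i + 2 \<and> b = i + 1)"
      using 1 V[of "w i"] assms(2,4,5) ab by (auto simp: between_sym)
    then show ?thesis unfolding * by (auto simp: transpose_def)
  next
    case 2
    then have *: "knuth_swap i w = transpose i (i + 1)" using between_imp[OF 2]
      by (simp add: knuth_swap_def)
    have "\<not> (a = i \<and> b = i + 1)" "\<not> (a = i + 1 \<and> b = i)"
      using 2 V[of "w (i + 2)"] assms(2,4,5) ab by (auto simp: between_sym)
    then show ?thesis unfolding * by (auto simp: transpose_def)
  next
    case 3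
    then show ?thesis by (simp add: knuth_swap_def)
  qed
  then show ?thesis by (simp add: a_def b_def)
qed

lemma inv_knuth: "bij w \<Longrightarrow> inv (knuth i w) = knuth_swap i w \<circ> inv w"
  unfolding knuth_def by (simp add: o_inv_distrib bij_knuth_swap)

lemma dual_knuth_conv: "bij w \<Longrightarrow> dual_knuth j w = knuth_swap j (inv w) \<circ> w"
  unfolding dual_knuth_def by (simp add: inv_knuth bij_imp_bij_inv inv_inv_eq)

lemma ord_convex_three: "ord_convex {j, j + 1, j + 2 :: nat}"
  unfolding ord_convex_def by auto

text \<open>If the values in the window of positions are not exactly those of the window of values,
  neither move changes the relative order that the other one inspects. Otherwise both moves act on
  the same pattern of three letters, and its six possibilities are checked.\<close>

lemma knuth_dual_knuth_commute:
  assumes w: "bij w"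
  shows "knuth i (dual_knuth j w) = dual_knuth j (knuth i w)"
proof (cases "w ` {i, i+1, i+2} = {j, j+1, j+2}")
  case False
  have c3: "card (w ` {i, i+1, i+2}) = 3"
    by (subst card_image[OF inj_on_subset[OF bij_is_inj[OF w] subset_UNIV]]) simp
  have sub: "w ` {i, i+1, i+2} \<subseteq> {j, j+1, j+2} \<Longrightarrow> w ` {i, i+1, i+2} = {j, j+1, j+2}"
    using c3 by (intro card_subset_eq) simp_all
  have sub': "inv w ` {j, j+1, j+2} \<subseteq> {i, i+1, i+2} \<Longrightarrow> w ` {i, i+1, i+2} = {j, j+1, j+2}"
  proof -
    assume "inv w ` {j, j+1, j+2} \<subseteq> {i, i+1, i+2}"
    then have "w ` inv w ` {j, j+1, j+2} \<subseteq> w ` {i, i+1, i+2}" by (rule image_mono)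
    then have "{j, j+1, j+2} \<subseteq> w ` {i, i+1, i+2}"
      by (simp only: image_f_inv_f[OF bij_is_surj[OF w]])
    then show ?thesis using c3 by (intro card_subset_eq[symmetric]) simp_all
  qed
  have 1: "knuth_swap j (inv (knuth i w)) = knuth_swap j (inv w)"
    using knuth_swap_keeps_order[OF w _ ord_convex_three[of j], of i] sub False
    by (intro knuth_swap_cong) (auto simp: inv_knuth[OF w])
  have 2: "knuth_swap i (dual_knuth j w) = knuth_swap i w"
    using knuth_swap_keeps_order[OF bij_imp_bij_inv[OF w] _ ord_convex_three[of i], of j] sub' False w
    by (intro knuth_swap_cong) (auto simp: dual_knuth_conv[OF w] inv_inv_eq)
  have bk: "bij (knuth i w)" unfolding knuth_def by (intro bij_comp bij_knuth_swap w)
  show ?thesis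
    unfolding knuth_def[of i "dual_knuth j w"] 2 dual_knuth_conv[OF bk] 1
    by (simp add: dual_knuth_conv[OF w] knuth_def comp_assoc)
next
  case True
  have bk: "bij (knuth i w)" unfolding knuth_def by (intro bij_comp bij_knuth_swap w)
  obtain a b c where abc: "w i = a" "w (i + 1) = b" "w (i + 2) = c" by blast
  have eq: "{a, b, c} = {j, j + 1, j + 2}" using True abc by simp
  have invs: "inv w a = i" "inv w b = i + 1" "inv w c = i + 2"
    using w abc by (auto simp: bij_is_inj inv_f_f)
  have cases: "a = j \<and> b = j + 1 \<and> c = j + 2 \<or> a = j \<and> b = j + 2 \<and> c = j + 1 \<or>
      a = j + 1 \<and> b = j \<and> c = j + 2 \<or> a = j + 1 \<and> b = j + 2 \<and> c = j \<or>
      a = j + 2 \<and> b = j \<and> c = j + 1 \<or> a = j + 2 \<and> b = j + 1 \<and> c = j"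
  proof -
    have "a \<in> {j, j + 1, j + 2}" "b \<in> {j, j + 1, j + 2}" "c \<in> {j, j + 1, j + 2}"
      using eq by blast+
    moreover have "a \<noteq> b" "b \<noteq> c" "a \<noteq> c"
      using invs by auto
    ultimately show ?thesis by (elim insertE emptyE; simp)
  qed
  have tr: "w \<circ> transpose x y = transpose (w x) (w y) \<circ> w" for x y
    using w by (auto simp: fun_eq_iff transpose_def bij_is_inj inj_eq)
  have L: "knuth i (dual_knuth j w) =
      knuth_swap j (inv w) \<circ> w \<circ> knuth_swap i (knuth_swap j (inv w) \<circ> w)"
    by (simp add: knuth_def dual_knuth_conv[OF w])
  have R: "dual_knuth j (knuth i w) =
      knuth_swap j (knuth_swap i w \<circ> inv w) \<circ> w \<circ> knuth_swap i w"
    by (simp add: dual_knuth_conv[OF bk] inv_knuth[OF w]) (simp add: knuth_def comp_assoc)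
  have tr': "f \<circ> w \<circ> transpose x y = f \<circ> transpose (w x) (w y) \<circ> w" for f :: "nat \<Rightarrow> nat" and x y
    by (simp only: comp_assoc tr)
  have fin: "f \<circ> w = g \<circ> w" if "\<And>x. f x = g x" for f g :: "nat \<Rightarrow> nat"
    using that by (simp add: fun_eq_iff)
  from cases show ?thesis
    by (elim disjE conjE; use abc invs in \<open>simp add: L R knuth_swap_def between_def transpose_def\<close>)
      (simp_all add: tr', (rule fin, (auto simp: transpose_def)[1])+)
qed

lemma finite_graph [simp]: "finite (graph N w)"
  by (simp add: graph_def)

text \<open>Only a chain containing both exchanged entries is destroyed. The witness has a value
  between theirs, so it can replace one of them, and by convexity its value stays in
  \<open>B\<close>. Equality follows because the move is an involution.\<close>

lemma max_ne_knuth_le: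
  assumes w: "w permutes {..<N}" and i: "i + 2 < N" and B: "ord_convex B"
  shows "max_ne (graph N w \<inter> UNIV \<times> B) \<le> max_ne (graph N (knuth i w) \<inter> UNIV \<times> B)"
proof (rule max_ne_le)
  let ?u = "knuth i w" and ?p = "knuth_swap i w"
  fix X assume X: "X \<subseteq> graph N w \<inter> UNIV \<times> B" "ne_set X"
  have finX: "finite X" using X by (meson finite_Int finite_graph finite_subset)
  have pN: "?p x < N" if "x < N" for x
    using permutes_in_image[OF knuth_swap_permutes[OF i, of w], of x] that by simp
  have pp: "?p (?p x) = x" for x by (metis comp_apply id_apply knuth_swap_invol)
  have u: "?u x = w (?p x)" for x by (simp add: knuth_def)
  have inj: "w x = w y \<longleftrightarrow> x = y" for x y using permutes_inj[OF w] by (simp add: inj_eq)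
  have Xw: "snd c = w (fst c)" "fst c < N" "w (fst c) \<in> B" if "c \<in> X" for c
    using subsetD[OF X(1) that] by (auto simp: graph_def)
  have mono: "w a < w b" if "(a, w a) \<in> X" "(b, w b) \<in> X" "a < b" for a b
    using ne_set_less_iff[OF X(2) that(1,2)] that(3) by simp
  show "\<exists>Y\<subseteq>graph N ?u \<inter> UNIV \<times> B. ne_set Y \<and> card X \<le> card Y"
  proof (cases "\<exists>a b. (a, w a) \<in> X \<and> (b, w b) \<in> X \<and> a < b \<and> ?p b < ?p a")
    case False
    define h where "h = (\<lambda>c. (?p (fst c), snd c) :: nat \<times> nat)"
    have "h ` X \<subseteq> graph N ?u \<inter> UNIV \<times> B"
    proof
      fix d assume "d \<in> h ` X"
      then obtain c where "c \<in> X" "d = h c" by blast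
      then have "d = (?p (fst c), ?u (?p (fst c)))" "?p (fst c) < N" "snd d \<in> B"
        using Xw[of c] pN by (auto simp: h_def u pp)
      then show "d \<in> graph N ?u \<inter> UNIV \<times> B" by (auto simp: graph_def)
    qed
    moreover have "ne_set (h ` X)"
      unfolding ne_set_def
    proof (intro ballI impI)
      have *: "ne_less (h c) (h d)" if "c \<in> X" "d \<in> X" "fst c < fst d" for c d
      proof -
        have "?p (fst c) \<noteq> ?p (fst d)" using that pp by (metis less_irrefl)
        moreover have "\<not> ?p (fst d) < ?p (fst c)" using False that Xw by (metis prod.collapse)
        ultimately show ?thesis using ne_set_less_iff[OF X(2) that(1,2)] that by (simp add: h_def ne_less_def)
      qed
      fix c d assume cd: "c \<in> h ` X" "d \<in> h ` X" "c \<noteq> d"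
      then obtain c' d' where cd': "c' \<in> X" "d' \<in> X" "c = h c'" "d = h d'" by blast
      then have "fst c' \<noteq> fst d'" using cd Xw by (metis prod.collapse)
      then show "ne_comparable c d" using *[of c' d'] *[of d' c'] cd'
        unfolding ne_comparable_def by (metis linorder_neqE_nat)
    qed
    moreover have "inj_on h X"
      by (rule inj_onI) (metis Pair_inject h_def pp prod.collapse)
    ultimately show ?thesis by (intro exI[of _ "h ` X"]) (simp add: card_image)
  next
    case True
    then obtain a b where ab: "(a, w a) \<in> X" "(b, w b) \<in> X" "a < b" "?p b < ?p a" by blast
    have wab: "w a < w b" using mono ab by blast
    have Bval: "w a \<in> B" "w b \<in> B" using Xw(3)[OF ab(1)] Xw(3)[OF ab(2)] by simp_all
    \<comment> \<open>This keeps the witness out of \<open>X\<close>, so that adding it really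
      increases the number of cells.\<close>
    have nX: "(x, w x) \<notin> X" if "x < a \<and> w a < w x \<or> b < x \<and> w x < w b" for x
      using mono[of x a] mono[of b x] ab that by (metis less_asym)
    \<comment> \<open>\<open>e < f\<close> are the positions after the move of the two entries that
      replace the pair at \<open>a\<close> and \<open>b\<close>: the witness and the larger entry if
      the witness stands before the pair, the smaller entry and the witness if it stands
      behind.\<close>
    obtain e f where ef: "e < N" "f < N" "e < f" "w (?p e) < w (?p f)" "w a \<le> w (?p e)" "w (?p f) \<le> w b"
        "\<And>x. (x, w x) \<in> X \<Longrightarrow> x < a \<Longrightarrow> x < e \<and> ?p x = x"
        "\<And>x. (x, w x) \<in> X \<Longrightarrow> b < x \<Longrightarrow> f < x \<and> ?p x = x" and b: "b = Suc a"
    proof -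
      have "?p = id" if "\<not> between (w (i + 1)) (w i) (w (i + 2))" "\<not> between (w i) (w (i + 2)) (w (i + 1))"
        using that by (simp add: knuth_swap_def)
      moreover have "?p \<noteq> id" using ab(3,4) by auto
      ultimately have "between (w (i + 1)) (w i) (w (i + 2)) \<or> between (w i) (w (i + 2)) (w (i + 1))"
        by blast
      then consider (1) "between (w (i + 1)) (w i) (w (i + 2))"
        | (2) "\<not> between (w (i + 1)) (w i) (w (i + 2))" "between (w i) (w (i + 2)) (w (i + 1))"
        by blast
      then show ?thesis
      proof cases
        case 1
        then have p: "?p = transpose (i + 1) (i + 2)" by (simp add: knuth_swap_def)
        then have "a = i + 1" "b = i + 2" using ab by (auto simp: transpose_def split: if_splits)
        moreover have "(i, w i) \<notin> X" using nX[of i] calculation 1 wab by (auto simp: between_def)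
        ultimately show ?thesis using 1 wab i nX
          by (intro that[of i "i + 1"]) (auto simp: p transpose_def between_def less_Suc_eq)
      next
        case 2
        then have p: "?p = transpose i (i + 1)" by (simp add: knuth_swap_def)
        then have "a = i" "b = i + 1" using ab by (auto simp: transpose_def split: if_splits)
        moreover have notX: "(i + 2, w (i + 2)) \<notin> X" using nX[of "i + 2"] calculation 2 wab by (auto simp: between_def)
        have gt: "Suc (Suc i) < x" if "(x, w x) \<in> X" "Suc i < x" for x
        proof -
          have "x \<noteq> i + 2" using notX that by auto
          then show ?thesis using that by linarith
        qed
        ultimately show ?thesis using 2 wab i
          by (intro that[of "i + 1" "i + 2"]) (auto simp: p transpose_def between_def dest: gt)
      qed
    qed
    define X0 where "X0 = X - {(a, w a), (b, w b)}"
    define Y where "Y = X0 \<union> {(e, ?u e), (f, ?u f)}"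
    have X0: "c \<in> X \<and> (fst c < a \<and> fst c < e \<or> b < fst c \<and> f < fst c) \<and> ?p (fst c) = fst c" if "c \<in> X0" for c
    proof -
      have c: "c \<in> X" "c = (fst c, w (fst c))" using that Xw[of c] by (auto simp: X0_def prod_eq_iff)
      then have "fst c \<noteq> a" "fst c \<noteq> b" using that unfolding X0_def by (metis DiffE insertCI)+
      then have "fst c < a \<or> b < fst c" using b by auto
      then show ?thesis using ef(7,8)[of "fst c"] c by auto
    qed
    have cmp: "ne_comparable c (e, ?u e) \<and> ne_comparable c (f, ?u f)" if "c \<in> X0" for c
    proof -
      have c: "c \<in> X" "snd c = w (fst c)" using X0[OF that] Xw by blast+
      then have "c = (fst c, w (fst c))" by (simp add: prod_eq_iff)
      then show ?thesis
        using X0[OF that] mono[of "fst c" a] mono[of b "fst c"] ab c ef(3,4,5,6) unfolding u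
        by (cases c) (auto simp: ne_comparable_Pair)
    qed
    have "ne_set Y"
    proof -
      have "ne_comparable (e, ?u e) (f, ?u f)" using ef(3,4) by (simp add: ne_comparable_Pair u)
      moreover have "ne_set X0" using X(2) ne_set_subset unfolding X0_def by blast
      ultimately show ?thesis using cmp unfolding Y_def ne_set_def
        by (auto simp: ne_comparable_sym)
    qed
    moreover have "card X \<le> card Y"
    proof -
      have "(e, ?u e) \<notin> X0" "(f, ?u f) \<notin> X0" using cmp ne_comparable_irrefl by blast+
      then have "card Y = Suc (Suc (card X0))"
        using finX ef(3) by (simp add: Y_def X0_def)
      moreover have "card X \<le> card X0 + 2"
        using finX diff_card_le_card_Diff[of "{(a, w a), (b, w b)}" X] ab(3) by (simp add: X0_def card_insert_if split: if_splits)
      ultimately show ?thesis by simp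
    qed
    moreover have "Y \<subseteq> graph N ?u \<inter> UNIV \<times> B"
    proof -
      have "c \<in> graph N ?u \<inter> UNIV \<times> B" if "c \<in> X0" for c
      proof -
        have "c \<in> X" "?p (fst c) = fst c" using X0[OF that] by auto
        then have "c = (fst c, ?u (fst c))" "fst c < N" "snd c \<in> B"
          using Xw[of c] by (auto simp: u prod_eq_iff)
        then show ?thesis by (cases c) (auto simp: graph_def)
      qed
      moreover have "?u e \<in> B" "?u f \<in> B"
        using ef(4,5,6) ord_convexD[OF B Bval] unfolding u by auto
      ultimately show ?thesis using ef(1,2) by (auto simp: Y_def graph_def)
    qed
    ultimately show ?thesis by blast
  qed
qed auto

lemma max_ne_knuth:
  assumes w: "w permutes {..<N}" and i: "i + 2 < N" and B: "ord_convex B"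
  shows "max_ne (graph N (knuth i w) \<inter> UNIV \<times> B) = max_ne (graph N w \<inter> UNIV \<times> B)"
  using max_ne_knuth_le[OF w i B] max_ne_knuth_le[OF knuth_permutes[OF w i] i B] by simp

section \<open>Classes of permutations under the two kinds of moves\<close>

definition knuth_eq :: "nat \<Rightarrow> (nat \<Rightarrow> nat) \<Rightarrow> (nat \<Rightarrow> nat) \<Rightarrow> bool" where
  "knuth_eq N = (\<lambda>w u. \<exists>i. i + 2 < N \<and> u = knuth i w)\<^sup>*\<^sup>*"

definition dual_knuth_eq :: "nat \<Rightarrow> (nat \<Rightarrow> nat) \<Rightarrow> (nat \<Rightarrow> nat) \<Rightarrow> bool" where
  "dual_knuth_eq N = (\<lambda>w u. \<exists>j. j + 2 < N \<and> u = dual_knuth j w)\<^sup>*\<^sup>*"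

definition two_sided_eq :: "nat \<Rightarrow> (nat \<Rightarrow> nat) \<Rightarrow> (nat \<Rightarrow> nat) \<Rightarrow> bool" where
  "two_sided_eq N = (\<lambda>w u. \<exists>i. i + 2 < N \<and> (u = knuth i w \<or> u = dual_knuth i w))\<^sup>*\<^sup>*"

lemma knuth_eq_trans: "knuth_eq N u v \<Longrightarrow> knuth_eq N v w \<Longrightarrow> knuth_eq N u w"
  unfolding knuth_eq_def by (rule rtranclp_trans)

lemma dual_knuth_eq_trans: "dual_knuth_eq N u v \<Longrightarrow> dual_knuth_eq N v w \<Longrightarrow> dual_knuth_eq N u w"
  unfolding dual_knuth_eq_def by (rule rtranclp_trans)

lemma two_sided_eq_trans [trans]: "two_sided_eq N u v \<Longrightarrow> two_sided_eq N v w \<Longrightarrow> two_sided_eq N u w"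
  unfolding two_sided_eq_def by (rule rtranclp_trans)

lemma two_sided_eq_refl [simp]: "two_sided_eq N w w"
  unfolding two_sided_eq_def by simp

lemma knuth_eq_imp_two_sided_eq: "knuth_eq N w u \<Longrightarrow> two_sided_eq N w u"
  unfolding knuth_eq_def two_sided_eq_def by (rule rtranclp_mono[THEN predicate2D]) auto

lemma knuth_eq_step: "knuth_eq N w y \<Longrightarrow> i + 2 < N \<Longrightarrow> knuth_eq N w (knuth i y)"
  unfolding knuth_eq_def by (rule rtranclp.rtrancl_into_rtrancl) auto

lemma dual_knuth_eq_step: "dual_knuth_eq N w y \<Longrightarrow> i + 2 < N \<Longrightarrow> dual_knuth_eq N w (dual_knuth i y)"
  unfolding dual_knuth_eq_def by (rule rtranclp.rtrancl_into_rtrancl) auto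

lemma knuth_eq_refl [simp]: "knuth_eq N w w"
  unfolding knuth_eq_def by simp

lemma dual_knuth_eq_refl [simp]: "dual_knuth_eq N w w"
  unfolding dual_knuth_eq_def by simp

lemma knuth_eq_induct [consumes 1, case_names base step]:
  assumes "knuth_eq N w u" "P w"
    and "\<And>y i. knuth_eq N w y \<Longrightarrow> i + 2 < N \<Longrightarrow> P y \<Longrightarrow> P (knuth i y)"
  shows "P u"
  using assms unfolding knuth_eq_def by (induction rule: rtranclp_induct) auto

lemma dual_knuth_eq_induct [consumes 1, case_names base step]:
  assumes "dual_knuth_eq N w u" "P w"
    and "\<And>y i. dual_knuth_eq N w y \<Longrightarrow> i + 2 < N \<Longrightarrow> P y \<Longrightarrow> P (dual_knuth i y)"
  shows "P u"
  using assms unfolding dual_knuth_eq_def by (induction rule: rtranclp_induct) auto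

lemma two_sided_eq_induct [consumes 1, case_names base knuth dual_knuth]:
  assumes "two_sided_eq N w u" "P w"
    and "\<And>y i. two_sided_eq N w y \<Longrightarrow> i + 2 < N \<Longrightarrow> P y \<Longrightarrow> P (knuth i y)"
    and "\<And>y i. two_sided_eq N w y \<Longrightarrow> i + 2 < N \<Longrightarrow> P y \<Longrightarrow> P (dual_knuth i y)"
  shows "P u"
  using assms unfolding two_sided_eq_def by (induction rule: rtranclp_induct) auto

lemma knuth_eq_sym:
  assumes "knuth_eq N w u" shows "knuth_eq N u w"
  using assms
proof (induction rule: knuth_eq_induct)
  case (step y i)
  have "knuth_eq N (knuth i y) y" using knuth_eq_step[of N "knuth i y" "knuth i y" i] step by simp
  then show ?case using step knuth_eq_trans by blast
qed simp

lemma knuth_eq_permutes: "knuth_eq N w u \<Longrightarrow> w permutes {..<N} \<Longrightarrow> u permutes {..<N}"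
  by (induction rule: knuth_eq_induct) (auto intro: knuth_permutes)

lemma dual_knuth_eq_permutes: "dual_knuth_eq N w u \<Longrightarrow> w permutes {..<N} \<Longrightarrow> u permutes {..<N}"
  by (induction rule: dual_knuth_eq_induct) (auto intro: dual_knuth_permutes)

lemma two_sided_eq_permutes: "two_sided_eq N w u \<Longrightarrow> w permutes {..<N} \<Longrightarrow> u permutes {..<N}"
  by (induction rule: two_sided_eq_induct) (auto intro: knuth_permutes dual_knuth_permutes)

lemma dual_knuth_eq_imp_inv:
  "dual_knuth_eq N w u \<Longrightarrow> w permutes {..<N} \<Longrightarrow> knuth_eq N (inv w) (inv u)"
proof (induction rule: dual_knuth_eq_induct)
  case (step y j)
  have "y permutes {..<N}" using dual_knuth_eq_permutes step by blast
  then have "inv (dual_knuth j y) = knuth j (inv y)"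
    using step by (simp add: dual_knuth_def permutes_inv_inv[OF knuth_permutes[OF permutes_inv]])
  then show ?case using step knuth_eq_step by simp
qed simp

lemma inv_imp_dual_knuth_eq:
  assumes "knuth_eq N (inv w) u" "w permutes {..<N}" shows "dual_knuth_eq N w (inv u)"
  using assms(1)
proof (induction rule: knuth_eq_induct)
  case base
  then show ?case using assms by (simp add: permutes_inv_inv)
next
  case (step y j)
  have y: "y permutes {..<N}"
    using knuth_eq_permutes[OF _ permutes_inv[OF assms(2)]] step by blast
  then have "inv (knuth j y) = dual_knuth j (inv y)"
    using step by (simp add: dual_knuth_def permutes_inv_inv)
  then show ?case using step dual_knuth_eq_step by simp
qed

lemma dual_knuth_eq_iff:
  assumes "w permutes {..<N}" "u permutes {..<N}"
  shows "dual_knuth_eq N w u \<longleftrightarrow> knuth_eq N (inv w) (inv u)"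
  using dual_knuth_eq_imp_inv[OF _ assms(1)] inv_imp_dual_knuth_eq[OF _ assms(1), of "inv u"]
  by (auto simp: permutes_inv_inv[OF assms(2)])

lemma dual_knuth_eq_sym: "dual_knuth_eq N w u \<Longrightarrow> w permutes {..<N} \<Longrightarrow> dual_knuth_eq N u w"
  by (meson dual_knuth_eq_iff dual_knuth_eq_permutes knuth_eq_sym)

lemma dual_knuth_eq_imp_two_sided_eq: "dual_knuth_eq N w u \<Longrightarrow> two_sided_eq N w u"
  unfolding dual_knuth_eq_def two_sided_eq_def by (rule rtranclp_mono[THEN predicate2D]) auto

lemma two_sided_eq_sym:
  assumes "two_sided_eq N w u" "w permutes {..<N}" shows "two_sided_eq N u w"
  using assms(1)
proof (induction rule: two_sided_eq_induct)
  case (knuth y i)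
  have "knuth_eq N (knuth i y) y" using knuth_eq_step[of N "knuth i y" "knuth i y" i] knuth by simp
  then show ?case using knuth knuth_eq_imp_two_sided_eq two_sided_eq_trans by blast
next
  case (dual_knuth y i)
  have "y permutes {..<N}" using two_sided_eq_permutes dual_knuth assms by blast
  then have "dual_knuth_eq N (dual_knuth i y) y"
    using dual_knuth_eq_step[of N "dual_knuth i y" "dual_knuth i y" i] dual_knuth
    by (simp add: dual_knuth_dual_knuth permutes_bij)
  then show ?case using dual_knuth dual_knuth_eq_imp_two_sided_eq two_sided_eq_trans by blast
qed simp

text \<open>Since the moves commute, a dual move carries a path of Knuth moves from \<open>w\<close>
  to \<open>u\<close> along to the images, and thus maps Knuth classes to Knuth classes.\<close>

lemma knuth_eq_dual_knuth:
  assumes "knuth_eq N w u" "w permutes {..<N}" "j + 2 < N"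
  shows "knuth_eq N (dual_knuth j w) (dual_knuth j u)"
  using assms(1)
proof (induction rule: knuth_eq_induct)
  case (step y i)
  have "bij y" using knuth_eq_permutes step assms permutes_bij by blast
  then show ?case using step by (simp add: knuth_dual_knuth_commute[symmetric] knuth_eq_step)
qed simp

text \<open>The commuting involutions permute the classes of the other kind among each other, so all
  nonempty intersections of the two kinds of classes inside a two-sided class are equinumerous.\<close>

lemma card_knuth_dual_knuth_class:
  assumes "two_sided_eq N v u" "v permutes {..<N}" "w permutes {..<N}"
  shows "card {x. dual_knuth_eq N w x \<and> knuth_eq N u x} = card {x. dual_knuth_eq N w x \<and> knuth_eq N v x}"
  using assms(1)
proof (induction rule: two_sided_eq_induct)
  case (knuth y j)
  have "knuth_eq N y (knuth j y)" using knuth knuth_eq_step by simp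
  then have "knuth_eq N (knuth j y) x \<longleftrightarrow> knuth_eq N y x" for x
    by (meson knuth_eq_sym knuth_eq_trans)
  then show ?case using knuth by simp
next
  case (dual_knuth y j)
  define z where z: "z = dual_knuth j y"
  have y: "y permutes {..<N}" using two_sided_eq_permutes dual_knuth assms by blast
  have j: "j + 2 < N" by (fact dual_knuth)
  have zp: "z permutes {..<N}" using z y j by (simp add: dual_knuth_permutes)
  have dd: "dual_knuth j (dual_knuth j x) = x" if "x permutes {..<N}" for x
    using dual_knuth_dual_knuth permutes_bij that by blast
  have zy: "y = dual_knuth j z" using z dd y by simp
  have deq: "dual_knuth_eq N w (dual_knuth j x)" if "dual_knuth_eq N w x" for x
    using that j dual_knuth_eq_step by blast
  have "bij_betw (dual_knuth j) {x. dual_knuth_eq N w x \<and> knuth_eq N z x} {x. dual_knuth_eq N w x \<and> knuth_eq N y x}"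
  proof (rule bij_betw_byWitness[of _ "dual_knuth j"])
    show "\<forall>x\<in>{x. dual_knuth_eq N w x \<and> knuth_eq N z x}. dual_knuth j (dual_knuth j x) = x"
      using dd dual_knuth_eq_permutes assms(3) by blast
    show "\<forall>x\<in>{x. dual_knuth_eq N w x \<and> knuth_eq N y x}. dual_knuth j (dual_knuth j x) = x"
      using dd dual_knuth_eq_permutes assms(3) by blast
    show "dual_knuth j ` {x. dual_knuth_eq N w x \<and> knuth_eq N z x} \<subseteq> {x. dual_knuth_eq N w x \<and> knuth_eq N y x}"
      using deq knuth_eq_dual_knuth[OF _ zp j] zy by auto
    show "dual_knuth j ` {x. dual_knuth_eq N w x \<and> knuth_eq N y x} \<subseteq> {x. dual_knuth_eq N w x \<and> knuth_eq N z x}"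
      using deq knuth_eq_dual_knuth[OF _ y j] z by auto
  qed
  then show ?case using dual_knuth by (simp add: z bij_betw_same_card)
qed simp

lemma max_ne_knuth_eq:
  assumes "knuth_eq N w u" "w permutes {..<N}" "ord_convex B"
  shows "max_ne (graph N u \<inter> UNIV \<times> B) = max_ne (graph N w \<inter> UNIV \<times> B)"
  using assms(1)
proof (induction rule: knuth_eq_induct)
  case (step y i)
  have "y permutes {..<N}" using knuth_eq_permutes step assms by blast
  then show ?case using step max_ne_knuth[of y N _ B] assms by auto
qed simp

lemma graph_inv:
  assumes "w permutes {..<N}" shows "graph N (inv w) = prod.swap ` graph N w"
proof -
  have "(i, inv w i) \<in> prod.swap ` graph N w" if "i < N" for i
    using that permutes_in_image[OF permutes_inv[OF assms], of i] permutes_inverses[OF assms]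
    by (auto simp: graph_def image_iff)
  moreover have "(w i, i) \<in> graph N (inv w)" if "i < N" for i
    using that permutes_in_image[OF assms, of i] permutes_inverses[OF assms]
    by (auto simp: graph_def image_iff)
  ultimately show ?thesis by (auto simp: graph_def)
qed

text \<open>The graph of the inverse is the transposed graph, so dual moves treat intervals of
  positions as Knuth moves treat intervals of values.\<close>

lemma max_ne_dual_knuth_eq:
  assumes "dual_knuth_eq N w u" "w permutes {..<N}" "ord_convex A"
  shows "max_ne (graph N u \<inter> A \<times> UNIV) = max_ne (graph N w \<inter> A \<times> UNIV)"
proof -
  have u: "u permutes {..<N}" using assms dual_knuth_eq_permutes by blast
  have *: "max_ne (graph N v \<inter> A \<times> UNIV) = max_ne (graph N (inv v) \<inter> UNIV \<times> A)"
    if "v permutes {..<N}" for v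
  proof -
    have "prod.swap ` graph N v \<inter> UNIV \<times> A = prod.swap ` (graph N v \<inter> A \<times> UNIV)" by auto
    then show ?thesis using that by (simp add: graph_inv max_ne_swap)
  qed
  show ?thesis using max_ne_knuth_eq[OF dual_knuth_eq_imp_inv[OF assms(1,2)] permutes_inv[OF assms(2)] assms(3)]
    by (simp add: * assms u)
qed

section \<open>Permutations are two-sided equivalent to their rotations\<close>

inductive elem_plactic :: "nat list \<Rightarrow> nat list \<Rightarrow> bool" where
  yzx: "x < y \<Longrightarrow> y < z \<Longrightarrow> elem_plactic (a @ [y, z, x] @ b) (a @ [y, x, z] @ b)"
| xzy: "x < y \<Longrightarrow> y < z \<Longrightarrow> elem_plactic (a @ [x, z, y] @ b) (a @ [z, x, y] @ b)"

definition plactic :: "nat list \<Rightarrow> nat list \<Rightarrow> bool" where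
  "plactic = equivclp elem_plactic"

lemma plactic_refl [simp]: "plactic u u"
  by (simp add: plactic_def)

lemma plactic_sym: "plactic u v \<Longrightarrow> plactic v u"
  unfolding plactic_def by (rule equivclp_sym)

lemma plactic_trans [trans]: "plactic u v \<Longrightarrow> plactic v w \<Longrightarrow> plactic u w"
  unfolding plactic_def by (rule equivclp_trans)

lemma elem_plactic_context: "elem_plactic u v \<Longrightarrow> elem_plactic (c @ u @ d) (c @ v @ d)"
proof (induction rule: elem_plactic.induct)
  case (yzx x y z a b)
  then show ?case using elem_plactic.yzx[of x y z "c @ a" "b @ d"] by simp
next
  case (xzy x y z a b)
  then show ?case using elem_plactic.xzy[of x y z "c @ a" "b @ d"] by simp
qed

lemma plactic_context: "plactic u v \<Longrightarrow> plactic (c @ u @ d) (c @ v @ d)"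
  unfolding plactic_def
  by (induction rule: equivclp_induct)
    (auto intro: elem_plactic_context rtranclp.rtrancl_into_rtrancl equivclp_into_equivclp)

lemma plactic_yzx: "x < y \<Longrightarrow> y < z \<Longrightarrow> plactic [y, z, x] [y, x, z]"
  unfolding plactic_def using elem_plactic.yzx[of x y z "[]" "[]"] by (simp add: r_into_equivclp)

lemma plactic_xzy: "x < y \<Longrightarrow> y < z \<Longrightarrow> plactic [x, z, y] [z, x, y]"
  unfolding plactic_def using elem_plactic.xzy[of x y z "[]" "[]"] by (simp add: r_into_equivclp)

lemma plactic_set: "plactic u v \<Longrightarrow> mset u = mset v"
  unfolding plactic_def
proof (induction rule: equivclp_induct)
  case (step y z)
  have "mset y = mset z" if "elem_plactic y z" for y z
    using that by (induction rule: elem_plactic.induct) auto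
  then show ?case using step by metis
qed simp

text \<open>\<open>x\<close> travels to the right through \<open>Z\<close>. The letter following the
  one to be passed is the witness: it is at least \<open>y\<close>, hence above \<open>x\<close>,
  and below the letter passed.\<close>

lemma plactic_small_right:
  assumes "sorted_wrt (>) Z" "\<And>z. z \<in> set Z \<Longrightarrow> y < z" "x < y"
  shows "plactic (x # Z @ [y]) (Z @ [x, y])"
  using assms
proof (induction Z)
  case (Cons z Z)
  obtain e E where e: "Z @ [y] = e # E" by (cases "Z @ [y]") auto
  then have "e \<in> set Z \<or> e = y" by (cases Z) auto
  moreover have "x < v" "v < z" if "v \<in> set Z \<or> v = y" for v
    using that Cons.prems(1) Cons.prems(2)[of v] Cons.prems(2)[of z] Cons.prems(3) by auto
  ultimately have "x < e" "e < z" by blast+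
  then have "plactic ([] @ [x, z, e] @ E) ([] @ [z, x, e] @ E)"
    by (intro plactic_context plactic_xzy)
  then have "plactic (x # (z # Z) @ [y]) (z # x # Z @ [y])" using e by simp
  also have "plactic ([z] @ (x # Z @ [y]) @ []) ([z] @ (Z @ [x, y]) @ [])"
    using Cons by (intro plactic_context Cons.IH) auto
  then have "plactic (z # x # Z @ [y]) ((z # Z) @ [x, y])" by simp
  finally show ?case .
qed simp

text \<open>\<open>c\<close> travels to the right through \<open>Z\<close>. The letter just to its
  left is the witness: it is below \<open>c\<close> and above the letter passed.\<close>

lemma plactic_large_right:
  assumes "sorted_wrt (>) Z" "\<And>z. z \<in> set Z \<Longrightarrow> z < x" "x < c"
  shows "plactic ([x, c] @ Z) (x # Z @ [c])"
  using assms
proof (induction Z arbitrary: x)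
  case (Cons z Z)
  have "plactic ([] @ [x, c, z] @ Z) ([] @ [x, z, c] @ Z)"
    using Cons.prems by (intro plactic_context plactic_yzx) auto
  then have "plactic ([x, c] @ z # Z) (x # [z, c] @ Z)" by simp
  also have "plactic ([x] @ ([z, c] @ Z) @ []) ([x] @ (z # Z @ [c]) @ [])"
    using Cons.prems less_trans[of z x c] by (intro plactic_context Cons.IH) auto
  then have "plactic (x # [z, c] @ Z) (x # (z # Z) @ [c])" by simp
  finally show ?case .
qed simp

text \<open>The last letter \<open>x\<close> of \<open>X\<close> is lent to the last letter
  \<open>z\<close> of \<open>Z\<close>: it moves next to \<open>z\<close>, witnesses the exchange of
  \<open>z\<close> and \<open>y\<close>, and returns to \<open>X\<close> by the induction hypothesis
  with \<open>x\<close> in the role of \<open>y\<close>. Every letter of \<open>Z\<close> borrows a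
  letter of its own, which explains the condition on the lengths.\<close>

lemma plactic_letter_left:
  assumes "sorted_wrt (>) X" "sorted_wrt (>) Z" "\<And>a. a \<in> set X \<Longrightarrow> y < a"
    "\<And>a b. a \<in> set X \<Longrightarrow> b \<in> set Z \<Longrightarrow> a < b" "length Z \<le> length X"
  shows "plactic (X @ Z @ [y]) (X @ [y] @ Z)"
  using assms
proof (induction Z arbitrary: X y rule: rev_induct)
  case (snoc z Z)
  then obtain X1 x where X: "X = X1 @ [x]" by (cases X rule: rev_cases) auto
  have "plactic (X1 @ (x # Z @ [z]) @ [y]) (X1 @ (Z @ [x, z]) @ [y])"
    using snoc.prems X by (intro plactic_context plactic_small_right) (auto simp: sorted_wrt_append)
  then have "plactic (X @ (Z @ [z]) @ [y]) ((X1 @ Z) @ [x, z, y] @ [])" using X by simp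
  also have "plactic \<dots> ((X1 @ Z) @ [x, y, z] @ [])"
    using snoc.prems X by (intro plactic_context plactic_yzx) auto
  also have "plactic ([] @ (X1 @ Z @ [x]) @ [y, z]) ([] @ (X1 @ [x] @ Z) @ [y, z])"
    using snoc.prems X by (intro plactic_context snoc.IH) (auto simp: sorted_wrt_append)
  then have "plactic ((X1 @ Z) @ [x, y, z] @ []) (X @ (Z @ [y, z]) @ [])" using X by simp
  also have "plactic \<dots> (X @ (y # Z @ [z]) @ [])"
  proof (intro plactic_context plactic_sym[OF plactic_small_right])
    show "y < z" using snoc.prems X by (auto intro: less_trans[of y x])
  qed (use snoc.prems in \<open>auto simp: sorted_wrt_append\<close>)
  finally show ?case by simp
qed simp

text \<open>The image of \<open>plactic_letter_left\<close> under reversing both the word and the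
  order of the letters, which keeps decreasing words decreasing. First letters now play the part of
  last ones.\<close>

lemma plactic_letter_right:
  assumes "sorted_wrt (>) X" "sorted_wrt (>) Z" "\<And>a. a \<in> set X \<Longrightarrow> a < y"
    "\<And>a b. a \<in> set X \<Longrightarrow> b \<in> set Z \<Longrightarrow> b < a" "length Z \<le> length X"
  shows "plactic ([y] @ Z @ X) (Z @ [y] @ X)"
  using assms
proof (induction Z arbitrary: X y)
  case (Cons z Z)
  then obtain x X1 where X: "X = x # X1" by (cases X) auto
  have zx: "z < x" "x < y" using Cons.prems X by auto
  have "plactic ([y] @ (z # Z @ [x]) @ X1) ([y] @ ([z, x] @ Z) @ X1)"
    using Cons.prems X by (intro plactic_context plactic_sym[OF plactic_large_right]) auto
  then have "plactic ([y] @ (z # Z) @ X) ([] @ [y, z, x] @ (Z @ X1))" using X by simp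
  also have "plactic \<dots> ([] @ [z, y, x] @ (Z @ X1))"
    using zx by (intro plactic_context plactic_sym[OF plactic_xzy])
  also have "plactic ([z, y] @ ([x] @ Z @ X1) @ []) ([z, y] @ (Z @ [x] @ X1) @ [])"
    using Cons.prems X by (intro plactic_context Cons.IH) auto
  then have "plactic ([] @ [z, y, x] @ (Z @ X1)) ([] @ ([z, y] @ Z) @ X)" using X by simp
  also have "plactic \<dots> ([] @ (z # Z @ [y]) @ X)"
    using zx Cons.prems by (intro plactic_context plactic_large_right) auto
  finally show ?case by simp
qed simp

section \<open>Column insertion into tableaux\<close>

text \<open>Tableaux are given by their columns, each listed in increasing order.\<close>

fun dominates :: "nat list \<Rightarrow> nat list \<Rightarrow> bool" where
  "dominates C [] = True"
| "dominates [] (d # D) = False"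
| "dominates (c # C) (d # D) = (c < d \<and> dominates C D)"

fun tableau :: "nat list list \<Rightarrow> bool" where
  "tableau [] = True"
| "tableau [C] = sorted_wrt (<) C"
| "tableau (C # D # cs) = (sorted_wrt (<) C \<and> dominates C D \<and> tableau (D # cs))"

definition column_word :: "nat list list \<Rightarrow> nat list" where
  "column_word cs = concat (map rev cs)"

fun column_insert :: "nat \<Rightarrow> nat list \<Rightarrow> nat list \<times> nat option" where
  "column_insert x [] = ([x], None)"
| "column_insert x (c # C) =
    (if x < c then (x # C, Some c) else apfst ((#) c) (column_insert x C))"

fun tableau_insert :: "nat \<Rightarrow> nat list list \<Rightarrow> nat list list" where
  "tableau_insert x [] = [[x]]"
| "tableau_insert x (C # cs) =
    (case column_insert x C of (C', None) \<Rightarrow> C' # cs | (C', Some c) \<Rightarrow> C' # tableau_insert c cs)"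

lemma dominates_Nil_left [simp]: "dominates [] D \<longleftrightarrow> D = []"
  by (cases D) auto

lemma dominates_append: "dominates C D \<Longrightarrow> dominates (C @ E) D"
  by (induction C D rule: dominates.induct) auto

text \<open>The ballot property of tableaux. It will supply the condition on lengths in
  \<open>plactic_letter_left\<close> at every stage of reading the inverse.\<close>

lemma dominates_filter_less:
  "dominates C D \<Longrightarrow> length (filter (\<lambda>a. a < t) D) \<le> length (filter (\<lambda>a. a < t) C)"
  by (induction C D rule: dominates.induct) auto

lemma column_insert_cases:
  assumes "sorted_wrt (<) C" "x \<notin> set C"
  obtains "column_insert x C = (C @ [x], None)" "\<And>c. c \<in> set C \<Longrightarrow> c < x"
  | C1 c C2 where "C = C1 @ c # C2" "column_insert x C = (C1 @ x # C2, Some c)"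
      "\<And>a. a \<in> set C1 \<Longrightarrow> a < x" "x < c"
proof -
  have "column_insert x C = (C @ [x], None) \<and> (\<forall>c\<in>set C. c < x) \<or>
    (\<exists>C1 c C2. C = C1 @ c # C2 \<and> column_insert x C = (C1 @ x # C2, Some c) \<and> (\<forall>a\<in>set C1. a < x) \<and> x < c)"
    using assms
  proof (induction C)
    case (Cons c C)
    show ?case
    proof (cases "x < c")
      case True
      then show ?thesis by (intro disjI2 exI[of _ "[]"]) auto
    next
      case False
      then have "c < x" using Cons.prems by auto
      have "sorted_wrt (<) C" "x \<notin> set C" using Cons.prems by auto
      from Cons.IH[OF this] show ?thesis
      proof
        assume "column_insert x C = (C @ [x], None) \<and> (\<forall>c\<in>set C. c < x)"
        then show ?thesis using \<open>c < x\<close> by auto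
      next
        assume "\<exists>C1 d C2. C = C1 @ d # C2 \<and> column_insert x C = (C1 @ x # C2, Some d) \<and> (\<forall>a\<in>set C1. a < x) \<and> x < d"
        then obtain C1 d C2 where *: "C = C1 @ d # C2" "column_insert x C = (C1 @ x # C2, Some d)" "\<forall>a\<in>set C1. a < x" "x < d"
          by blast
        then show ?thesis using \<open>c < x\<close>
          by (intro disjI2 exI[of _ "c # C1"] exI[of _ d] exI[of _ C2]) auto
      qed
    qed
  qed simp
  then show ?thesis using that by blast
qed

lemma column_insert_mem: "column_insert x C = (C', Some c) \<Longrightarrow> c \<in> set C"
  by (induction C arbitrary: C') (auto split: if_splits simp: apfst_def map_prod_def split: prod.splits)

lemma dominates_column_insert_same:
  "dominates C D \<Longrightarrow> column_insert x C = (C', Some c) \<Longrightarrow> dominates C' D"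
proof (induction C D arbitrary: C' rule: dominates.induct)
  case (3 a C d D)
  show ?case
  proof (cases "x < a")
    case True
    then show ?thesis using 3 by auto
  next
    case False
    then obtain C1 where "column_insert x C = (C1, Some c)" "C' = a # C1"
      using 3 by (cases "column_insert x C") auto
    then show ?thesis using 3 by auto
  qed
qed auto

text \<open>In \<open>D\<close> the entry in the row of the bumped \<open>c\<close>, if there is
  one, exceeds \<open>c\<close>, so \<open>c\<close> lands in that row or an earlier one. There its
  left neighbour in \<open>C'\<close> is at most \<open>x\<close> and hence below \<open>c\<close>.
  Elsewhere bumping only makes the entries of \<open>C\<close> smaller.\<close>

lemma dominates_column_insert:
  assumes "dominates C D" "sorted_wrt (<) C" "x \<notin> set C" "column_insert x C = (C', Some c)"
  shows "dominates C' (fst (column_insert c D))"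
  using assms
proof (induction C arbitrary: D C')
  case (Cons a C)
  show ?case
  proof (cases "x < a")
    case True
    then show ?thesis using Cons.prems by (cases D) auto
  next
    case False
    then obtain C1 where C1: "column_insert x C = (C1, Some c)" "C' = a # C1"
      using Cons.prems by (cases "column_insert x C") auto
    then have "a < c" using column_insert_mem Cons.prems by auto
    show ?thesis
    proof (cases D)
      case Nil
      then show ?thesis using C1 \<open>a < c\<close> by simp
    next
      case (Cons d D1)
      then have "dominates C1 (fst (column_insert c D1))" "dominates C1 D1"
        using Cons.IH[of D1 C1] C1 Cons.prems dominates_column_insert_same[of C D1 x C1 c] by auto
      then show ?thesis using Cons C1 \<open>a < c\<close> Cons.prems by auto
    qed
  qed
qed simp

text \<open>For \<open>C = C1 @ c # C2\<close> the letter \<open>x\<close> passes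
  \<open>rev C2\<close> with \<open>c\<close> at the far end as the final witness; afterwards
  \<open>c\<close> passes \<open>rev C1\<close>, whose letters are all below
  \<open>x\<close>.\<close>

lemma plactic_column_insert:
  assumes "sorted_wrt (<) C" "x \<notin> set C" "column_insert x C = (C', Some c)"
  shows "plactic (x # rev C) (rev C' @ [c])"
proof -
  obtain C1 C2 where C: "C = C1 @ c # C2" "C' = C1 @ x # C2" "\<And>a. a \<in> set C1 \<Longrightarrow> a < x" "x < c"
    using column_insert_cases[OF assms(1,2)] assms(3) by (metis Pair_inject option.distinct(1) option.inject)
  have dec: "sorted_wrt (>) (rev C1)" "sorted_wrt (>) (rev C2)" "\<And>a. a \<in> set C2 \<Longrightarrow> c < a"
    using assms(1) C(1) by (auto simp: sorted_wrt_append sorted_wrt_rev)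
  have "plactic ([] @ (x # rev C2 @ [c]) @ rev C1) ([] @ (rev C2 @ [x, c]) @ rev C1)"
    using dec C by (intro plactic_context plactic_small_right) auto
  then have "plactic (x # rev C) (rev C2 @ ([x, c] @ rev C1) @ [])" using C by simp
  also have "plactic \<dots> (rev C2 @ (x # rev C1 @ [c]) @ [])"
    using dec C by (intro plactic_context plactic_large_right) auto
  finally show ?thesis using C by simp
qed

lemma sorted_column_insert:
  assumes "sorted_wrt (<) C" "x \<notin> set C"
  shows "sorted_wrt (<) (fst (column_insert x C))"
  using column_insert_cases[OF assms]
proof cases
  case 1
  then show ?thesis using assms by (auto simp: sorted_wrt_append)
next
  case (2 C1 c C2)
  then show ?thesis using assms by (auto simp: sorted_wrt_append intro: less_trans)
qed

lemma tableau_Cons: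
  "tableau (C # cs) \<longleftrightarrow> sorted_wrt (<) C \<and> tableau cs \<and> (case cs of [] \<Rightarrow> True | D # _ \<Rightarrow> dominates C D)"
  by (cases cs) auto

lemma hd_tableau_insert: "\<exists>rest. tableau_insert c (D # cs) = fst (column_insert c D) # rest"
  by (auto split: prod.splits option.splits)

text \<open>A letter in front of the column word is absorbed by the first column, which releases the
  bumped entry at its end. That is the place in front of the word of the remaining columns, so the
  recursion can go on.\<close>

lemma tableau_insert:
  assumes "tableau cs" "distinct (x # concat cs)"
  shows "tableau (tableau_insert x cs) \<and> plactic (x # column_word cs) (column_word (tableau_insert x cs))"
  using assms
proof (induction cs arbitrary: x)
  case Nil
  then show ?case by (simp add: column_word_def)
next
  case (Cons C cs)
  have C: "sorted_wrt (<) C" "x \<notin> set C" "tableau cs" using Cons.prems by (auto simp: tableau_Cons)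
  from C(1,2) show ?case
  proof (cases rule: column_insert_cases)
    case 1
    then show ?thesis using Cons.prems sorted_column_insert[OF C(1,2)]
      by (auto simp: tableau_Cons column_word_def dominates_append split: list.splits)
  next
    case (2 C1 c C2)
    define C' where "C' = C1 @ x # C2"
    have ins: "column_insert x C = (C', Some c)" using 2 C'_def by simp
    have "distinct (c # concat cs)" using Cons.prems 2 by auto
    then have IH: "tableau (tableau_insert c cs)" "plactic (c # column_word cs) (column_word (tableau_insert c cs))"
      using Cons.IH C(3) by blast+
    have "sorted_wrt (<) C'" using sorted_column_insert[OF C(1,2)] ins by simp
    moreover have "case tableau_insert c cs of [] \<Rightarrow> True | D # _ \<Rightarrow> dominates C' D"
    proof (cases cs)
      case Nil
      then show ?thesis using dominates_column_insert[OF _ C(1,2) ins, of "[]"] by simp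
    next
      case (Cons D ds)
      then have "dominates C D" using Cons.prems \<open>tableau (C # cs)\<close> by simp
      then have "dominates C' (fst (column_insert c D))" using dominates_column_insert C ins by blast
      then show ?thesis using hd_tableau_insert[of c D ds] Cons by auto
    qed
    ultimately have "tableau (C' # tableau_insert c cs)" using IH by (simp add: tableau_Cons)
    moreover have "plactic (x # column_word (C # cs)) (column_word (C' # tableau_insert c cs))"
    proof -
      have "plactic ([] @ (x # rev C) @ column_word cs) ([] @ (rev C' @ [c]) @ column_word cs)"
        by (intro plactic_context plactic_column_insert C ins)
      then have "plactic (x # column_word (C # cs)) (rev C' @ (c # column_word cs) @ [])"
        by (simp add: column_word_def)
      also have "plactic \<dots> (rev C' @ column_word (tableau_insert c cs) @ [])"
        by (intro plactic_context IH)
      finally show ?thesis by (simp add: column_word_def)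
    qed
    ultimately show ?thesis using ins by simp
  qed
qed

lemma plactic_tableau: "distinct w \<Longrightarrow> \<exists>cs. tableau cs \<and> plactic w (column_word cs)"
proof (induction w)
  case Nil
  then show ?case by (intro exI[of _ "[]"]) (simp add: column_word_def)
next
  case (Cons x w)
  then obtain cs where cs: "tableau cs" "plactic w (column_word cs)" by auto
  have "mset (concat cs) = mset (column_word cs)"
    unfolding column_word_def by (induction cs) auto
  then have "mset (x # w) = mset (x # concat cs)" using plactic_set[OF cs(2)] by simp
  then have "distinct (x # concat cs)" using Cons.prems by (metis mset_eq_imp_distinct_iff)
  note ins = tableau_insert[OF cs(1) this]
  have "plactic ([x] @ w @ []) ([x] @ column_word cs @ [])" by (intro plactic_context cs)
  then have "plactic (x # w) (x # column_word cs)" by simp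
  then show ?case using ins plactic_trans by blast
qed

section \<open>From words back to permutations\<close>

lemma map_upt_window:
  assumes "map w [0..<N] = a @ [p, q, r] @ b"
  shows "length a + 2 < N" "w (length a) = p" "w (length a + 1) = q" "w (length a + 2) = r"
    "map (w \<circ> transpose (length a) (length a + 1)) [0..<N] = a @ [q, p, r] @ b"
    "map (w \<circ> transpose (length a + 1) (length a + 2)) [0..<N] = a @ [p, r, q] @ b"
proof -
  define i where "i = length a"
  have N: "N = i + 3 + length b" using arg_cong[OF assms, of length] by (simp add: i_def)
  have w: "w k = (a @ [p, q, r] @ b) ! k" if "k < N" for k
    using that arg_cong[OF assms, of "\<lambda>l. l ! k"] by simp
  show "length a + 2 < N" "w (length a) = p" "w (length a + 1) = q" "w (length a + 2) = r"
    using N w[of i] w[of "i + 1"] w[of "i + 2"] by (simp_all add: i_def nth_append)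
  have t: "transpose i (i + 1) k < N" "transpose (i + 1) (i + 2) k < N" if "k < N" for k
    using that N by (auto simp: transpose_def)
  show "map (w \<circ> transpose (length a) (length a + 1)) [0..<N] = a @ [q, p, r] @ b"
    by (rule nth_equalityI)
      (auto simp: N w t i_def[symmetric] transpose_def nth_append nth_Cons' split: if_splits)
  show "map (w \<circ> transpose (length a + 1) (length a + 2)) [0..<N] = a @ [p, r, q] @ b"
    by (rule nth_equalityI)
      (auto simp: N w t i_def[symmetric] transpose_def nth_append nth_Cons' split: if_splits)
qed

lemma map_knuth_window:
  assumes "map w [0..<N] = a @ [p, q, r] @ b"
  shows "between q p r \<Longrightarrow> map (knuth (length a) w) [0..<N] = a @ [p, r, q] @ b"
    and "between p r q \<Longrightarrow> map (knuth (length a) w) [0..<N] = a @ [q, p, r] @ b"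
proof -
  note W = map_upt_window[OF assms]
  show "map (knuth (length a) w) [0..<N] = a @ [p, r, q] @ b" if "between q p r"
    using that W unfolding knuth_def knuth_swap_def by simp
  show "map (knuth (length a) w) [0..<N] = a @ [q, p, r] @ b" if "between p r q"
    using that W between_imp[OF that] unfolding knuth_def knuth_swap_def by simp
qed

text \<open>The two sides of an elementary relation are the two states of a window on which a Knuth
  move acts. Hence a plactic derivation can be followed move by move, in either direction.\<close>

lemma elem_plactic_knuth:
  assumes "elem_plactic u v"
  shows "map w [0..<N] = u \<Longrightarrow> \<exists>i. i + 2 < N \<and> map (knuth i w) [0..<N] = v" (is "?A \<Longrightarrow> ?B")
    and "map w [0..<N] = v \<Longrightarrow> \<exists>i. i + 2 < N \<and> map (knuth i w) [0..<N] = u" (is "?C \<Longrightarrow> ?D")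
proof -
  show ?B if ?A
    using assms
  proof cases
    case (yzx x y z a b)
    have 1: "map w [0..<N] = a @ [y, z, x] @ b" using \<open>?A\<close> yzx by simp
    show ?thesis using map_upt_window(1)[OF 1] map_knuth_window(1)[OF 1] yzx
      by (intro exI[of _ "length a"]) (simp add: between_def)
  next
    case (xzy x y z a b)
    have 1: "map w [0..<N] = a @ [x, z, y] @ b" using \<open>?A\<close> xzy by simp
    show ?thesis using map_upt_window(1)[OF 1] map_knuth_window(2)[OF 1] xzy
      by (intro exI[of _ "length a"]) (simp add: between_def)
  qed
  show ?D if ?C
    using assms
  proof cases
    case (yzx x y z a b)
    have 1: "map w [0..<N] = a @ [y, x, z] @ b" using \<open>?C\<close> yzx by simp
    show ?thesis using map_upt_window(1)[OF 1] map_knuth_window(1)[OF 1] yzx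
      by (intro exI[of _ "length a"]) (simp add: between_def)
  next
    case (xzy x y z a b)
    have 1: "map w [0..<N] = a @ [z, x, y] @ b" using \<open>?C\<close> xzy by simp
    show ?thesis using map_upt_window(1)[OF 1] map_knuth_window(2)[OF 1] xzy
      by (intro exI[of _ "length a"]) (simp add: between_def)
  qed
qed

lemma plactic_knuth_eq:
  assumes "plactic u v" "map w [0..<N] = u"
  shows "\<exists>w'. knuth_eq N w w' \<and> map w' [0..<N] = v"
  using assms(1) unfolding plactic_def
proof (induction rule: equivclp_induct)
  case base
  show ?case using assms(2) knuth_eq_refl by blast
next
  case (step y z)
  then obtain w' where w': "knuth_eq N w w'" "map w' [0..<N] = y" by blast
  then obtain i where "i + 2 < N" "map (knuth i w') [0..<N] = z"
    using step elem_plactic_knuth by blast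
  then show ?case using w' knuth_eq_step by blast
qed

lemma plactic_imp_knuth_eq:
  assumes "plactic (map w [0..<N]) (map u [0..<N])" "w permutes {..<N}" "u permutes {..<N}"
  shows "knuth_eq N w u"
proof -
  obtain w' where w': "knuth_eq N w w'" "map w' [0..<N] = map u [0..<N]"
    using plactic_knuth_eq[OF assms(1) refl] by blast
  have "w' x = u x" for x
  proof (cases "x < N")
    case True
    then show ?thesis using w'(2) by (auto simp: map_eq_conv)
  next
    case False
    then show ?thesis
      using permutes_not_in[OF assms(3)] permutes_not_in[OF knuth_eq_permutes[OF w'(1) assms(2)]] by simp
  qed
  then have "w' = u" by blast
  then show ?thesis using w'(1) by simp
qed

lemma ex_permutes_map:
  assumes "mset l = mset [0..<N]"
  obtains w where "w permutes {..<N}" "map w [0..<N] = l"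
proof -
  have len: "length l = N" using arg_cong[OF assms, of size] by simp
  have set: "set l = {..<N}" using arg_cong[OF assms, of set_mset] by (simp add: atLeast0LessThan)
  have dist: "distinct l" using assms by (metis distinct_upt mset_eq_imp_distinct_iff)
  define w where "w i = (if i < N then l ! i else i)" for i
  have "inj_on w {..<N}"
    using inj_on_nth[OF dist, of "{..<N}"] len by (simp add: w_def inj_on_def)
  moreover have "w ` {..<N} = set l"
    unfolding set_conv_nth len by (auto simp: w_def)
  moreover note set
  ultimately have "w permutes {..<N}" by (intro bij_imp_permutes) (auto simp: bij_betw_def w_def)
  moreover have "map w [0..<N] = l" by (rule nth_equalityI) (auto simp: w_def len)
  ultimately show ?thesis using that by blast
qed

section \<open>Direct sums of decreasing blocks\<close>

definition list_graph :: "nat \<Rightarrow> nat list \<Rightarrow> (nat \<times> nat) set" where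
  "list_graph o' l = (\<lambda>i. (o' + i, l ! i)) ` {..<length l}"

lemma list_graph_zip: "list_graph s l = set (zip [s..<s + length l] l)"
  by (auto simp: list_graph_def set_zip intro!: exI)

lemma list_graph_append: "list_graph s (l @ l') = list_graph s l \<union> list_graph (s + length l) l'"
  using upt_add_eq_append[of s "s + length l" "length l'"]
  by (simp add: list_graph_zip add.assoc)

lemma list_graph_Nil: "list_graph s [] = {}"
  by (simp add: list_graph_def)

lemma list_graph_map_upt: "list_graph 0 (map w [0..<N]) = graph N w"
  by (auto simp: list_graph_def graph_def)

lemma map_inv_upt:
  assumes "w permutes {..<N}" "list_graph 0 l = prod.swap ` list_graph 0 (map w [0..<N])" "length l = N"
  shows "map (inv w) [0..<N] = l"
proof (rule nth_equalityI)
  fix i assume "i < length (map (inv w) [0..<N])"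
  then have i: "i < N" by simp
  have "(i, l ! i) \<in> list_graph 0 l" using i assms(3) by (auto simp: list_graph_def)
  then have "(i, l ! i) \<in> graph N (inv w)"
    using assms(2) by (simp add: list_graph_map_upt graph_inv[OF assms(1)])
  then show "map (inv w) [0..<N] ! i = l ! i" using i by (auto simp: graph_def)
qed (use assms in simp)

text \<open>The condition is symmetric in both offsets, so transposition merely exchanges the corner
  coordinates \<open>s\<close> and \<open>v\<close>.\<close>

definition antidiagonal :: "nat \<Rightarrow> nat \<Rightarrow> nat \<Rightarrow> (nat \<times> nat) set" where
  "antidiagonal s v b = {(s + i, v + j) | i j. Suc (i + j) = b}"

lemma list_graph_rev_upt: "list_graph s (rev [v..<v + b]) = antidiagonal s v b"
proof -
  have "(s + i, v + j) \<in> list_graph s (rev [v..<v + b])" if "Suc (i + j) = b" for i j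
    using that unfolding list_graph_def by (intro image_eqI[of _ _ i]) (auto simp: rev_nth)
  moreover have "\<exists>j. (s + i, rev [v..<v + b] ! i) = (s + i, v + j) \<and> Suc (i + j) = b" if "i < b" for i
    using that by (intro exI[of _ "b - Suc i"]) (auto simp: rev_nth)
  ultimately show ?thesis by (fastforce simp: antidiagonal_def list_graph_def)
qed

lemma swap_antidiagonal: "prod.swap ` antidiagonal s v b = antidiagonal v s b"
  unfolding antidiagonal_def by (auto simp: image_iff add.commute)

text \<open>One-line notation of a layered permutation, the direct sum of decreasing permutations of
  lengths \<open>bs\<close>.\<close>

fun block_list :: "nat \<Rightarrow> nat list \<Rightarrow> nat list" where
  "block_list s [] = []"
| "block_list s (b # bs) = rev [s..<s + b] @ block_list (s + b) bs"

lemma block_list_append: "block_list s (as @ bs) = block_list s as @ block_list (s + sum_list as) bs"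
  by (induction as arbitrary: s) (auto simp: add.assoc)

lemma length_block_list [simp]: "length (block_list s bs) = sum_list bs"
  by (induction bs arbitrary: s) auto

lemma mset_block_list: "mset (block_list s bs) = mset [s..<s + sum_list bs]"
proof (induction bs arbitrary: s)
  case (Cons b bs)
  have "[s..<s + sum_list (b # bs)] = [s..<s + b] @ [s + b..<s + b + sum_list bs]"
    using upt_add_eq_append[of s "s + b" "sum_list bs"] by (simp add: add.assoc)
  then show ?case using Cons by simp
qed simp

lemma swap_list_graph_block_list: "prod.swap ` list_graph s (block_list s bs) = list_graph s (block_list s bs)"
  by (induction bs arbitrary: s)
    (simp_all add: list_graph_append image_Un list_graph_rev_upt swap_antidiagonal list_graph_Nil)

lemma permutes_eqI:
  assumes "w permutes {..<N}" "u permutes {..<N}" "map w [0..<N] = map u [0..<N]"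
  shows "w = u"
proof
  fix x
  show "w x = u x"
    using assms(3) permutes_not_in[OF assms(1)] permutes_not_in[OF assms(2)] by (cases "x < N") auto
qed

definition block_perm :: "nat list \<Rightarrow> nat \<Rightarrow> nat" where
  "block_perm bs = (SOME w. w permutes {..<sum_list bs} \<and> map w [0..<sum_list bs] = block_list 0 bs)"

lemma block_perm:
  shows block_perm_permutes: "sum_list bs = N \<Longrightarrow> block_perm bs permutes {..<N}"
    and map_block_perm: "sum_list bs = N \<Longrightarrow> map (block_perm bs) [0..<N] = block_list 0 bs"
proof -
  have "\<exists>w. w permutes {..<sum_list bs} \<and> map w [0..<sum_list bs] = block_list 0 bs"
    using ex_permutes_map[of "block_list 0 bs" "sum_list bs"] mset_block_list[of 0 bs] by auto
  from someI_ex[OF this]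
  show "sum_list bs = N \<Longrightarrow> block_perm bs permutes {..<N}"
    and "sum_list bs = N \<Longrightarrow> map (block_perm bs) [0..<N] = block_list 0 bs"
    unfolding block_perm_def by auto
qed

text \<open>Every block is an antidiagonal of a square centred on the main diagonal, so the graph is
  symmetric. This is what turns Knuth equivalence of inverses into dual Knuth equivalence.\<close>

lemma inv_block_perm: "inv (block_perm bs) = block_perm bs"
proof (rule permutes_eqI[of _ "sum_list bs"])
  show "inv (block_perm bs) permutes {..<sum_list bs}" "block_perm bs permutes {..<sum_list bs}"
    by (simp_all add: block_perm_permutes permutes_inv)
  have "map (inv (block_perm bs)) [0..<sum_list bs] = block_list 0 bs"
    by (rule map_inv_upt) (simp_all add: block_perm swap_list_graph_block_list)
  then show "map (inv (block_perm bs)) [0..<sum_list bs] = map (block_perm bs) [0..<sum_list bs]"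
    by (simp add: map_block_perm)
qed

text \<open>\<open>y\<close> crosses the last block first, and the block in front of the one being
  crossed always supplies the witnesses. Therefore the lengths have to decrease weakly.\<close>

lemma plactic_letter_past_columns:
  assumes "sorted_wrt (>) X" "\<And>a. a \<in> set X \<Longrightarrow> y < a"
    and "\<forall>B\<in>set Bs. sorted_wrt (>) B"
    and "sorted_wrt (\<lambda>A B. length B \<le> length A \<and> (\<forall>a\<in>set A. \<forall>b\<in>set B. a < b)) (X # Bs)" "\<forall>B\<in>set Bs. \<forall>b\<in>set B. y < b"
  shows "plactic (X @ concat Bs @ [y]) (X @ [y] @ concat Bs)"
  using assms
proof (induction Bs arbitrary: X)
  case (Cons B Bs)
  have "plactic (X @ (B @ concat Bs @ [y]) @ []) (X @ (B @ [y] @ concat Bs) @ [])"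
    using Cons.prems by (intro plactic_context Cons.IH) auto
  then have "plactic (X @ concat (B # Bs) @ [y]) ([] @ (X @ B @ [y]) @ concat Bs)" by simp
  also have "plactic \<dots> ([] @ (X @ [y] @ B) @ concat Bs)"
    using Cons.prems by (intro plactic_context plactic_letter_left) auto
  finally show ?case by simp
qed simp

lemma sorted_wrt_concat:
  "sorted_wrt P (concat xss) \<longleftrightarrow> (\<forall>xs\<in>set xss. sorted_wrt P xs) \<and>
     sorted_wrt (\<lambda>xs ys. \<forall>a\<in>set xs. \<forall>b\<in>set ys. P a b) xss"
  by (induction xss) (auto simp: sorted_wrt_append)

lemma sorted_wrt_memD:
  "sorted_wrt P xs \<Longrightarrow> a \<in> set xs \<Longrightarrow> b \<in> set xs \<Longrightarrow> a \<noteq> b \<Longrightarrow> P a b \<or> P b a"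
  by (induction xs) auto

lemma filter_less_Suc:
  "sorted_wrt (<) C \<Longrightarrow> t \<in> set C \<Longrightarrow> filter (\<lambda>s. s < Suc t) C = filter (\<lambda>s. s < t) C @ [t]" for t :: nat
proof (induction C)
  case (Cons c C)
  show ?case
  proof (cases "c = t")
    case True
    then have "filter (\<lambda>s. s < Suc t) C = []" "filter (\<lambda>s. s < t) C = []"
      using Cons.prems by (auto simp: filter_empty_conv)
    then show ?thesis using True by simp
  next
    case False
    then show ?thesis using Cons by auto
  qed
qed simp

lemma tableau_columns:
  "tableau cs \<Longrightarrow> (\<forall>C\<in>set cs. sorted_wrt (<) C) \<and>
    sorted_wrt (\<lambda>C D. \<forall>t. length (filter (\<lambda>a. a < t) D) \<le> length (filter (\<lambda>a. a < t) C)) cs"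
proof (induction cs rule: tableau.induct)
  case (3 C D cs)
  then show ?case using dominates_filter_less[of C D] by (simp, meson le_trans)
qed auto

lemma concat_rev_eq_upt:
  "concat (map rev Ls) = [s..<s + n] \<Longrightarrow> concat Ls = block_list s (map length Ls)"
proof (induction Ls arbitrary: s n)
  case (Cons L Ls)
  have len: "length L + length (concat (map rev Ls)) = n"
    using arg_cong[OF Cons.prems, of length] by simp
  then have "[s..<s + n] = [s..<s + length L] @ [s + length L..<s + length L + length (concat (map rev Ls))]"
    using upt_add_eq_append[of s "s + length L" "length (concat (map rev Ls))"] by (simp add: add.assoc)
  then have "rev L @ concat (map rev Ls) = [s..<s + length L] @ [s + length L..<s + length L + length (concat (map rev Ls))]"
    using Cons.prems by simp
  then have "rev L = [s..<s + length L]"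
    "concat (map rev Ls) = [s + length L..<s + length L + length (concat (map rev Ls))]"
    by (simp_all add: append_eq_append_conv)
  then have "L = rev [s..<s + length L]" "concat Ls = block_list (s + length L) (map length Ls)"
    using Cons.IH by (metis rev_rev_ident, blast)
  then show ?case by (metis block_list.simps(2) concat.simps(2) list.simps(9))
qed simp

text \<open>The positions of the values below \<open>t\<close>, read in the order of the values, form a ballot word in
  the column indices. It is brought into the block form letter by letter.\<close>

lemma plactic_tableau_inverse:
  assumes x: "x permutes {..<N}" "map x [0..<N] = column_word cs" and tab: "tableau cs"
  shows "plactic (map (inv x) [0..<N]) (block_list 0 (map length cs))"
proof -
  define v where "v = inv x"
  have vx: "v (x i) = i" for i using permutes_inverses[OF x(1)] by (simp add: v_def)
  have vcol: "map v (column_word cs) = [0..<N]"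
    by (simp flip: x(2) add: comp_def vx)
  have "sorted_wrt (\<lambda>a b. v a < v b) (column_word cs)"
    by (simp flip: x(2) add: sorted_wrt_map vx)
  then have *: "\<forall>C\<in>set cs. sorted_wrt (\<lambda>a b. v a < v b) (rev C)"
     and pos: "sorted_wrt (\<lambda>C D. \<forall>a\<in>set C. \<forall>b\<in>set D. v a < v b) cs"
    by (simp_all add: column_word_def sorted_wrt_concat sorted_wrt_map)
  then have posC: "sorted_wrt (\<lambda>a b. v b < v a) C" if "C \<in> set cs" for C
    using that by (simp add: sorted_wrt_rev)
  have srt: "sorted_wrt (<) C" if "C \<in> set cs" for C using tableau_columns[OF tab] that by blast
  have len: "sorted_wrt (\<lambda>C D. \<forall>t. length (filter (\<lambda>a. a < t) D) \<le> length (filter (\<lambda>a. a < t) C)) cs"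
    using tableau_columns[OF tab] by blast
  have inC: "v b < v a" if "C \<in> set cs" "a \<in> set C" "b \<in> set C" "a < b" for C a b
  proof -
    have "sorted_wrt (\<lambda>a b. a < b \<and> v b < v a) C"
      using srt[OF that(1)] posC[OF that(1)] by (simp add: sorted_wrt_iff_nth_less)
    from sorted_wrt_memD[OF this that(2,3)] that(4) show ?thesis by auto
  qed
  have set_cs: "set (concat cs) = {..<N}"
  proof -
    have "set (concat cs) = set (column_word cs)" by (auto simp: column_word_def)
    also have "\<dots> = x ` {..<N}" unfolding x(2)[symmetric] by (simp add: atLeast0LessThan)
    finally show ?thesis using permutes_image[OF x(1)] by simp
  qed
  \<comment> \<open>\<open>col t C\<close> lists the positions of those entries of \<open>C\<close>
    that are below \<open>t\<close>. As \<open>column_word\<close> reads the increasing list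
    \<open>C\<close> backwards, these positions decrease.\<close>
  define col where "col t C = map v (filter (\<lambda>s. s < t) C)" for t C
  have "plactic (map v [0..<t]) (concat (map (col t) cs))" if "t \<le> N" for t
    using that
  proof (induction t)
    case 0
    have "map v [0..<0] = concat (map (col 0) cs)" by (induction cs) (auto simp: col_def)
    then show ?case by (metis plactic_refl)
  next
    case (Suc t)
    then have "t \<in> set (concat cs)" using set_cs by simp
    then obtain C where "C \<in> set cs" "t \<in> set C" by auto
    then obtain cs1 cs2 where cs: "cs = cs1 @ C # cs2" and tC: "t \<in> set C" by (meson split_list)
    have other: "col (Suc t) D = col t D" if "D \<in> set cs1 \<union> set cs2" for D
    proof -
      have "t \<notin> set D" using pos that tC unfolding cs sorted_wrt_append by fastforce
      then have "filter (\<lambda>s. s < Suc t) D = filter (\<lambda>s. s < t) D"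
        by (intro filter_cong) (auto simp: less_Suc_eq)
      then show ?thesis by (simp add: col_def)
    qed
    have own: "col (Suc t) C = col t C @ [v t]"
      using filter_less_Suc[OF srt tC] cs by (simp add: col_def)
    have dec: "sorted_wrt (>) (col t D)" if "D \<in> set cs" for D
      using posC[OF that] unfolding col_def sorted_wrt_map by (rule sorted_wrt_filter)
    have map_cong: "map (col (Suc t)) cs1 = map (col t) cs1" "map (col (Suc t)) cs2 = map (col t) cs2"
      using other by auto
    have "plactic ([] @ map v [0..<t] @ [v t]) ([] @ concat (map (col t) cs) @ [v t])"
      using Suc by (intro plactic_context Suc.IH) simp
    then have "plactic (map v [0..<Suc t])
        (concat (map (col t) cs1) @ (col t C @ concat (map (col t) cs2) @ [v t]) @ [])"
      by (simp add: cs)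
    \<comment> \<open>The new letter \<open>v t\<close> stands at the very end and has to reach its
      own column past all later ones; it extends the decreasing list of that column.\<close>
    also have "plactic \<dots> (concat (map (col t) cs1) @ (col t C @ [v t] @ concat (map (col t) cs2)) @ [])"
    proof (intro plactic_context plactic_letter_past_columns)
      show "sorted_wrt (>) (col t C)" using dec cs by simp
      show "v t < a" if "a \<in> set (col t C)" for a
        using that inC[of C _ t] tC cs by (auto simp: col_def)
      show "\<forall>B\<in>set (map (col t) cs2). sorted_wrt (>) B" using dec cs by simp
      show "\<forall>B\<in>set (map (col t) cs2). \<forall>b\<in>set B. v t < b"
        using pos tC unfolding cs sorted_wrt_append by (auto simp: col_def)
      have "sorted_wrt (\<lambda>A B. length (col t B) \<le> length (col t A) \<and>
          (\<forall>a\<in>set (col t A). \<forall>b\<in>set (col t B). a < b)) cs"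
        using len pos unfolding sorted_wrt_iff_nth_less by (auto simp: col_def)
      then show "sorted_wrt (\<lambda>A B. length B \<le> length A \<and> (\<forall>a\<in>set A. \<forall>b\<in>set B. a < b)) (col t C # map (col t) cs2)"
        unfolding cs sorted_wrt_append by (simp add: sorted_wrt_map)
    qed
    finally show ?case by (simp add: cs own map_cong)
  qed
  from this[of N] have "plactic (map v [0..<N]) (concat (map (col N) cs))" by simp
  also have "map (col N) cs = map (map v) cs"
  proof (rule map_cong[OF refl])
    fix C assume "C \<in> set cs"
    then have "\<forall>s\<in>set C. s < N" using set_cs by auto
    then show "col N C = map v C" by (simp add: col_def)
  qed
  also have "concat (map (map v) cs) = block_list 0 (map length (map (map v) cs))"
    using vcol by (intro concat_rev_eq_upt[where n = N]) (simp add: column_word_def map_concat rev_map comp_def)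
  finally show ?thesis by (simp add: v_def comp_def)
qed

lemma two_sided_block_perm:
  assumes w: "w permutes {..<N}"
  shows "\<exists>bs. sum_list bs = N \<and> two_sided_eq N w (block_perm bs)"
proof -
  have "distinct (map w [0..<N])" using inj_on_subset[OF permutes_inj[OF w] subset_UNIV] by (simp add: distinct_map)
  then obtain cs where cs: "tableau cs" "plactic (map w [0..<N]) (column_word cs)"
    using plactic_tableau by blast
  obtain x where x: "knuth_eq N w x" "map x [0..<N] = column_word cs"
    using plactic_knuth_eq[OF cs(2) refl] by blast
  have xp: "x permutes {..<N}" using knuth_eq_permutes x w by blast
  define bs where "bs = map length cs"
  have "length (column_word cs) = sum_list bs"
    unfolding column_word_def bs_def by (induction cs) auto
  then have N: "sum_list bs = N" using arg_cong[OF x(2), of length] by simp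
  have "plactic (map (inv x) [0..<N]) (map (block_perm bs) [0..<N])"
    using plactic_tableau_inverse[OF xp x(2) cs(1), folded bs_def] by (simp only: map_block_perm[OF N])
  then have "knuth_eq N (inv x) (block_perm bs)"
    using plactic_imp_knuth_eq permutes_inv[OF xp] block_perm_permutes[OF N] by blast
  then have "dual_knuth_eq N x (block_perm bs)"
    using inv_imp_dual_knuth_eq[OF _ xp] by (metis inv_block_perm)
  then show ?thesis
    using N x(1) knuth_eq_imp_two_sided_eq dual_knuth_eq_imp_two_sided_eq two_sided_eq_trans by blast
qed

section \<open>Exchanging adjacent blocks\<close>

lemma plactic_word_left:
  assumes "sorted_wrt (>) (X @ Y)" "sorted_wrt (>) Z"
    "\<And>a b. a \<in> set X \<union> set Y \<Longrightarrow> b \<in> set Z \<Longrightarrow> a < b" "length Z \<le> length X"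
  shows "plactic (X @ Z @ Y) (X @ Y @ Z)"
  using assms
proof (induction Y arbitrary: X)
  case (Cons y Y)
  have "plactic ([] @ (X @ Z @ [y]) @ Y) ([] @ (X @ [y] @ Z) @ Y)"
    using Cons.prems by (intro plactic_context plactic_letter_left) (auto simp: sorted_wrt_append)
  then have "plactic (X @ Z @ y # Y) ((X @ [y]) @ Z @ Y)" by simp
  also have "plactic \<dots> ((X @ [y]) @ Y @ Z)"
    using Cons.prems by (intro Cons.IH) auto
  finally show ?case by simp
qed simp

lemma plactic_word_right:
  assumes "sorted_wrt (>) (Y @ X)" "sorted_wrt (>) Z"
    "\<And>a b. a \<in> set X \<union> set Y \<Longrightarrow> b \<in> set Z \<Longrightarrow> b < a" "length Z \<le> length X"
  shows "plactic (Y @ Z @ X) (Z @ Y @ X)"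
  using assms
proof (induction Y arbitrary: X rule: rev_induct)
  case (snoc y Y)
  have "plactic (Y @ ([y] @ Z @ X) @ []) (Y @ (Z @ [y] @ X) @ [])"
    using snoc.prems by (intro plactic_context plactic_letter_right) (auto simp: sorted_wrt_append)
  then have "plactic ((Y @ [y]) @ Z @ X) (Y @ Z @ (y # X))" by simp
  also have "plactic \<dots> (Z @ Y @ (y # X))"
    using snoc.prems by (intro snoc.IH) auto
  finally show ?case by simp
qed simp

lemma sorted_rev_upt: "sorted_wrt (>) (rev [i..<j])"
  by (simp add: sorted_wrt_rev)

lemma rev_upt_append: "rev [i..<i + (m + n)] = rev [i + m..<i + m + n] @ rev [i..<i + m]"
  using upt_add_eq_append[of i "i + m" n] by (simp add: add.assoc)

text \<open>Cut the longer block into its upper \<open>b\<close> letters \<open>X\<close> and its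
  lower \<open>d\<close> letters \<open>Y\<close>. Knuth moves lead from \<open>X Y Z\<close> to
  \<open>X Z Y\<close>, where \<open>X\<close> is long enough to supply the witnesses for
  \<open>Z\<close>. The inverse of this intermediate permutation has the form
  \<open>Y' Z' X'\<close>, and Knuth moves lead on to \<open>Z' Y' X'\<close>, which is the pair of
  blocks in the other order.\<close>

lemma block_perm_swap_le:
  fixes us vs :: "nat list"
  assumes N: "sum_list us + (a + b) + sum_list vs = N" and "b \<le> a"
  shows "two_sided_eq N (block_perm (us @ [a, b] @ vs)) (block_perm (us @ [b, a] @ vs))"
proof -
  obtain d where a: "a = d + b" using \<open>b \<le> a\<close> by (metis add.commute le_Suc_ex)
  define s where "s = sum_list us"
  define P where "P = block_list 0 us"
  define S where "S = block_list (s + (d + b + b)) vs"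
  define X where "X = rev [s + d..<s + d + b]"
  define Y where "Y = rev [s..<s + d]"
  define Z where "Z = rev [s + (d + b)..<s + (d + b) + b]"
  define X' where "X' = rev [s + b..<s + b + b]"
  define Y' where "Y' = rev [s + (b + b)..<s + (b + b) + d]"
  define Z' where "Z' = rev [s..<s + b]"
  let ?w = "block_perm (us @ [a, b] @ vs)" and ?u = "block_perm (us @ [b, a] @ vs)"
  have Nw: "sum_list (us @ [a, b] @ vs) = N" and Nu: "sum_list (us @ [b, a] @ vs) = N" using N by simp_all
  have XY: "rev [s..<s + a] = X @ Y" and YX: "rev [s + b..<s + b + a] = Y' @ X'"
    using rev_upt_append[of s d b] rev_upt_append[of "s + b" b d]
    by (simp_all only: a X_def Y_def X'_def Y'_def add.assoc add.commute[of d b])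
  have wl: "map ?w [0..<N] = P @ (X @ Y @ Z) @ S"
  proof -
    have "map ?w [0..<N] = P @ rev [s..<s + a] @ rev [s + a..<s + a + b] @ block_list (s + a + b) vs"
      unfolding map_block_perm[OF Nw] block_list_append P_def s_def by (simp add: add.assoc)
    moreover have "rev [s + a..<s + a + b] = Z" "block_list (s + a + b) vs = S"
      by (simp_all only: Z_def S_def a add.assoc)
    ultimately show ?thesis by (simp only: XY append_assoc)
  qed
  have ul: "map ?u [0..<N] = P @ (Z' @ Y' @ X') @ S"
  proof -
    have "map ?u [0..<N] = P @ rev [s..<s + b] @ rev [s + b..<s + b + a] @ block_list (s + b + a) vs"
      unfolding map_block_perm[OF Nu] block_list_append P_def s_def by (simp add: add.assoc)
    moreover have "rev [s..<s + b] = Z'" "block_list (s + b + a) vs = S"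
      by (simp_all add: Z'_def S_def a add_ac)
    ultimately show ?thesis by (simp only: YX append_assoc)
  qed
  have "plactic (X @ Z @ Y) (X @ Y @ Z)"
    by (rule plactic_word_left) (auto simp: X_def Y_def Z_def sorted_rev_upt sorted_wrt_append)
  then have "plactic (map ?w [0..<N]) (P @ (X @ Z @ Y) @ S)"
    unfolding wl by (rule plactic_context[OF plactic_sym])
  then obtain z where z: "knuth_eq N ?w z" "map z [0..<N] = P @ (X @ Z @ Y) @ S"
    using plactic_knuth_eq[OF _ refl] by blast
  have zp: "z permutes {..<N}" using knuth_eq_permutes[OF z(1) block_perm_permutes[OF Nw]] .
  \<comment> \<open>Transposition takes the antidiagonals of \<open>X\<close>, \<open>Z\<close> and
    \<open>Y\<close> to those of \<open>Z'\<close>, \<open>X'\<close> and \<open>Y'\<close>, while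
    the blocks outside are symmetric.\<close>
  have "map (inv z) [0..<N] = P @ (Y' @ Z' @ X') @ S"
  proof (rule map_inv_upt[OF zp])
    have lP: "length P = s" by (simp add: P_def s_def)
    have sw: "prod.swap ` list_graph 0 P = list_graph 0 P"
      "prod.swap ` list_graph (s + (d + b + b)) S = list_graph (s + (d + b + b)) S"
      by (simp_all add: P_def S_def swap_list_graph_block_list)
    have l: "list_graph s (X @ Z @ Y) = antidiagonal s (s + d) b \<union> antidiagonal (s + b) (s + (d + b)) b \<union> antidiagonal (s + b + b) s d"
      by (simp only: list_graph_append X_def Y_def Z_def list_graph_rev_upt) (simp add: Un_assoc)
    have r: "list_graph s (Y' @ Z' @ X') = antidiagonal s (s + b + b) d \<union> antidiagonal (s + d) s b \<union> antidiagonal (s + (d + b)) (s + b) b"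
      by (simp only: list_graph_append X'_def Y'_def Z'_def list_graph_rev_upt) (simp add: Un_assoc add_ac)
    have "prod.swap ` list_graph s (X @ Z @ Y) = list_graph s (Y' @ Z' @ X')"
      unfolding l r by (auto simp: image_Un swap_antidiagonal)
    moreover have "length (X @ Z @ Y) = d + b + b" "length (Y' @ Z' @ X') = d + b + b"
      by (simp_all add: X_def Y_def Z_def X'_def Y'_def Z'_def)
    ultimately show "list_graph 0 (P @ (Y' @ Z' @ X') @ S) = prod.swap ` list_graph 0 (map z [0..<N])"
      unfolding z(2) list_graph_append[of 0 P] list_graph_append[of "0 + length P" _ S] image_Un
      by (simp add: lP sw del: append_assoc)
    show "length (P @ (Y' @ Z' @ X') @ S) = N"
      using arg_cong[OF ul, of length] by simp
  qed
  moreover have "plactic (Y' @ Z' @ X') (Z' @ Y' @ X')"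
    by (rule plactic_word_right) (auto simp: X'_def Y'_def Z'_def sorted_rev_upt sorted_wrt_append)
  ultimately have "plactic (map (inv z) [0..<N]) (map ?u [0..<N])"
    unfolding ul by (metis plactic_context)
  then have "knuth_eq N (inv z) ?u"
    using plactic_imp_knuth_eq permutes_inv[OF zp] block_perm_permutes[OF Nu] by blast
  then have "dual_knuth_eq N z ?u"
    using inv_imp_dual_knuth_eq[OF _ zp] by (metis inv_block_perm)
  then show ?thesis
    using z(1) knuth_eq_imp_two_sided_eq dual_knuth_eq_imp_two_sided_eq two_sided_eq_trans by blast
qed

lemma block_perm_swap:
  assumes N: "sum_list us + (a + b) + sum_list vs = N"
  shows "two_sided_eq N (block_perm (us @ [a, b] @ vs)) (block_perm (us @ [b, a] @ vs))"
proof (cases "b \<le> a")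
  case False
  then have "two_sided_eq N (block_perm (us @ [b, a] @ vs)) (block_perm (us @ [a, b] @ vs))"
    using N by (intro block_perm_swap_le) auto
  then show ?thesis by (rule two_sided_eq_sym) (use N in \<open>simp add: block_perm_permutes\<close>)
qed (use block_perm_swap_le N in blast)

lemma block_perm_move:
  "sum_list us + (a + sum_list bs) + sum_list vs = N \<Longrightarrow>
    two_sided_eq N (block_perm (us @ a # bs @ vs)) (block_perm (us @ bs @ a # vs))"
proof (induction bs arbitrary: us)
  case (Cons b bs)
  have "two_sided_eq N (block_perm (us @ [a, b] @ bs @ vs)) (block_perm (us @ [b, a] @ bs @ vs))"
    using Cons.prems by (intro block_perm_swap) simp
  moreover have "two_sided_eq N (block_perm ((us @ [b]) @ a # bs @ vs)) (block_perm ((us @ [b]) @ bs @ a # vs))"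
    using Cons.prems by (intro Cons.IH) simp
  ultimately show ?case using two_sided_eq_trans by simp
qed simp

lemma block_perm_rev:
  "sum_list us + sum_list bs + sum_list vs = N \<Longrightarrow>
    two_sided_eq N (block_perm (us @ bs @ vs)) (block_perm (us @ rev bs @ vs))"
proof (induction bs arbitrary: vs)
  case (Cons b bs)
  have "two_sided_eq N (block_perm (us @ b # bs @ vs)) (block_perm (us @ bs @ b # vs))"
    using Cons.prems by (intro block_perm_move) simp
  moreover have "two_sided_eq N (block_perm (us @ bs @ b # vs)) (block_perm (us @ rev bs @ b # vs))"
    using Cons.prems by (intro Cons.IH) simp
  ultimately show ?case using two_sided_eq_trans by simp
qed simp

section \<open>Rotation by 180 degrees\<close>

definition reflection :: "nat \<Rightarrow> nat \<Rightarrow> nat" where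
  "reflection N i = (if i < N then N - 1 - i else i)"

definition rotate_perm :: "nat \<Rightarrow> (nat \<Rightarrow> nat) \<Rightarrow> nat \<Rightarrow> nat" where
  "rotate_perm N w = reflection N \<circ> w \<circ> reflection N"

lemma reflection_reflection [simp]: "reflection N (reflection N i) = i"
  by (auto simp: reflection_def)

lemma reflection_comp [simp]: "reflection N \<circ> reflection N = id"
  by (simp add: fun_eq_iff)

lemma bij_reflection: "bij (reflection N)"
  by (rule o_bij[of "reflection N"]) simp_all

lemma inv_reflection: "inv (reflection N) = reflection N"
  by (rule inv_unique_comp) simp_all

lemma reflection_permutes: "reflection N permutes {..<N}"
proof (rule bij_imp_permutes)
  show "bij_betw (reflection N) {..<N} {..<N}"
    by (rule bij_betw_byWitness[of _ "reflection N"]) (auto simp: reflection_def)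
qed (auto simp: reflection_def)

lemma rotate_perm_permutes: "w permutes {..<N} \<Longrightarrow> rotate_perm N w permutes {..<N}"
  unfolding rotate_perm_def by (intro permutes_compose reflection_permutes)

lemma inv_rotate_perm: "bij w \<Longrightarrow> inv (rotate_perm N w) = rotate_perm N (inv w)"
  unfolding rotate_perm_def
  by (simp add: o_inv_distrib bij_reflection bij_comp inv_reflection comp_assoc)

text \<open>Rotation reverses the window and complements the values; betweenness survives both. The
  window that starts at \<open>i\<close> ends at \<open>i + 2\<close>, which is reflected to
  \<open>N - 3 - i\<close>, the start of the new window.\<close>

lemma knuth_rotate_perm:
  assumes w: "w permutes {..<N}" and i: "i + 2 < N"
  shows "rotate_perm N (knuth i w) = knuth (N - 3 - i) (rotate_perm N w)"
proof -
  define k where "k = N - 3 - i"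
  have r: "reflection N k = i + 2" "reflection N (k + 1) = i + 1" "reflection N (k + 2) = i"
    using i by (auto simp: reflection_def k_def)
  have wN: "w i < N" "w (i + 1) < N" "w (i + 2) < N" using permutes_in_image[OF w] i by auto
  have btw: "between (reflection N x) (reflection N y) (reflection N z) \<longleftrightarrow> between x y z"
    if "x < N" "y < N" "z < N" for x y z using that by (auto simp: between_def reflection_def)
  have rw: "rotate_perm N w k = reflection N (w (i + 2))" "rotate_perm N w (k + 1) = reflection N (w (i + 1))"
    "rotate_perm N w (k + 2) = reflection N (w i)"
    using r by (simp_all add: rotate_perm_def del: One_nat_def add_Suc_right add_2_eq_Suc')
  have tr: "reflection N \<circ> transpose x y \<circ> reflection N = transpose (reflection N x) (reflection N y)" for x y
  proof
    fix z
    have "reflection N z = x \<longleftrightarrow> z = reflection N x" "reflection N z = y \<longleftrightarrow> z = reflection N y"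
      by auto
    then show "(reflection N \<circ> transpose x y \<circ> reflection N) z = transpose (reflection N x) (reflection N y) z"
      by (auto simp: transpose_def)
  qed
  have r': "reflection N (i + 2) = k" "reflection N (i + 1) = k + 1" "reflection N i = k + 2"
    using r by (metis reflection_reflection)+
  have sw: "knuth_swap k (rotate_perm N w) = reflection N \<circ> knuth_swap i w \<circ> reflection N"
  proof -
    consider "between (w (i + 1)) (w i) (w (i + 2))" | "between (w i) (w (i + 2)) (w (i + 1))"
      | "\<not> between (w (i + 1)) (w i) (w (i + 2))" "\<not> between (w i) (w (i + 2)) (w (i + 1))" by blast
    then show ?thesis
    proof cases
      case 1
      then have "knuth_swap i w = transpose (i + 1) (i + 2)" by (simp add: knuth_swap_def)
      moreover have "knuth_swap k (rotate_perm N w) = transpose k (k + 1)"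
        unfolding knuth_swap_def rw btw[OF wN(2,3,1)] btw[OF wN(3,1,2)]
        using 1 between_imp[OF 1] by (simp add: between_sym)
      ultimately show ?thesis by (simp only: tr r' transpose_commute[of k])
    next
      case 2
      then have "knuth_swap i w = transpose i (i + 1)" using between_imp[OF 2] by (simp add: knuth_swap_def)
      moreover have "knuth_swap k (rotate_perm N w) = transpose (k + 1) (k + 2)"
        unfolding knuth_swap_def rw btw[OF wN(2,3,1)] btw[OF wN(3,1,2)]
        using 2 by (simp add: between_sym)
      ultimately show ?thesis by (simp only: tr r' transpose_commute[of "k + 2"])
    next
      case 3
      then have "knuth_swap i w = id" by (simp add: knuth_swap_def)
      moreover have "knuth_swap k (rotate_perm N w) = id"
        unfolding knuth_swap_def rw btw[OF wN(2,3,1)] btw[OF wN(3,1,2)]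
        using 3 by (simp add: between_sym)
      ultimately show ?thesis by simp
    qed
  qed
  show ?thesis
    unfolding k_def[symmetric] knuth_def sw
    by (simp add: rotate_perm_def fun_eq_iff)
qed

lemma two_sided_eq_rotate_perm:
  assumes "two_sided_eq N w u" "w permutes {..<N}"
  shows "two_sided_eq N (rotate_perm N w) (rotate_perm N u)"
  using assms(1)
proof (induction rule: two_sided_eq_induct)
  case (knuth y i)
  have "y permutes {..<N}" using two_sided_eq_permutes knuth assms by blast
  then have "rotate_perm N (knuth i y) = knuth (N - 3 - i) (rotate_perm N y)" "N - 3 - i + 2 < N"
    using knuth knuth_rotate_perm by auto
  then show ?case
    using knuth knuth_eq_step[OF knuth_eq_refl] knuth_eq_imp_two_sided_eq two_sided_eq_trans by metis
next
  case (dual_knuth y i)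
  have y: "y permutes {..<N}" using two_sided_eq_permutes dual_knuth assms by blast
  have i: "i + 2 < N" by (fact dual_knuth)
  have "bij (knuth i (inv y))" using knuth_permutes[OF permutes_inv[OF y] i] permutes_bij by blast
  then have "rotate_perm N (dual_knuth i y) = dual_knuth (N - 3 - i) (rotate_perm N y)" "N - 3 - i + 2 < N"
    using i knuth_rotate_perm[OF permutes_inv[OF y] i]
    by (simp_all add: dual_knuth_def inv_rotate_perm permutes_bij[OF y] flip: inv_rotate_perm[OF \<open>bij (knuth i (inv y))\<close>])
  then show ?case
    using dual_knuth dual_knuth_eq_step[OF dual_knuth_eq_refl] dual_knuth_eq_imp_two_sided_eq two_sided_eq_trans by metis
qed simp

lemma rotate_perm_block_perm:
  assumes N: "sum_list bs = N"
  shows "rotate_perm N (block_perm bs) = block_perm (rev bs)"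
proof (rule permutes_eqI[of _ N])
  have Nr: "sum_list (rev bs) = N" using N by simp
  \<comment> \<open>A part that occupies the values from \<open>s\<close> to below
    \<open>s + sum_list cs\<close> starts after the rotation at the mirror image of its upper end,
    which is \<open>N - s - sum_list cs\<close>.\<close>
  have bl: "rev (map (\<lambda>v. N - 1 - v) (block_list s cs)) = block_list (N - s - sum_list cs) (rev cs)"
    if "s + sum_list cs \<le> N" for s cs
    using that
  proof (induction cs arbitrary: s)
    case (Cons b cs)
    have "map (\<lambda>v. N - 1 - v) [s..<s + b] = rev [N - s - b..<N - s]"
      by (rule nth_equalityI) (use Cons.prems in \<open>auto simp: rev_nth\<close>)
    moreover have "rev (map (\<lambda>v. N - 1 - v) (block_list (s + b) cs)) = block_list (N - (s + b) - sum_list cs) (rev cs)"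
      using Cons.prems by (intro Cons.IH) simp
    ultimately have "rev (map (\<lambda>v. N - 1 - v) (block_list s (b # cs))) =
        block_list (N - (s + b) - sum_list cs) (rev cs) @ rev [N - s - b..<N - s]"
      by (simp add: rev_map)
    also have "N - (s + b) - sum_list cs = N - s - sum_list (b # cs)" by simp
    also have "rev [N - s - b..<N - s] = block_list (N - s - sum_list (b # cs) + sum_list (rev cs)) [b]"
      using Cons.prems by simp
    finally show ?case by (simp only: block_list_append rev.simps)
  qed simp
  show "rotate_perm N (block_perm bs) permutes {..<N}" "block_perm (rev bs) permutes {..<N}"
    using block_perm_permutes[OF N] block_perm_permutes[OF Nr] rotate_perm_permutes by auto
  have "map (rotate_perm N (block_perm bs)) [0..<N] = rev (map (\<lambda>v. N - 1 - v) (map (block_perm bs) [0..<N]))"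
    using permutes_in_image[OF block_perm_permutes[OF N]]
    by (intro nth_equalityI) (auto simp: rev_nth rotate_perm_def reflection_def)
  also have "\<dots> = map (block_perm (rev bs)) [0..<N]"
    using bl[of 0 bs] by (simp add: map_block_perm[OF N] map_block_perm[OF Nr] N del: map_map)
  finally show "map (rotate_perm N (block_perm bs)) [0..<N] = map (block_perm (rev bs)) [0..<N]" .
qed

lemma two_sided_eq_rotate:
  assumes w: "w permutes {..<N}"
  shows "two_sided_eq N w (rotate_perm N w)"
proof -
  obtain bs where bs: "sum_list bs = N" "two_sided_eq N w (block_perm bs)"
    using two_sided_block_perm[OF w] by blast
  have "two_sided_eq N (block_perm bs) (block_perm (rev bs))"
    using block_perm_rev[of "[]" bs "[]" N] bs by simp
  moreover have "two_sided_eq N (rotate_perm N w) (block_perm (rev bs))"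
    using two_sided_eq_rotate_perm[OF bs(2) w] rotate_perm_block_perm[OF bs(1)] by simp
  ultimately show ?thesis
    using bs(2) two_sided_eq_sym[OF _ rotate_perm_permutes[OF w]] two_sided_eq_trans by blast
qed

section \<open>From permutations to words\<close>

lemma fibrewise_bij:
  assumes "finite X" "finite Y"
    and card: "\<And>c. card {x \<in> X. f x = c} = card {y \<in> Y. g y = c}"
  shows "\<exists>h. bij_betw h X Y \<and> (\<forall>x\<in>X. g (h x) = f x)"
proof -
  have "\<exists>h. bij_betw h {x \<in> X. f x = c} {y \<in> Y. g y = c}" for c
    using assms by (intro finite_same_card_bij) auto
  then obtain h where h: "\<And>c. bij_betw (h c) {x \<in> X. f x = c} {y \<in> Y. g y = c}" by metis
  have h1: "h (f x) x \<in> Y \<and> g (h (f x) x) = f x" if "x \<in> X" for x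
    using bij_betwE[OF h[of "f x"]] that by blast
  have "inj_on (\<lambda>x. h (f x) x) X"
  proof (rule inj_onI)
    fix x y assume xy: "x \<in> X" "y \<in> X" "h (f x) x = h (f y) y"
    then have "f x = f y" using h1 by metis
    then show "x = y" using xy inj_onD[OF bij_betw_imp_inj_on[OF h[of "f x"]], of x y] by simp
  qed
  moreover have "(\<lambda>x. h (f x) x) ` X = Y"
  proof
    show "Y \<subseteq> (\<lambda>x. h (f x) x) ` X"
    proof
      fix y assume "y \<in> Y"
      then have "y \<in> h (g y) ` {x \<in> X. f x = g y}" using bij_betw_imp_surj_on[OF h[of "g y"]] by blast
      then obtain x where "x \<in> X" "y = h (f x) x" by auto
      then show "y \<in> (\<lambda>x. h (f x) x) ` X" by blast
    qed
  qed (use h1 in blast)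
  ultimately show ?thesis using h1 by (intro exI[of _ "\<lambda>x. h (f x) x"]) (auto simp: bij_betw_def)
qed

lemma rotate_rotate [simp]: "rotate_perm N (rotate_perm N w) = w"
  by (simp add: rotate_perm_def fun_eq_iff)

lemma knuth_eq_rotate_perm:
  assumes "knuth_eq N w u" "w permutes {..<N}"
  shows "knuth_eq N (rotate_perm N w) (rotate_perm N u)"
  using assms(1)
proof (induction rule: knuth_eq_induct)
  case (step y i)
  have "y permutes {..<N}" using knuth_eq_permutes step assms by blast
  then have "rotate_perm N (knuth i y) = knuth (N - 3 - i) (rotate_perm N y)" "N - 3 - i + 2 < N"
    using step knuth_rotate_perm by auto
  then show ?case using step knuth_eq_step by metis
qed simp

text \<open>Every \<open>w\<close> has to be sent to its own dual class and to the Knuth class of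
  its rotation. With pairs of classes as labels this is a question of equal fibres. The fibres in
  question are the intersections of the dual class of some \<open>v\<close> with the Knuth classes
  of \<open>v\<close> and of its rotation, and these two permutations are two-sided
  equivalent.\<close>

lemma perm_bijection_classes:
  "\<exists>\<psi>. bij_betw \<psi> {w. w permutes {..<N}} {w. w permutes {..<N}} \<and>
     (\<forall>w. w permutes {..<N} \<longrightarrow> dual_knuth_eq N w (\<psi> w) \<and> knuth_eq N (rotate_perm N w) (\<psi> w))"
proof -
  let ?S = "{w. w permutes {..<N}}"
  define f where "f w = (Collect (dual_knuth_eq N w), Collect (knuth_eq N (rotate_perm N w)))" for w
  define g where "g w = (Collect (dual_knuth_eq N w), Collect (knuth_eq N w))" for w
  have fin: "finite ?S" by (rule finite_permutations) simp
  have D: "Collect (dual_knuth_eq N w) = Collect (dual_knuth_eq N u) \<longleftrightarrow> dual_knuth_eq N w u"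
    if "w permutes {..<N}" for w u
    using that dual_knuth_eq_sym dual_knuth_eq_trans dual_knuth_eq_permutes
    by (metis (mono_tags, lifting) Collect_cong dual_knuth_eq_refl mem_Collect_eq)
  have K: "Collect (knuth_eq N w) = Collect (knuth_eq N u) \<longleftrightarrow> knuth_eq N w u" for w u
    using knuth_eq_sym knuth_eq_trans
    by (metis (mono_tags, lifting) Collect_cong knuth_eq_refl mem_Collect_eq)
  have rot: "knuth_eq N (rotate_perm N w) u \<longleftrightarrow> knuth_eq N w (rotate_perm N u)"
    if "w permutes {..<N}" for w u
    using knuth_eq_rotate_perm[of N "rotate_perm N w" u] knuth_eq_rotate_perm[of N w "rotate_perm N u"]
      rotate_perm_permutes[OF that] that by auto
  have eq: "card {w \<in> ?S. dual_knuth_eq N v w \<and> knuth_eq N (rotate_perm N v) w}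
      = card {w \<in> ?S. dual_knuth_eq N v w \<and> knuth_eq N v w}" if "v permutes {..<N}" for v
  proof -
    have "{w \<in> ?S. dual_knuth_eq N v w \<and> P w} = {w. dual_knuth_eq N v w \<and> P w}" for P
      using dual_knuth_eq_permutes that by blast
    then show ?thesis
      using card_knuth_dual_knuth_class[OF two_sided_eq_rotate[OF that] that that] by simp
  qed
  have card: "card {w \<in> ?S. f w = c} = card {w \<in> ?S. g w = c}" for c
  proof (cases "\<exists>v\<in>?S. f v = c")
    case True
    then obtain v where v: "v permutes {..<N}" "c = f v" by blast
    \<comment> \<open>Rotation respects Knuth equivalence, so a common class of the rotations means
      a common class of the permutations themselves.\<close>
    have "{w \<in> ?S. f w = c} = {w \<in> ?S. dual_knuth_eq N v w \<and> knuth_eq N v w}"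
      using D K rot v dual_knuth_eq_sym knuth_eq_sym knuth_eq_rotate_perm
      by (auto simp: f_def rotate_perm_permutes)
    moreover have "{w \<in> ?S. g w = c} = {w \<in> ?S. dual_knuth_eq N v w \<and> knuth_eq N (rotate_perm N v) w}"
      using D K v dual_knuth_eq_sym knuth_eq_sym by (auto simp: f_def g_def)
    ultimately show ?thesis using eq[OF v(1)] by simp
  next
    case False
    \<comment> \<open>A label missed by \<open>f\<close> is missed by \<open>g\<close>, too: the
      intersection belonging to the rotation of \<open>v\<close> has as many elements as the one
      that contains \<open>v\<close>, and any \<open>u\<close> in it satisfies
      \<open>f u = g v\<close>.\<close>
    have "g v \<noteq> c" if v: "v permutes {..<N}" for v
    proof
      assume c: "g v = c"
      have "v \<in> {w \<in> ?S. dual_knuth_eq N v w \<and> knuth_eq N v w}" using v by simp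
      moreover have "finite {w \<in> ?S. dual_knuth_eq N v w \<and> knuth_eq N v w}"
        by (rule finite_subset[OF _ fin]) blast
      ultimately have "card {w \<in> ?S. dual_knuth_eq N v w \<and> knuth_eq N v w} \<noteq> 0"
        using card_0_eq by blast
      then have "{w \<in> ?S. dual_knuth_eq N v w \<and> knuth_eq N (rotate_perm N v) w} \<noteq> {}"
        using eq[OF v] by (metis (no_types, lifting) card.empty)
      then obtain u where u: "u permutes {..<N}" "dual_knuth_eq N v u" "knuth_eq N (rotate_perm N v) u" by blast
      have "Collect (dual_knuth_eq N v) = Collect (dual_knuth_eq N u)" using D[OF v] u(2) by blast
      moreover have "Collect (knuth_eq N v) = Collect (knuth_eq N (rotate_perm N u))"
        using rot[OF v, of u] K u(3) by blast
      ultimately have "f u = c" using c by (simp add: f_def g_def)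
      then show False using False u by blast
    qed
    then show ?thesis using False by (metis (mono_tags, lifting) Collect_empty_eq mem_Collect_eq)
  qed
  obtain \<psi> where \<psi>: "bij_betw \<psi> ?S ?S" "\<forall>w\<in>?S. g (\<psi> w) = f w"
    using fibrewise_bij[OF fin fin card] by blast
  have "dual_knuth_eq N w (\<psi> w) \<and> knuth_eq N (rotate_perm N w) (\<psi> w)" if w: "w permutes {..<N}" for w
  proof -
    have "g (\<psi> w) = f w" "\<psi> w permutes {..<N}" using \<psi> w bij_betwE[OF \<psi>(1)] by blast+
    then show ?thesis using D[OF w, of "\<psi> w"] K knuth_eq_sym by (auto simp: f_def g_def)
  qed
  then show ?thesis using \<psi> by blast
qed

text \<open>Dual moves keep the chains in intervals of positions. Knuth moves keep those in
  intervals of values of the rotated permutation, and rotation keeps comparability while reversing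
  the values.\<close>

lemma perm_bijection:
  "\<exists>\<psi>. bij_betw \<psi> {w. w permutes {..<N}} {w. w permutes {..<N}} \<and>
     (\<forall>w. w permutes {..<N} \<longrightarrow>
        (\<forall>A. ord_convex A \<longrightarrow> max_ne (graph N (\<psi> w) \<inter> A \<times> UNIV) = max_ne (graph N w \<inter> A \<times> UNIV)) \<and>
        (\<forall>B. ord_convex B \<longrightarrow>
           max_ne (graph N (\<psi> w) \<inter> UNIV \<times> B) = max_ne (graph N w \<inter> UNIV \<times> reflection N -` B)))"
proof -
  obtain \<psi> where \<psi>: "bij_betw \<psi> {w. w permutes {..<N}} {w. w permutes {..<N}}"
    "\<And>w. w permutes {..<N} \<Longrightarrow> dual_knuth_eq N w (\<psi> w) \<and> knuth_eq N (rotate_perm N w) (\<psi> w)"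
    using perm_bijection_classes by blast
  have "max_ne (graph N (\<psi> w) \<inter> UNIV \<times> B) = max_ne (graph N w \<inter> UNIV \<times> reflection N -` B)"
    if w: "w permutes {..<N}" and B: "ord_convex B" for w B
  proof -
    let ?h = "map_prod (reflection N) (reflection N)"
    have less: "reflection N i < N" if "i < N" for i using that by (auto simp: reflection_def)
    have "?h ` (graph N w \<inter> UNIV \<times> reflection N -` B) = graph N (rotate_perm N w) \<inter> UNIV \<times> B"
    proof
      show "?h ` (graph N w \<inter> UNIV \<times> reflection N -` B) \<subseteq> graph N (rotate_perm N w) \<inter> UNIV \<times> B"
        by (auto simp: graph_def rotate_perm_def less intro!: image_eqI[of _ _ "reflection N _"])
      show "graph N (rotate_perm N w) \<inter> UNIV \<times> B \<subseteq> ?h ` (graph N w \<inter> UNIV \<times> reflection N -` B)"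
      proof
        fix c assume "c \<in> graph N (rotate_perm N w) \<inter> UNIV \<times> B"
        then obtain i where i: "i < N" "c = (i, rotate_perm N w i)" "rotate_perm N w i \<in> B"
          by (auto simp: graph_def)
        then have "c = ?h (reflection N i, w (reflection N i))" "reflection N i < N"
          by (auto simp: rotate_perm_def less)
        moreover have "(reflection N i, w (reflection N i)) \<in> graph N w \<inter> UNIV \<times> reflection N -` B"
          using i calculation(2) by (auto simp: graph_def rotate_perm_def)
        ultimately show "c \<in> ?h ` (graph N w \<inter> UNIV \<times> reflection N -` B)" by blast
      qed
    qed
    moreover have "max_ne (?h ` (graph N w \<inter> UNIV \<times> reflection N -` B)) = max_ne (graph N w \<inter> UNIV \<times> reflection N -` B)"
    proof (rule max_ne_image)
      have r: "reflection N a < reflection N b \<longleftrightarrow> b < a" if "a < N" "b < N" for a b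
        using that by (auto simp: reflection_def)
      fix c d assume "c \<in> graph N w \<inter> UNIV \<times> reflection N -` B" "d \<in> graph N w \<inter> UNIV \<times> reflection N -` B"
      then have "c \<in> graph N w" "d \<in> graph N w" by blast+
      then obtain i j where "i < N" "c = (i, w i)" "j < N" "d = (j, w j)" by (auto simp: graph_def)
      then have "fst c < N" "snd c < N" "fst d < N" "snd d < N"
        using permutes_in_image[OF w, of i] permutes_in_image[OF w, of j] by simp_all
      then show "ne_comparable (?h c) (?h d) \<longleftrightarrow> ne_comparable c d"
        by (auto simp: ne_comparable_def ne_less_def r)
    qed simp
    ultimately show ?thesis
      using max_ne_knuth_eq[OF conjunct2[OF \<psi>(2)[OF w]] rotate_perm_permutes[OF w] B] by simp
  qed
  moreover have "max_ne (graph N (\<psi> w) \<inter> A \<times> UNIV) = max_ne (graph N w \<inter> A \<times> UNIV)"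
    if "w permutes {..<N}" "ord_convex A" for w A
    using max_ne_dual_knuth_eq \<psi>(2) that by blast
  ultimately show ?thesis using \<psi>(1) by blast
qed

section \<open>Standardization of words\<close>

text \<open>Equal letters are numbered from right to left, since strictly increasing subsequences are
  considered.\<close>

definition precedes :: "(nat \<Rightarrow> nat) \<Rightarrow> nat \<Rightarrow> nat \<Rightarrow> bool" where
  "precedes y s t \<longleftrightarrow> y s < y t \<or> y s = y t \<and> t < s"

definition standardize :: "nat \<Rightarrow> (nat \<Rightarrow> nat) \<Rightarrow> nat \<Rightarrow> nat" where
  "standardize N y t = (if t < N then card {s. s < N \<and> precedes y s t} else t)"

lemma standardize_less:
  assumes "s < N" "t < N" shows "standardize N y s < standardize N y t \<longleftrightarrow> precedes y s t"
proof -
  have *: "standardize N y a < standardize N y b" if "precedes y a b" "a < N" "b < N" for a b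
  proof -
    have "{s. s < N \<and> precedes y s a} \<subset> {s. s < N \<and> precedes y s b}"
      using that by (auto simp: precedes_def)
    then show ?thesis using that by (simp add: standardize_def psubset_card_mono)
  qed
  have "s = t \<or> precedes y s t \<or> precedes y t s" by (auto simp: precedes_def)
  then show ?thesis using *[OF _ assms] *[OF _ assms(2,1)] by (metis less_asym less_irrefl precedes_def)
qed

lemma standardize_permutes: "standardize N y permutes {..<N}"
proof (rule bij_imp_permutes)
  have "inj_on (standardize N y) {..<N}"
  proof (rule inj_onI)
    fix s t assume st: "s \<in> {..<N}" "t \<in> {..<N}" "standardize N y s = standardize N y t"
    then have "\<not> precedes y s t" "\<not> precedes y t s"
      using standardize_less[of s N t y] standardize_less[of t N s y] by auto
    then show "s = t" by (auto simp: precedes_def)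
  qed
  moreover have "standardize N y ` {..<N} \<subseteq> {..<N}"
  proof clarsimp
    fix t assume "t < N"
    then have "{s. s < N \<and> precedes y s t} \<subset> {..<N}" by (auto simp: precedes_def)
    then have "card {s. s < N \<and> precedes y s t} < card {..<N}" by (intro psubset_card_mono) auto
    then show "standardize N y t < N" using \<open>t < N\<close> by (simp add: standardize_def)
  qed
  ultimately show "bij_betw (standardize N y) {..<N} {..<N}"
    by (simp add: bij_betw_def endo_inj_surj)
qed (simp add: standardize_def)

text \<open>Comparing only positions \<open>s < t\<close> encodes the treatment of ties as well:
  equal letters have no ascent in \<open>v\<close>, so the ranks decrease along them. The value
  \<open>v t\<close> is the number of positions with smaller values.\<close>

lemma standardize_unique:
  assumes v: "v permutes {..<N}"
    and vy: "\<And>s t. s < t \<Longrightarrow> t < N \<Longrightarrow> v s < v t \<longleftrightarrow> y s < y t"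
  shows "standardize N y = v"
proof
  fix t
  show "standardize N y t = v t"
  proof (cases "t < N")
    case True
    have "v s < v t \<longleftrightarrow> precedes y s t" if "s < N" for s
    proof -
      have "v s = v t \<longleftrightarrow> s = t" using permutes_inj[OF v] by (simp add: inj_eq)
      then show ?thesis using vy[of s t] vy[of t s] True that
        by (cases s t rule: linorder_cases) (auto simp: precedes_def)
    qed
    then have "{s. s < N \<and> precedes y s t} = {s. s < N \<and> v s < v t}" by auto
    also have "\<dots> = inv v ` {..<v t}"
    proof -
      have "v t < N" using permutes_in_image[OF v] True by simp
      then have "inv v k < N" if "k < v t" for k
        using permutes_in_image[OF permutes_inv[OF v], of k] that by simp
      then show ?thesis by (auto simp: permutes_inverses[OF v] intro!: image_eqI[of _ "inv v" "v _"])
    qed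
    also have "card \<dots> = v t" using permutes_inj[OF permutes_inv[OF v]] by (simp add: card_image inj_on_subset)
    finally show ?thesis using True by (simp add: standardize_def)
  next
    case False
    then show ?thesis using permutes_not_in[OF v] by (simp add: standardize_def)
  qed
qed

lemma max_ne_graph_letters:
  assumes v: "v permutes {..<N}" and vy: "\<And>s t. s < t \<Longrightarrow> t < N \<Longrightarrow> v s < v t \<longleftrightarrow> y s < y t"
    and y: "\<And>t. t < N \<Longrightarrow> y t = k (v t)"
  shows "max_ne (graph N y \<inter> A \<times> B) = max_ne (graph N v \<inter> A \<times> {j. j < N \<and> k j \<in> B})"
proof -
  have "graph N y \<inter> A \<times> B = map_prod id k ` (graph N v \<inter> A \<times> {j. j < N \<and> k j \<in> B})"
  proof
    show "graph N y \<inter> A \<times> B \<subseteq> map_prod id k ` (graph N v \<inter> A \<times> {j. j < N \<and> k j \<in> B})"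
    proof
      fix c assume "c \<in> graph N y \<inter> A \<times> B"
      then obtain t where t: "t < N" "c = (t, y t)" "t \<in> A" "y t \<in> B" by (auto simp: graph_def)
      then have "c = map_prod id k (t, v t)" "(t, v t) \<in> graph N v \<inter> A \<times> {j. j < N \<and> k j \<in> B}"
        using y[of t] permutes_in_image[OF v, of t] by (auto simp: graph_def)
      then show "c \<in> map_prod id k ` (graph N v \<inter> A \<times> {j. j < N \<and> k j \<in> B})" by (rule image_eqI)
    qed
  qed (use y in \<open>auto simp: graph_def\<close>)
  moreover have "max_ne (map_prod id k ` (graph N v \<inter> A \<times> {j. j < N \<and> k j \<in> B})) =
      max_ne (graph N v \<inter> A \<times> {j. j < N \<and> k j \<in> B})"
  proof (rule max_ne_image)
    fix c d assume "c \<in> graph N v \<inter> A \<times> {j. j < N \<and> k j \<in> B}" "d \<in> graph N v \<inter> A \<times> {j. j < N \<and> k j \<in> B}"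
    then obtain s t where "s < N" "t < N" "c = (s, v s)" "d = (t, v t)" by (auto simp: graph_def)
    then show "ne_comparable (map_prod id k c) (map_prod id k d) \<longleftrightarrow> ne_comparable c d"
      using vy[of s t] vy[of t s] by (auto simp: ne_comparable_Pair y)
  qed simp
  ultimately show ?thesis by simp
qed

text \<open>A word splits into its standardization and its sorted letters; the bijection on
  permutations is applied to the former and the letters are complemented. The crucial point is that
  the image permutation standardizes the new word. The ranks of a letter form an interval on which
  the old permutation has no ascent, and the absence of ascents is one of the statistics that the
  bijection transfers to the reflected interval.\<close>

lemma word_bijection:
  fixes N m :: nat
  defines "W \<equiv> {..<N} \<rightarrow>\<^sub>E {..<m}"
  shows "\<exists>\<Phi>. bij_betw \<Phi> W W \<and>
     (\<forall>y\<in>W. (\<forall>A. ord_convex A \<longrightarrow> max_ne (graph N (\<Phi> y) \<inter> A \<times> UNIV) = max_ne (graph N y \<inter> A \<times> UNIV)) \<and>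
        (\<forall>B. ord_convex B \<longrightarrow>
           max_ne (graph N (\<Phi> y) \<inter> UNIV \<times> B) = max_ne (graph N y \<inter> UNIV \<times> reflection m -` B)))"
proof -
  obtain \<psi> where \<psi>: "bij_betw \<psi> {w. w permutes {..<N}} {w. w permutes {..<N}}"
    and \<psi>A: "\<And>w A. w permutes {..<N} \<Longrightarrow> ord_convex A \<Longrightarrow>
        max_ne (graph N (\<psi> w) \<inter> A \<times> UNIV) = max_ne (graph N w \<inter> A \<times> UNIV)"
    and \<psi>B: "\<And>w B. w permutes {..<N} \<Longrightarrow> ord_convex B \<Longrightarrow>
        max_ne (graph N (\<psi> w) \<inter> UNIV \<times> B) = max_ne (graph N w \<inter> UNIV \<times> reflection N -` B)"
    using perm_bijection[of N] by blast
  have \<psi>p: "\<psi> w permutes {..<N}" if "w permutes {..<N}" for w using bij_betwE[OF \<psi>] that by blast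
  \<comment> \<open>\<open>k y\<close> is the weakly increasing list of the letters of
    \<open>y\<close>, indexed by rank; \<open>k' y\<close> is the same for the complemented letters,
    so both indices and letters are reflected.\<close>
  define k where "k y = y \<circ> inv (standardize N y)" for y :: "nat \<Rightarrow> nat"
  define k' where "k' y j = reflection m (k y (reflection N j))" for y j
  define \<Phi> where "\<Phi> y = (\<lambda>t. if t < N then k' y (\<psi> (standardize N y) t) else undefined)" for y
  have r: "reflection n i < n \<longleftrightarrow> i < n" for n i by (auto simp: reflection_def)
  have std: "standardize N y s < standardize N y t \<longleftrightarrow> y s < y t" if "s < t" "t < N" for y s t
    using standardize_less[of s N t y] that by (auto simp: precedes_def)
  have ky: "y t = k y (standardize N y t)" for y t
    by (simp add: k_def permutes_inverses[OF standardize_permutes])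
  have k_mono: "k y i \<le> k y j" if "i \<le> j" "j < N" for y i j
  proof (rule ccontr)
    let ?v = "standardize N y"
    assume "\<not> k y i \<le> k y j"
    then have "precedes y (inv ?v j) (inv ?v i)" by (simp add: k_def precedes_def)
    moreover have "inv ?v i < N" "inv ?v j < N"
      using permutes_in_image[OF permutes_inv[OF standardize_permutes, of N y]] that by simp_all
    ultimately have "?v (inv ?v j) < ?v (inv ?v i)" by (simp add: standardize_less)
    then show False using that by (simp add: permutes_inverses[OF standardize_permutes])
  qed
  have k_less: "k y j < m" if "y \<in> W" "j < N" for y j
    using that permutes_in_image[OF permutes_inv[OF standardize_permutes, of N y], of j]
    by (auto simp: k_def W_def PiE_iff)
  have k'_less: "k' y j < m" if "y \<in> W" "j < N" for y j
    using that k_less by (simp add: k'_def r)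
  have k'_mono: "k' y i \<le> k' y j" if "y \<in> W" "i \<le> j" "j < N" for y i j
  proof -
    have "k y (reflection N j) \<le> k y (reflection N i)" using that by (intro k_mono) (auto simp: reflection_def)
    moreover have "k y (reflection N j) < m" "k y (reflection N i) < m" using that k_less r by auto
    moreover have "reflection m b \<le> reflection m a" if "a \<le> b" "b < m" for a b
      using that by (auto simp: reflection_def)
    ultimately show ?thesis by (simp add: k'_def)
  qed
  have compat: "\<psi> (standardize N y) s < \<psi> (standardize N y) t \<longleftrightarrow> \<Phi> y s < \<Phi> y t"
    if y: "y \<in> W" and st: "s < t" "t < N" for y s t
  proof -
    let ?v = "standardize N y" and ?v' = "\<psi> (standardize N y)"
    have lt: "?v' s < N" "?v' t < N" using permutes_in_image[OF \<psi>p[OF standardize_permutes]] st by auto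
    have "?v' s < ?v' t \<longleftrightarrow> k' y (?v' s) < k' y (?v' t)"
    proof
      show "?v' s < ?v' t" if "k' y (?v' s) < k' y (?v' t)"
        using k'_mono[OF y, of "?v' t" "?v' s"] that lt by (meson leD leI)
      assume less: "?v' s < ?v' t"
      show "k' y (?v' s) < k' y (?v' t)"
      proof (rule ccontr)
        assume "\<not> k' y (?v' s) < k' y (?v' t)"
        then have eq: "k' y (?v' s) = k' y (?v' t)" using k'_mono[OF y, of "?v' s" "?v' t"] less lt by simp
        \<comment> \<open>By monotonicity all ranks in \<open>?B\<close> carry the same letter, so
          an ascent of \<open>?v\<close> in the reflected ranks would be an ascent between equal
          letters.\<close>
        let ?B = "{?v' s..?v' t}"
        have "card {(s, ?v' s), (t, ?v' t)} \<le> max_ne (graph N ?v' \<inter> UNIV \<times> ?B)"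
          using st less by (intro max_ne_ge) (auto simp: ne_set_def ne_comparable_Pair graph_def)
        also have "\<dots> = max_ne (graph N ?v \<inter> UNIV \<times> reflection N -` ?B)"
          by (rule \<psi>B[OF standardize_permutes]) simp
        also have "\<dots> \<le> 1"
        proof (subst max_ne_le_1_iff; (intro ballI notI)?)
          fix a b assume ab: "a \<in> graph N ?v \<inter> UNIV \<times> reflection N -` ?B"
            "b \<in> graph N ?v \<inter> UNIV \<times> reflection N -` ?B" "ne_less a b"
          then obtain p q where pq: "p < N" "q < N" "a = (p, ?v p)" "b = (q, ?v q)"
            "reflection N (?v p) \<in> ?B" "reflection N (?v q) \<in> ?B" by (auto simp: graph_def)
          then have "p < q" "?v p < ?v q" using ab by (auto simp: ne_less_def)
          then have less: "y p < y q" using std pq by blast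
          have "k' y (reflection N (?v q)) = k' y (reflection N (?v p))"
            using k'_mono[OF y] pq(5,6) eq lt by (smt (verit) atLeastAtMost_iff le_less_trans order_antisym)
          then have "reflection m (y q) = reflection m (y p)" by (simp add: k'_def flip: ky)
          then show False using less by (metis less_irrefl reflection_reflection)
        qed simp
        finally show False using st by simp
      qed
    qed
    then show ?thesis using st by (simp add: \<Phi>_def)
  qed
  have \<Phi>W: "\<Phi> y \<in> W" if "y \<in> W" for y
    using that k'_less permutes_in_image[OF \<psi>p[OF standardize_permutes]]
    by (auto simp: \<Phi>_def W_def PiE_iff extensional_def)
  have std\<Phi>: "standardize N (\<Phi> y) = \<psi> (standardize N y)" if "y \<in> W" for y
    using standardize_unique[OF \<psi>p[OF standardize_permutes]] compat[OF that] by blast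
  have "inj_on \<Phi> W"
  proof (rule inj_onI)
    fix y z assume yz: "y \<in> W" "z \<in> W" "\<Phi> y = \<Phi> z"
    have "\<psi> (standardize N y) = \<psi> (standardize N z)" using yz std\<Phi> by metis
    then have v: "standardize N y = standardize N z"
      using inj_onD[OF bij_betw_imp_inj_on[OF \<psi>]] standardize_permutes by blast
    have k'eq: "k' y j = k' z j" if "j < N" for j
    proof -
      let ?v' = "\<psi> (standardize N y)"
      have p: "?v' permutes {..<N}" using \<psi>p standardize_permutes by blast
      have "inv ?v' j < N" using permutes_in_image[OF permutes_inv[OF p], of j] that by simp
      then have "k' y (?v' (inv ?v' j)) = k' z (?v' (inv ?v' j))"
        using fun_cong[OF yz(3), of "inv ?v' j"] by (simp add: \<Phi>_def v)
      then show ?thesis by (simp add: permutes_inverses[OF p])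
    qed
    have keq: "k y j = k z j" if "j < N" for j
      using k'eq[of "reflection N j"] that r by (simp add: k'_def) (metis reflection_reflection)
    show "y = z"
    proof
      fix t
      show "y t = z t"
      proof (cases "t < N")
        case True
        then show ?thesis using keq[of "standardize N y t"] ky[of y t] ky[of z t] v
            permutes_in_image[OF standardize_permutes, of N y t] by simp
      next
        case False
        then show ?thesis using yz by (auto simp: W_def PiE_iff extensional_def)
      qed
    qed
  qed
  moreover have "finite W" unfolding W_def by (intro finite_PiE) auto
  ultimately have "bij_betw \<Phi> W W"
    using \<Phi>W by (simp add: bij_betw_def endo_inj_surj image_subsetI)
  moreover have "max_ne (graph N (\<Phi> y) \<inter> A \<times> UNIV) = max_ne (graph N y \<inter> A \<times> UNIV)"
    if y: "y \<in> W" and A: "ord_convex A" for y A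
  proof -
    have "{j. j < N \<and> f j \<in> UNIV} = {..<N}" for f :: "nat \<Rightarrow> nat" by auto
    moreover have "graph N w \<inter> A \<times> {..<N} = graph N w \<inter> A \<times> UNIV" if "w permutes {..<N}" for w
      using permutes_in_image[OF that] by (auto simp: graph_def)
    ultimately show ?thesis
      using max_ne_graph_letters[OF \<psi>p[OF standardize_permutes] compat[OF y], of "k' y" A UNIV]
        max_ne_graph_letters[where k = "k y", OF standardize_permutes[of N y] std[of _ _ y] ky[of y], of A UNIV]
        \<psi>A[OF standardize_permutes A] \<psi>p[OF standardize_permutes] standardize_permutes
      by (simp add: \<Phi>_def)
  qed
  moreover have "max_ne (graph N (\<Phi> y) \<inter> UNIV \<times> B) = max_ne (graph N y \<inter> UNIV \<times> reflection m -` B)"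
    if y: "y \<in> W" and B: "ord_convex B" for y B
  proof -
    let ?v = "standardize N y"
    have "ord_convex {j. j < N \<and> k' y j \<in> B}"
      using ord_convexD[OF B] k'_mono[OF y] unfolding ord_convex_def
      by (smt (verit) le_less_trans mem_Collect_eq)
    then have "max_ne (graph N (\<psi> ?v) \<inter> UNIV \<times> {j. j < N \<and> k' y j \<in> B}) =
        max_ne (graph N ?v \<inter> UNIV \<times> reflection N -` {j. j < N \<and> k' y j \<in> B})"
      by (rule \<psi>B[OF standardize_permutes])
    moreover have "reflection N -` {j. j < N \<and> k' y j \<in> B} = {j. j < N \<and> k y j \<in> reflection m -` B}"
      by (auto simp: r k'_def)
    ultimately show ?thesis
      using max_ne_graph_letters[OF \<psi>p[OF standardize_permutes] compat[OF y], of "k' y" UNIV B]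
        max_ne_graph_letters[where k = "k y", OF standardize_permutes[of N y] std[of _ _ y] ky[of y], of UNIV "reflection m -` B"]
      by (simp add: \<Phi>_def)
  qed
  ultimately show ?thesis by blast
qed

section \<open>From words to sets of cells\<close>

definition row_count :: "(nat \<times> nat) set \<Rightarrow> nat \<Rightarrow> nat" where
  "row_count S j = card {i. (i, j) \<in> S}"

text \<open>A filling with non-negative integers is a list of units: position \<open>t\<close> is a
  unit in row \<open>\<rho> t\<close> and column \<open>y t\<close>. Units of the same row are
  listed from right to left, so that they never form an ascent.\<close>

definition decreasing_words :: "nat \<Rightarrow> nat \<Rightarrow> (nat \<Rightarrow> nat) \<Rightarrow> (nat \<Rightarrow> nat) set" where
  "decreasing_words m N \<rho> =
     {y \<in> {..<N} \<rightarrow>\<^sub>E {..<m}. \<forall>s t. s < t \<and> t < N \<and> \<rho> s = \<rho> t \<longrightarrow> y t \<le> y s}"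

definition support :: "nat \<Rightarrow> (nat \<Rightarrow> nat) \<Rightarrow> (nat \<Rightarrow> nat) \<Rightarrow> (nat \<times> nat) set" where
  "support N \<rho> y = (\<lambda>t. (y t, \<rho> t)) ` {..<N}"

lemma finite_decreasing_words: "finite (decreasing_words m N \<rho>)"
  unfolding decreasing_words_def
  by (rule finite_subset[of _ "{..<N} \<rightarrow>\<^sub>E {..<m}"]) (auto intro: finite_PiE)

text \<open>Inside a row the word decreases weakly. Hence an ascent of the word joins two different
  rows and corresponds to a step of the support to the north-east.\<close>

lemma max_ne_support:
  assumes y: "y \<in> decreasing_words m N \<rho>" and \<rho>: "\<And>s t. s \<le> t \<Longrightarrow> t < N \<Longrightarrow> \<rho> s \<le> \<rho> t"
  shows "max_ne (support N \<rho> y \<inter> A \<times> J) = max_ne (graph N y \<inter> {t. t < N \<and> \<rho> t \<in> J} \<times> A)"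
proof -
  let ?h = "\<lambda>(t, i). (i, \<rho> t)"
  have "support N \<rho> y \<inter> A \<times> J = ?h ` (graph N y \<inter> {t. t < N \<and> \<rho> t \<in> J} \<times> A)"
  proof
    show "support N \<rho> y \<inter> A \<times> J \<subseteq> ?h ` (graph N y \<inter> {t. t < N \<and> \<rho> t \<in> J} \<times> A)"
    proof
      fix c assume "c \<in> support N \<rho> y \<inter> A \<times> J"
      then obtain t where "t < N" "c = (y t, \<rho> t)" "y t \<in> A" "\<rho> t \<in> J" by (auto simp: support_def)
      then have "c = ?h (t, y t)" "(t, y t) \<in> graph N y \<inter> {t. t < N \<and> \<rho> t \<in> J} \<times> A"
        by (auto simp: graph_def)
      then show "c \<in> ?h ` (graph N y \<inter> {t. t < N \<and> \<rho> t \<in> J} \<times> A)" by blast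
    qed
  qed (auto simp: graph_def support_def)
  moreover have "max_ne (?h ` (graph N y \<inter> {t. t < N \<and> \<rho> t \<in> J} \<times> A)) =
      max_ne (graph N y \<inter> {t. t < N \<and> \<rho> t \<in> J} \<times> A)"
  proof (rule max_ne_image)
    have *: "y s < y t \<and> \<rho> s < \<rho> t \<longleftrightarrow> y s < y t \<and> s < t" if "s < N" "t < N" for s t
    proof
      assume st: "y s < y t \<and> \<rho> s < \<rho> t"
      then show "y s < y t \<and> s < t" using \<rho>[of t s] that by (meson leD leI)
    next
      assume st: "y s < y t \<and> s < t"
      then have "\<rho> s \<noteq> \<rho> t" using y that unfolding decreasing_words_def by fastforce
      then show "y s < y t \<and> \<rho> s < \<rho> t" using \<rho>[of s t] st that by simp
    qed
    fix c d assume "c \<in> graph N y \<inter> {t. t < N \<and> \<rho> t \<in> J} \<times> A" "d \<in> graph N y \<inter> {t. t < N \<and> \<rho> t \<in> J} \<times> A"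
    then obtain s t where "s < N" "t < N" "c = (s, y s)" "d = (t, y t)" by (auto simp: graph_def)
    then show "ne_comparable (?h c) (?h d) \<longleftrightarrow> ne_comparable c d"
      using *[of s t] *[of t s] by (auto simp: ne_comparable_Pair)
  qed simp
  ultimately show ?thesis by simp
qed

text \<open>Each row is an interval of positions, and decreasing weakly on it means that increasing
  subsequences there have length at most 1. The bijection of \<open>word_bijection\<close> keeps
  this statistic and therefore restricts to decreasing words.\<close>

lemma decreasing_word_bijection:
  assumes \<rho>: "\<And>s t. s \<le> t \<Longrightarrow> t < N \<Longrightarrow> \<rho> s \<le> \<rho> t"
  shows "\<exists>\<Phi>. bij_betw \<Phi> (decreasing_words m N \<rho>) (decreasing_words m N \<rho>) \<and>
     (\<forall>y\<in>decreasing_words m N \<rho>.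
        (\<forall>J. ord_convex J \<longrightarrow>
           max_ne (support N \<rho> (\<Phi> y) \<inter> UNIV \<times> J) = max_ne (support N \<rho> y \<inter> UNIV \<times> J)) \<and>
        (\<forall>A. ord_convex A \<longrightarrow>
           max_ne (support N \<rho> (\<Phi> y) \<inter> A \<times> UNIV) = max_ne (support N \<rho> y \<inter> reflection m -` A \<times> UNIV)))"
proof -
  let ?W = "{..<N} \<rightarrow>\<^sub>E {..<m}" and ?D = "decreasing_words m N \<rho>"
  obtain \<Phi> where \<Phi>: "bij_betw \<Phi> ?W ?W"
    and A: "\<And>y A. y \<in> ?W \<Longrightarrow> ord_convex A \<Longrightarrow> max_ne (graph N (\<Phi> y) \<inter> A \<times> UNIV) = max_ne (graph N y \<inter> A \<times> UNIV)"
    and B: "\<And>y B. y \<in> ?W \<Longrightarrow> ord_convex B \<Longrightarrow>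
        max_ne (graph N (\<Phi> y) \<inter> UNIV \<times> B) = max_ne (graph N y \<inter> UNIV \<times> reflection m -` B)"
    using word_bijection[of N m] by blast
  have DW: "?D \<subseteq> ?W" by (auto simp: decreasing_words_def)
  have dec: "\<Phi> y \<in> ?D" if y: "y \<in> ?D" for y
  proof -
    have yW: "y \<in> ?W" using y DW by blast
    have "\<Phi> y t \<le> \<Phi> y s" if st: "s < t" "t < N" "\<rho> s = \<rho> t" for s t
    proof (rule ccontr)
      assume "\<not> \<Phi> y t \<le> \<Phi> y s"
      then have "ne_less (s, \<Phi> y s) (t, \<Phi> y t)" using st by (simp add: ne_less_def)
      moreover have "(s, \<Phi> y s) \<in> graph N (\<Phi> y) \<inter> {s..t} \<times> UNIV" "(t, \<Phi> y t) \<in> graph N (\<Phi> y) \<inter> {s..t} \<times> UNIV"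
        using st by (auto simp: graph_def)
      ultimately have "\<not> max_ne (graph N (\<Phi> y) \<inter> {s..t} \<times> UNIV) \<le> 1"
        using max_ne_le_1_iff[of "graph N (\<Phi> y) \<inter> {s..t} \<times> UNIV"] by auto
      then have "\<not> max_ne (graph N y \<inter> {s..t} \<times> UNIV) \<le> 1" using A[OF yW] by simp
      then obtain p q where pq: "s \<le> p" "p \<le> t" "s \<le> q" "q \<le> t" "p < q" "y p < y q"
        by (subst (asm) max_ne_le_1_iff) (auto simp: graph_def ne_less_def)
      then have "\<rho> p = \<rho> q" using \<rho>[of s p] \<rho>[of p q] \<rho>[of q t] st by simp
      then show False using y pq st unfolding decreasing_words_def by fastforce
    qed
    then show ?thesis using bij_betwE[OF \<Phi>] yW unfolding decreasing_words_def by blast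
  qed
  have "inj_on \<Phi> ?D" using bij_betw_imp_inj_on[OF \<Phi>] DW inj_on_subset by blast
  then have "bij_betw \<Phi> ?D ?D"
    using dec finite_decreasing_words by (simp add: bij_betw_def endo_inj_surj image_subsetI)
  moreover have "max_ne (support N \<rho> (\<Phi> y) \<inter> UNIV \<times> J) = max_ne (support N \<rho> y \<inter> UNIV \<times> J)"
    if y: "y \<in> ?D" and J: "ord_convex J" for y J
  proof -
    have "ord_convex {t. t < N \<and> \<rho> t \<in> J}"
      unfolding ord_convex_def
    proof (intro ballI allI impI)
      fix a b c assume "a \<in> {t. t < N \<and> \<rho> t \<in> J}" "b \<in> {t. t < N \<and> \<rho> t \<in> J}" "a \<le> c \<and> c \<le> b"
      then show "c \<in> {t. t < N \<and> \<rho> t \<in> J}"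
        using ord_convexD[OF J, of "\<rho> a" "\<rho> b" "\<rho> c"] \<rho>[of a c] \<rho>[of c b] by simp
    qed
    then have "max_ne (graph N (\<Phi> y) \<inter> {t. t < N \<and> \<rho> t \<in> J} \<times> UNIV) = max_ne (graph N y \<inter> {t. t < N \<and> \<rho> t \<in> J} \<times> UNIV)"
      using A y DW by blast
    then show ?thesis
      by (simp only: max_ne_support[OF dec[OF y] \<rho>] max_ne_support[OF y \<rho>])
  qed
  moreover have "max_ne (support N \<rho> (\<Phi> y) \<inter> A \<times> UNIV) = max_ne (support N \<rho> y \<inter> reflection m -` A \<times> UNIV)"
    if y: "y \<in> ?D" and A: "ord_convex A" for y A
  proof -
    have *: "max_ne (support N \<rho> z \<inter> C \<times> UNIV) = max_ne (graph N z \<inter> UNIV \<times> C)" if "z \<in> ?D" for z C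
    proof -
      have "graph N z \<inter> {t. t < N \<and> \<rho> t \<in> UNIV} \<times> C = graph N z \<inter> UNIV \<times> C"
        by (auto simp: graph_def)
      then show ?thesis using max_ne_support[OF that \<rho>, of C UNIV] by simp
    qed
    show ?thesis using *[OF dec[OF y]] *[OF y] B[OF subsetD[OF DW y] A] by simp
  qed
  ultimately show ?thesis by blast
qed

lemma ex_strict_mono_bij:
  fixes A B :: "nat set"
  assumes "finite A" "finite B" "card A = card B"
  shows "\<exists>g. bij_betw g A B \<and> (\<forall>a\<in>A. \<forall>b\<in>A. a < b \<longrightarrow> g a < g b)"
proof -
  obtain f where f: "bij_betw f {..<card A} A" "strict_mono_on {..<card A} f"
    using ex_bij_betw_strict_mono_card[OF assms(1)] by blast
  obtain h where h: "bij_betw h {..<card A} B" "strict_mono_on {..<card A} h"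
    using ex_bij_betw_strict_mono_card[OF assms(2)] assms(3) by metis
  define g where "g = h \<circ> inv_into {..<card A} f"
  have "bij_betw g A B" unfolding g_def
    using bij_betw_trans[OF bij_betw_inv_into[OF f(1)] h(1)] .
  moreover have "g a < g b" if "a \<in> A" "b \<in> A" "a < b" for a b
  proof -
    let ?i = "inv_into {..<card A} f"
    have i: "?i a \<in> {..<card A}" "?i b \<in> {..<card A}" "f (?i a) = a" "f (?i b) = b"
      using that bij_betwE[OF bij_betw_inv_into[OF f(1)]] bij_betw_inv_into_right[OF f(1)] by auto
    then have "?i a < ?i b"
      using f(2) that(3) by (metis linorder_neqE_nat not_less_iff_gr_or_eq strict_mono_onD)
    then show ?thesis using h(2) i by (simp add: g_def strict_mono_onD)
  qed
  ultimately show ?thesis by blast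
qed

lemma finite_row: "finite S \<Longrightarrow> finite {i. (i, j) \<in> S}"
  using finite_vimageI[of S "\<lambda>i. (i, j)"] by (simp add: inj_on_def vimage_def)

text \<open>Increasing bijections from the rows of \<open>S\<close> to those of \<open>S'\<close>
  rename the columns row by row and keep the weak decrease. The roles of \<open>S\<close> and
  \<open>S'\<close> can be exchanged, which gives equality.\<close>

lemma card_words_with_support_le:
  assumes S: "S \<subseteq> {..<m} \<times> {..<n}" "S' \<subseteq> {..<m} \<times> {..<n}" and eq: "row_count S = row_count S'"
  shows "card {y \<in> decreasing_words m N \<rho>. support N \<rho> y = S}
       \<le> card {y \<in> decreasing_words m N \<rho>. support N \<rho> y = S'}"
proof -
  have fin: "finite S" "finite S'" using S finite_subset by blast+
  have "\<exists>g. bij_betw g {i. (i, j) \<in> S} {i. (i, j) \<in> S'} \<and> (\<forall>a\<in>{i. (i, j) \<in> S}. \<forall>b\<in>{i. (i, j) \<in> S}. a < b \<longrightarrow> g a < g b)" for j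
    using fun_cong[OF eq, of j] fin by (intro ex_strict_mono_bij finite_row) (auto simp: row_count_def)
  then obtain g where g: "\<And>j. bij_betw (g j) {i. (i, j) \<in> S} {i. (i, j) \<in> S'}"
    and mono: "\<And>j a b. (a, j) \<in> S \<Longrightarrow> (b, j) \<in> S \<Longrightarrow> a < b \<Longrightarrow> g j a < g j b"
    by (metis mem_Collect_eq)
  have gS: "(g j i, j) \<in> S'" if "(i, j) \<in> S" for i j using bij_betwE[OF g[of j]] that by blast
  define h where "h y = (\<lambda>t. if t < N then g (\<rho> t) (y t) else undefined)" for y
  let ?W = "\<lambda>S. {y \<in> decreasing_words m N \<rho>. support N \<rho> y = S}"
  have mem: "(y t, \<rho> t) \<in> S" if "y \<in> ?W S" "t < N" for y t using that by (auto simp: support_def)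
  show ?thesis
  proof (rule card_inj_on_le)
    show "finite (?W S')" using finite_decreasing_words by simp
    show "inj_on h (?W S)"
    proof (rule inj_onI)
      fix y z assume yz: "y \<in> ?W S" "z \<in> ?W S" "h y = h z"
      show "y = z"
      proof
        fix t
        show "y t = z t"
        proof (cases "t < N")
          case True
          then have "g (\<rho> t) (y t) = g (\<rho> t) (z t)" using fun_cong[OF yz(3), of t] by (simp add: h_def)
          then show ?thesis using mem yz True inj_onD[OF bij_betw_imp_inj_on[OF g]] by blast
        next
          case False
          then show ?thesis using yz by (auto simp: decreasing_words_def PiE_iff extensional_def)
        qed
      qed
    qed
    show "h ` ?W S \<subseteq> ?W S'"
    proof (rule image_subsetI)
      fix y assume y: "y \<in> ?W S"
      have hS: "(h y t, \<rho> t) \<in> S'" if "t < N" for t using gS mem[OF y] that by (simp add: h_def)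
      have "h y t \<le> h y s" if st: "s < t" "t < N" "\<rho> s = \<rho> t" for s t
      proof -
        have "y t \<le> y s" using y st unfolding decreasing_words_def by blast
        then show ?thesis
          using mono[of "y t" "\<rho> t" "y s"] mem[OF y, of s] mem[OF y, of t] st
          by (cases "y t = y s") (auto simp: h_def)
      qed
      moreover have "h y t < m" if "t < N" for t using hS[OF that] S(2) by auto
      ultimately have "h y \<in> decreasing_words m N \<rho>"
        by (auto simp: decreasing_words_def PiE_iff extensional_def) (simp add: h_def)
      moreover have "support N \<rho> (h y) = S'"
      proof
        show "S' \<subseteq> support N \<rho> (h y)"
        proof clarify
          fix i j assume "(i, j) \<in> S'"
          then have "i \<in> g j ` {i. (i, j) \<in> S}" using bij_betw_imp_surj_on[OF g[of j]] by blast
          then obtain i' where i': "(i', j) \<in> S" "i = g j i'" by blast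
          then obtain t where "t < N" "y t = i'" "\<rho> t = j" using y by (auto simp: support_def)
          then show "(i, j) \<in> support N \<rho> (h y)" using i' by (auto simp: support_def h_def)
        qed
      qed (use hS in \<open>auto simp: support_def\<close>)
      ultimately show "h y \<in> ?W S'" by blast
    qed
  qed
qed

definition block_map :: "nat \<Rightarrow> (nat \<Rightarrow> nat) \<Rightarrow> nat \<Rightarrow> (nat \<Rightarrow> nat) \<Rightarrow> bool" where
  "block_map n \<beta> N \<rho> \<longleftrightarrow> (\<forall>s t. s \<le> t \<and> t < N \<longrightarrow> \<rho> s \<le> \<rho> t) \<and> (\<forall>t<N. \<rho> t < n) \<and>
     (\<forall>j<n. card {t. t < N \<and> \<rho> t = j} = \<beta> j)"

lemma ex_block_map: "\<exists>N \<rho>. block_map n \<beta> N \<rho>"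
proof (induction n)
  case 0
  show ?case by (rule exI[of _ 0]) (simp add: block_map_def)
next
  case (Suc n)
  then obtain N \<rho> where "block_map n \<beta> N \<rho>" by blast
  then have \<rho>: "\<forall>s t. s \<le> t \<and> t < N \<longrightarrow> \<rho> s \<le> \<rho> t" "\<forall>t<N. \<rho> t < n" "\<forall>j<n. card {t. t < N \<and> \<rho> t = j} = \<beta> j"
    by (simp_all add: block_map_def)
  define \<rho>' where "\<rho>' t = (if t < N then \<rho> t else n)" for t
  have "{t. t < N + \<beta> n \<and> \<rho>' t = j} = {t. t < N \<and> \<rho> t = j}" if "j < n" for j
    using that by (auto simp: \<rho>'_def)
  moreover have "{t. t < N + \<beta> n \<and> \<rho>' t = n} = {N..<N + \<beta> n}"
  proof -
    have "\<rho> t \<noteq> n" if "t < N" for t using \<rho>(2) that by auto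
    then show ?thesis by (auto simp: \<rho>'_def)
  qed
  ultimately have "\<forall>j<Suc n. card {t. t < N + \<beta> n \<and> \<rho>' t = j} = \<beta> j"
    using \<rho>(3) by (auto simp: less_Suc_eq)
  moreover have "\<forall>s t. s \<le> t \<and> t < N + \<beta> n \<longrightarrow> \<rho>' s \<le> \<rho>' t" "\<forall>t<N + \<beta> n. \<rho>' t < Suc n"
    using \<rho>(1,2) by (auto simp: \<rho>'_def less_imp_le intro: less_SucI)
  ultimately have "block_map (Suc n) \<beta> (N + \<beta> n) \<rho>'" by (simp add: block_map_def)
  then show ?case by blast
qed

text \<open>There is one position for each cell, and every row is listed from right to left.
  Reflecting the columns turns this decrease into the increase offered by
  \<open>ex_strict_mono_bij\<close>.\<close>

lemma ex_word_with_support: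
  assumes S: "S \<subseteq> {..<m} \<times> {..<n}" and \<rho>: "\<forall>t<N. \<rho> t < n" "\<forall>j<n. card {t. t < N \<and> \<rho> t = j} = row_count S j"
  shows "\<exists>y\<in>decreasing_words m N \<rho>. support N \<rho> y = S"
proof -
  have fin: "finite S" using S finite_subset by blast
  define P where "P j g \<longleftrightarrow> bij_betw g {t. t < N \<and> \<rho> t = j} (reflection m ` {i. (i, j) \<in> S}) \<and>
      (\<forall>a\<in>{t. t < N \<and> \<rho> t = j}. \<forall>b\<in>{t. t < N \<and> \<rho> t = j}. a < b \<longrightarrow> g a < g b)" for j g
  have "\<exists>g. P j g" if "j < n" for j
    unfolding P_def
  proof (rule ex_strict_mono_bij)
    show "card {t. t < N \<and> \<rho> t = j} = card (reflection m ` {i. (i, j) \<in> S})"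
      using that \<rho>(2) by (simp add: row_count_def card_image inj_on_subset[OF bij_is_inj[OF bij_reflection]])
  qed (use fin in \<open>auto intro: finite_row\<close>)
  then obtain g where g': "\<And>j. j < n \<Longrightarrow> P j (g j)" by metis
  then have g: "\<And>j. j < n \<Longrightarrow> bij_betw (g j) {t. t < N \<and> \<rho> t = j} (reflection m ` {i. (i, j) \<in> S})"
    by (simp add: P_def)
  have mono: "g j s < g j t" if "j < n" "s < N" "t < N" "\<rho> s = j" "\<rho> t = j" "s < t" for j s t
    using g'[OF that(1)] that by (simp add: P_def)
  define y where "y t = (if t < N then reflection m (g (\<rho> t) t) else undefined)" for t
  have yS: "(y t, \<rho> t) \<in> S" if "t < N" for t
  proof -
    have "g (\<rho> t) t \<in> reflection m ` {i. (i, \<rho> t) \<in> S}" using bij_betwE[OF g[of "\<rho> t"]] \<rho>(1) that by blast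
    then show ?thesis using that by (auto simp: y_def)
  qed
  have "y t \<le> y s" if st: "s < t" "t < N" "\<rho> s = \<rho> t" for s t
  proof -
    have "y t < m" "y s < m" using yS[of t] yS[of s] S st by auto
    moreover have "g (\<rho> t) t = reflection m (y t)" "g (\<rho> t) s = reflection m (y s)"
      using st by (simp_all add: y_def)
    moreover have "g (\<rho> t) s < g (\<rho> t) t" using mono[of "\<rho> t" s t] \<rho>(1) st by simp
    ultimately show ?thesis by (simp add: reflection_def)
  qed
  then have "y \<in> decreasing_words m N \<rho>"
    using yS S by (auto simp: decreasing_words_def y_def PiE_iff extensional_def)
  moreover have "support N \<rho> y = S"
  proof
    show "S \<subseteq> support N \<rho> y"
    proof clarify
      fix i j assume ij: "(i, j) \<in> S"
      then have "j < n" "reflection m i \<in> reflection m ` {i. (i, j) \<in> S}" using S by auto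
      then have "reflection m i \<in> g j ` {t. t < N \<and> \<rho> t = j}" using bij_betw_imp_surj_on[OF g] by blast
      then obtain t where "t < N" "\<rho> t = j" "reflection m i = g j t" by blast
      then have "y t = i" by (metis reflection_reflection y_def)
      then show "(i, j) \<in> support N \<rho> y" using \<open>t < N\<close> \<open>\<rho> t = j\<close> by (auto simp: support_def)
    qed
  qed (use yS in \<open>auto simp: support_def\<close>)
  ultimately show ?thesis by blast
qed

text \<open>Decreasing words with prescribed row lengths are the fillings with non-negative integers.
  Their longest ne-chains only depend on the support, and the number of words with a given support
  only depends on its row counts. This gives a triangular system for the numbers of supports.\<close>

lemma card_supports_eq:
  fixes F G :: "(nat \<times> nat) set \<Rightarrow> 'c"
  assumes bij: "\<And>N \<rho>. (\<And>s t. s \<le> t \<Longrightarrow> t < N \<Longrightarrow> \<rho> s \<le> \<rho> t) \<Longrightarrow>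
      \<exists>\<Phi>. bij_betw \<Phi> (decreasing_words m N \<rho>) (decreasing_words m N \<rho>) \<and>
        (\<forall>y\<in>decreasing_words m N \<rho>. G (support N \<rho> (\<Phi> y)) = F (support N \<rho> y))"
  shows "card {S \<in> Pow ({..<m} \<times> {..<n}). row_count S = k \<and> F S = c} =
         card {S \<in> Pow ({..<m} \<times> {..<n}). row_count S = k \<and> G S = c}"
proof (induction "\<Sum>j<n. k j" arbitrary: k rule: less_induct)
  case less
  let ?P = "Pow ({..<m} \<times> {..<n})"
  have finP: "finite ?P" by simp
  define a where "a H k = card {S \<in> ?P. row_count S = k \<and> H S = c}" for H :: "(nat \<times> nat) set \<Rightarrow> 'c" and k
  show ?case
  proof (cases "\<exists>S\<in>?P. row_count S = k")
    case False
    then have "{S \<in> ?P. row_count S = k \<and> F S = c} = {}" "{S \<in> ?P. row_count S = k \<and> G S = c} = {}"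
      by blast+
    then show ?thesis by (simp only:)
  next
    case True
    then obtain S0 where S0: "S0 \<in> ?P" "row_count S0 = k" by blast
    \<comment> \<open>The row lengths of the words are exactly \<open>k\<close>, so their supports
      have row counts at most \<open>k\<close>, with equality only if no cell is repeated.\<close>
    obtain N \<rho> where "block_map n k N \<rho>" using ex_block_map by blast
    then have mono: "\<And>s t. s \<le> t \<Longrightarrow> t < N \<Longrightarrow> \<rho> s \<le> \<rho> t" and \<rho>n: "\<forall>t<N. \<rho> t < n"
      and \<rho>k: "\<forall>j<n. card {t. t < N \<and> \<rho> t = j} = k j"
      by (auto simp: block_map_def)
    let ?D = "decreasing_words m N \<rho>"
    define mult where "mult S = card {y \<in> ?D. support N \<rho> y = S}" for S
    \<comment> \<open>All supports with the same row counts carry equally many words, so an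
      arbitrary representative gives the coefficient of the system.\<close>
    define \<mu> where "\<mu> k' = mult (SOME S. S \<in> ?P \<and> row_count S = k')" for k'
    have mult_\<mu>: "mult S = \<mu> (row_count S)" if "S \<in> ?P" for S
    proof -
      have "\<exists>S'. S' \<in> ?P \<and> row_count S' = row_count S" using that by blast
      from someI_ex[OF this]
      obtain S' where S': "\<mu> (row_count S) = mult S'" "S' \<in> ?P" "row_count S' = row_count S"
        unfolding \<mu>_def by blast
      have "mult S \<le> mult S'" "mult S' \<le> mult S"
        using that S' unfolding mult_def by (intro card_words_with_support_le[of _ m n]; auto)+
      then show ?thesis using S' by simp
    qed
    have suppP: "support N \<rho> y \<in> ?P" if "y \<in> ?D" for y
      using that \<rho>n by (auto simp: support_def decreasing_words_def PiE_iff)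
    have total: "card {y \<in> ?D. H (support N \<rho> y) = c} = (\<Sum>k'\<in>row_count ` ?P. a H k' * \<mu> k')"
      for H :: "(nat \<times> nat) set \<Rightarrow> 'c"
    proof -
      have "card {y \<in> ?D. H (support N \<rho> y) = c} =
          (\<Sum>S\<in>{S \<in> ?P. H S = c}. card {y \<in> {y \<in> ?D. H (support N \<rho> y) = c}. support N \<rho> y = S})"
      proof -
        have "(\<Sum>S\<in>{S \<in> ?P. H S = c}. \<Sum>y\<in>{y \<in> {y \<in> ?D. H (support N \<rho> y) = c}. support N \<rho> y = S}. 1) =
            (\<Sum>y\<in>{y \<in> ?D. H (support N \<rho> y) = c}. 1 :: nat)"
          by (rule sum.group) (use suppP finite_decreasing_words finP in auto)
        then show ?thesis by (simp only: card_eq_sum)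
      qed
      also have "\<dots> = (\<Sum>S\<in>{S \<in> ?P. H S = c}. \<mu> (row_count S))"
      proof (rule sum.cong[OF refl])
        fix S assume S: "S \<in> {S \<in> ?P. H S = c}"
        then have "{y \<in> {y \<in> ?D. H (support N \<rho> y) = c}. support N \<rho> y = S} = {y \<in> ?D. support N \<rho> y = S}" by auto
        then show "card {y \<in> {y \<in> ?D. H (support N \<rho> y) = c}. support N \<rho> y = S} = \<mu> (row_count S)"
          using mult_\<mu> S by (simp add: mult_def)
      qed
      also have "\<dots> = (\<Sum>k'\<in>row_count ` ?P. \<Sum>S\<in>{S \<in> {S \<in> ?P. H S = c}. row_count S = k'}. \<mu> (row_count S))"
        by (rule sum.group[symmetric]) (use finP in auto)
      also have "\<dots> = (\<Sum>k'\<in>row_count ` ?P. a H k' * \<mu> k')"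
      proof (rule sum.cong[OF refl])
        fix k'
        have "(\<Sum>S\<in>{S \<in> {S \<in> ?P. H S = c}. row_count S = k'}. \<mu> (row_count S)) =
            (\<Sum>S\<in>{S \<in> ?P. row_count S = k' \<and> H S = c}. \<mu> k')"
          by (rule sum.cong) auto
        then show "(\<Sum>S\<in>{S \<in> {S \<in> ?P. H S = c}. row_count S = k'}. \<mu> (row_count S)) = a H k' * \<mu> k'"
          by (simp add: a_def)
      qed
      finally show ?thesis .
    qed
    obtain \<Phi> where \<Phi>: "bij_betw \<Phi> ?D ?D" "\<forall>y\<in>?D. G (support N \<rho> (\<Phi> y)) = F (support N \<rho> y)"
      using bij[of N \<rho>, OF mono] by blast
    have "card {y \<in> ?D. F (support N \<rho> y) = c} = card {y \<in> ?D. G (support N \<rho> y) = c}"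
    proof (rule bij_betw_same_card)
      have "\<Phi> ` {y \<in> ?D. F (support N \<rho> y) = c} = {y \<in> ?D. G (support N \<rho> y) = c}"
      proof
        show "{y \<in> ?D. G (support N \<rho> y) = c} \<subseteq> \<Phi> ` {y \<in> ?D. F (support N \<rho> y) = c}"
        proof
          fix z assume z: "z \<in> {y \<in> ?D. G (support N \<rho> y) = c}"
          then obtain y where "y \<in> ?D" "z = \<Phi> y" using bij_betw_imp_surj_on[OF \<Phi>(1)] by blast
          then show "z \<in> \<Phi> ` {y \<in> ?D. F (support N \<rho> y) = c}" using z \<Phi>(2) by auto
        qed
      qed (use \<Phi> bij_betwE[OF \<Phi>(1)] in auto)
      then show "bij_betw \<Phi> {y \<in> ?D. F (support N \<rho> y) = c} {y \<in> ?D. G (support N \<rho> y) = c}"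
        using bij_betw_imp_inj_on[OF \<Phi>(1)] inj_on_subset by (fastforce simp: bij_betw_def)
    qed
    then have sums: "(\<Sum>k'\<in>row_count ` ?P. a F k' * \<mu> k') = (\<Sum>k'\<in>row_count ` ?P. a G k' * \<mu> k')"
      by (simp add: total)
    \<comment> \<open>A row count \<open>k'\<close> other than \<open>k\<close> with nonzero
      coefficient is bounded by \<open>k\<close> and has a smaller sum, so the induction hypothesis
      applies: the system is triangular.\<close>
    have others: "a F k' * \<mu> k' = a G k' * \<mu> k'" if k': "k' \<in> row_count ` ?P - {k}" for k'
    proof (cases "\<mu> k' = 0")
      case False
      obtain S where S: "S \<in> ?P" "row_count S = k'" using k' by blast
      then have "mult S \<noteq> 0" using mult_\<mu> False by simp
      then have "{y \<in> ?D. support N \<rho> y = S} \<noteq> {}" unfolding mult_def by (metis card.empty)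
      then obtain y where y: "y \<in> ?D" "support N \<rho> y = S" by blast
      have le: "k' j \<le> k j" if "j < n" for j
      proof -
        have "{i. (i, j) \<in> S} = y ` {t. t < N \<and> \<rho> t = j}" using y by (auto simp: support_def)
        then have "row_count S j \<le> card {t. t < N \<and> \<rho> t = j}" by (simp add: row_count_def card_image_le)
        then show ?thesis using S \<rho>k that by simp
      qed
      have "{i. (i, j) \<in> S} = {}" "{i. (i, j) \<in> S0} = {}" if "\<not> j < n" for j using that S S0 by auto
      then have "k' j = k j" if "\<not> j < n" for j using that S S0 by (auto simp: row_count_def)
      then obtain j where "j < n" "k' j \<noteq> k j" using k' by (metis DiffD2 ext singletonI)
      then have "(\<Sum>j<n. k' j) < (\<Sum>j<n. k j)"
        using le by (intro sum_strict_mono_ex1) (auto simp: order_less_le)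
      then show ?thesis using less[of k'] by (simp add: a_def)
    qed simp
    have kP: "k \<in> row_count ` ?P" using S0 by blast
    have "(\<Sum>k'\<in>row_count ` ?P - {k}. a F k' * \<mu> k') = (\<Sum>k'\<in>row_count ` ?P - {k}. a G k' * \<mu> k')"
      by (rule sum.cong[OF refl others])
    moreover have "finite (row_count ` ?P)" using finP by simp
    ultimately have "a F k * \<mu> k = a G k * \<mu> k"
      using sums sum.remove[OF _ kP, of "\<lambda>k'. a F k' * \<mu> k'"] sum.remove[OF _ kP, of "\<lambda>k'. a G k' * \<mu> k'"]
      by linarith
    \<comment> \<open>The diagonal coefficient does not vanish, because \<open>S0\<close> is the
      support of a word that uses every cell once; so it can be cancelled.\<close>
    moreover have "\<mu> k \<noteq> 0"
    proof -
      obtain y where "y \<in> ?D" "support N \<rho> y = S0"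
        using ex_word_with_support[of S0 m n N \<rho>] S0 \<rho>n \<rho>k by auto
      then have "mult S0 \<noteq> 0"
        using finite_decreasing_words[of m N \<rho>] by (auto simp: mult_def)
      then show ?thesis using mult_\<mu>[OF S0(1)] S0(2) by simp
    qed
    ultimately show ?thesis by (simp add: a_def)
  qed
qed

section \<open>Rotating and shifting a rectangle\<close>

lemma rectangle_rotation:
  "\<exists>\<Psi>. bij_betw \<Psi> (Pow ({..<m} \<times> {..<n})) (Pow ({..<m} \<times> {..<n})) \<and>
     (\<forall>S\<in>Pow ({..<m} \<times> {..<n}). row_count (\<Psi> S) = row_count S \<and>
        (\<forall>J. ord_convex J \<longrightarrow> max_ne (\<Psi> S \<inter> UNIV \<times> J) = max_ne (S \<inter> UNIV \<times> J)) \<and>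
        (\<forall>A. ord_convex A \<longrightarrow> max_ne (\<Psi> S \<inter> A \<times> UNIV) = max_ne (S \<inter> reflection m -` A \<times> UNIV)))"
proof -
  let ?P = "Pow ({..<m} \<times> {..<n})"
  \<comment> \<open>All statistics form one label, with the dummy value 0 for sets that are not
    intervals. Counting labels then yields a single bijection for all intervals
    simultaneously.\<close>
  define F where "F S = ((\<lambda>J. if ord_convex J then max_ne (S \<inter> UNIV \<times> J) else 0),
      (\<lambda>A. if ord_convex A then max_ne (S \<inter> reflection m -` A \<times> UNIV) else 0))" for S :: "(nat \<times> nat) set"
  define G where "G S = ((\<lambda>J. if ord_convex J then max_ne (S \<inter> UNIV \<times> J) else 0),
      (\<lambda>A. if ord_convex A then max_ne (S \<inter> A \<times> UNIV) else 0))" for S :: "(nat \<times> nat) set"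
  have GF: "G T = F S \<longleftrightarrow> (\<forall>J. ord_convex J \<longrightarrow> max_ne (T \<inter> UNIV \<times> J) = max_ne (S \<inter> UNIV \<times> J)) \<and>
        (\<forall>A. ord_convex A \<longrightarrow> max_ne (T \<inter> A \<times> UNIV) = max_ne (S \<inter> reflection m -` A \<times> UNIV))" for S T
    unfolding F_def G_def by (auto simp: fun_eq_iff)
  have eq: "card {S \<in> ?P. row_count S = k \<and> F S = c} = card {S \<in> ?P. row_count S = k \<and> G S = c}" for k c
    by (rule card_supports_eq) (unfold GF, rule decreasing_word_bijection)
  have "card {S \<in> ?P. (row_count S, F S) = p} = card {S \<in> ?P. (row_count S, G S) = p}" for p
    using eq[of "fst p" "snd p"] by (cases p) simp
  then obtain \<Psi> where "bij_betw \<Psi> ?P ?P" "\<forall>S\<in>?P. (row_count (\<Psi> S), G (\<Psi> S)) = (row_count S, F S)"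
    using fibrewise_bij[of ?P ?P "\<lambda>S. (row_count S, F S)" "\<lambda>S. (row_count S, G S)"] by auto
  then show ?thesis using GF by (intro exI[of _ \<Psi>]) simp
qed

lemma row_count_Un:
  assumes "finite S" "finite T" "S \<inter> T = {}"
  shows "row_count (S \<union> T) j = row_count S j + row_count T j"
proof -
  have "{i. (i, j) \<in> S \<union> T} = {i. (i, j) \<in> S} \<union> {i. (i, j) \<in> T}" by auto
  then show ?thesis
    using assms by (auto simp: row_count_def finite_row intro!: card_Un_disjoint)
qed

text \<open>The statistics of column \<open>i < m\<close> in the result come from column
  \<open>m - 1 - i\<close> after the rotation of all \<open>Suc m\<close> columns, and these from
  column \<open>m - (m - 1 - i) = i + 1\<close> of the original set. The second rotation leaves
  column \<open>m\<close> alone; gluing this column back on keeps the chains over intervals of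
  rows.\<close>

lemma rectangle_shift:
  "\<exists>\<phi>. bij_betw \<phi> (Pow ({..<Suc m} \<times> {..<n})) (Pow ({..<Suc m} \<times> {..<n})) \<and>
     (\<forall>S\<in>Pow ({..<Suc m} \<times> {..<n}). row_count (\<phi> S) = row_count S \<and>
        (\<forall>J. ord_convex J \<longrightarrow> max_ne (\<phi> S \<inter> UNIV \<times> J) = max_ne (S \<inter> UNIV \<times> J)) \<and>
        (\<forall>A. ord_convex A \<and> A \<subseteq> {..<m} \<longrightarrow> max_ne (\<phi> S \<inter> A \<times> UNIV) = max_ne (S \<inter> Suc ` A \<times> UNIV)))"
proof -
  let ?P = "Pow ({..<Suc m} \<times> {..<n})" and ?P' = "Pow ({..<m} \<times> {..<n})"
  obtain \<Psi> where \<Psi>: "bij_betw \<Psi> ?P ?P" "\<And>S. S \<in> ?P \<Longrightarrow> row_count (\<Psi> S) = row_count S"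
    and \<Psi>J: "\<And>S J. S \<in> ?P \<Longrightarrow> ord_convex J \<Longrightarrow> max_ne (\<Psi> S \<inter> UNIV \<times> J) = max_ne (S \<inter> UNIV \<times> J)"
    and \<Psi>A: "\<And>S A. S \<in> ?P \<Longrightarrow> ord_convex A \<Longrightarrow> max_ne (\<Psi> S \<inter> A \<times> UNIV) = max_ne (S \<inter> reflection (Suc m) -` A \<times> UNIV)"
    using rectangle_rotation[of "Suc m" n] by blast
  obtain \<Theta> where \<Theta>: "bij_betw \<Theta> ?P' ?P'" "\<And>S. S \<in> ?P' \<Longrightarrow> row_count (\<Theta> S) = row_count S"
    and \<Theta>J: "\<And>S J. S \<in> ?P' \<Longrightarrow> ord_convex J \<Longrightarrow> max_ne (\<Theta> S \<inter> UNIV \<times> J) = max_ne (S \<inter> UNIV \<times> J)"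
    and \<Theta>A: "\<And>S A. S \<in> ?P' \<Longrightarrow> ord_convex A \<Longrightarrow> max_ne (\<Theta> S \<inter> A \<times> UNIV) = max_ne (S \<inter> reflection m -` A \<times> UNIV)"
    using rectangle_rotation[of m n] by blast
  define V where "V S = S \<inter> {..<m} \<times> UNIV" for S :: "(nat \<times> nat) set"
  define W where "W S = S \<inter> {m} \<times> UNIV" for S :: "(nat \<times> nat) set"
  define glue where "glue S = \<Theta> (V S) \<union> W S" for S
  have VP: "V S \<in> ?P'" if "S \<in> ?P" for S using that by (auto simp: V_def)
  have \<Theta>P: "\<Theta> (V S) \<in> ?P'" if "S \<in> ?P" for S using bij_betwE[OF \<Theta>(1)] VP[OF that] by blast
  have S: "S = V S \<union> W S" if "S \<in> ?P" for S using that by (auto simp: V_def W_def less_Suc_eq)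
  have WP: "W S \<subseteq> {m} \<times> {..<n}" if "S \<in> ?P" for S using that by (auto simp: W_def)
  have glueP: "glue S \<in> ?P" if "S \<in> ?P" for S
  proof -
    have "{..<m} \<times> {..<n} \<subseteq> {..<Suc m} \<times> {..<n}" by auto
    moreover have "{m} \<times> {..<n} \<subseteq> {..<Suc m} \<times> {..<n}" by auto
    ultimately show ?thesis using \<Theta>P[OF that] WP[OF that] by (auto simp: glue_def)
  qed
  have fin: "finite (V S)" "finite (W S)" "finite (\<Theta> (V S))" if "S \<in> ?P" for S
  proof -
    show "finite (V S)" "finite (\<Theta> (V S))"
      using VP[OF that] \<Theta>P[OF that] finite_subset[of _ "{..<m} \<times> {..<n}"] by auto
    show "finite (W S)" using WP[OF that] finite_subset[of _ "{m} \<times> {..<n}"] by auto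
  qed
  have Vglue: "V (glue S) = \<Theta> (V S)" and Wglue: "W (glue S) = W S" if "S \<in> ?P" for S
    using \<Theta>P[OF that] WP[OF that] by (auto simp: glue_def V_def W_def)
  have "inj_on glue ?P"
  proof (rule inj_onI)
    fix S T assume ST: "S \<in> ?P" "T \<in> ?P" "glue S = glue T"
    then have "\<Theta> (V S) = \<Theta> (V T)" "W S = W T"
      using Vglue[OF ST(1)] Vglue[OF ST(2)] Wglue[OF ST(1)] Wglue[OF ST(2)] by simp_all
    moreover have "V S = V T"
      by (rule inj_onD[OF bij_betw_imp_inj_on[OF \<Theta>(1)] calculation(1) VP[OF ST(1)] VP[OF ST(2)]])
    ultimately show "S = T" using S ST by metis
  qed
  moreover have "glue ` ?P = ?P"
    by (rule endo_inj_surj) (use glueP \<open>inj_on glue ?P\<close> in blast)+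
  ultimately have "bij_betw glue ?P ?P" by (simp add: bij_betw_def)
  then have "bij_betw (glue \<circ> \<Psi>) ?P ?P" using \<Psi>(1) bij_betw_trans by blast
  moreover have "row_count ((glue \<circ> \<Psi>) S) = row_count S \<and>
        (\<forall>J. ord_convex J \<longrightarrow> max_ne ((glue \<circ> \<Psi>) S \<inter> UNIV \<times> J) = max_ne (S \<inter> UNIV \<times> J)) \<and>
        (\<forall>A. ord_convex A \<and> A \<subseteq> {..<m} \<longrightarrow> max_ne ((glue \<circ> \<Psi>) S \<inter> A \<times> UNIV) = max_ne (S \<inter> Suc ` A \<times> UNIV))"
    if SP: "S \<in> ?P" for S
  proof (intro conjI allI impI)
    define T where "T = \<Psi> S"
    have T: "T \<in> ?P" using bij_betwE[OF \<Psi>(1)] SP by (simp add: T_def)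
    show "row_count ((glue \<circ> \<Psi>) S) = row_count S"
    proof
      fix j
      have "V T \<inter> W T = {}" by (auto simp: V_def W_def)
      then have "row_count T j = row_count (V T) j + row_count (W T) j"
        using S[OF T] row_count_Un[OF fin(1,2)[OF T]] by simp
      also have "\<dots> = row_count (\<Theta> (V T)) j + row_count (W T) j" using \<Theta>(2)[OF VP[OF T]] by simp
      also have "\<dots> = row_count (glue T) j"
        unfolding glue_def using \<Theta>P[OF T] WP[OF T]
        by (intro row_count_Un[symmetric] fin[OF T]) auto
      finally show "row_count ((glue \<circ> \<Psi>) S) j = row_count S j" using \<Psi>(2)[OF SP] by (simp add: T_def)
    qed
    show "max_ne ((glue \<circ> \<Psi>) S \<inter> UNIV \<times> J) = max_ne (S \<inter> UNIV \<times> J)" if J: "ord_convex J" for J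
    proof -
      let ?J = "UNIV \<times> J"
      have "max_ne ({} \<union> (V T \<inter> ?J) \<union> (W T \<inter> ?J)) = max_ne ({} \<union> (\<Theta> (V T) \<inter> ?J) \<union> (W T \<inter> ?J))"
      proof (rule max_ne_glue)
        fix K :: "nat set" assume "ord_convex K"
        then show "max_ne (V T \<inter> ?J \<inter> UNIV \<times> K) = max_ne (\<Theta> (V T) \<inter> ?J \<inter> UNIV \<times> K)"
          using \<Theta>J[OF VP[OF T] ord_convex_Int[OF J]] by (simp add: Int_assoc Times_Int_Times)
      next
        fix c d assume "c \<in> V T \<inter> ?J \<union> \<Theta> (V T) \<inter> ?J" "d \<in> W T \<inter> ?J"
        then show "fst c < fst d" using \<Theta>P[OF T] VP[OF T] WP[OF T] by fastforce
      qed (use fin[OF T] in auto)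
      then have "max_ne (glue T \<inter> ?J) = max_ne (T \<inter> ?J)"
        by (subst (2) S[OF T]) (simp add: glue_def Int_Un_distrib2)
      then show ?thesis using \<Psi>J[OF SP J] by (simp add: T_def)
    qed
    show "max_ne ((glue \<circ> \<Psi>) S \<inter> A \<times> UNIV) = max_ne (S \<inter> Suc ` A \<times> UNIV)"
      if A: "ord_convex A \<and> A \<subseteq> {..<m}" for A
    proof -
      define B where "B = reflection m -` A \<inter> {..<m}"
      have B: "ord_convex B"
        unfolding ord_convex_def
      proof (intro ballI allI impI)
        fix x y z assume "x \<in> B" "y \<in> B" "x \<le> z \<and> z \<le> y"
        then show "z \<in> B"
          using ord_convexD[OF conjunct1[OF A], of "reflection m y" "reflection m x" "reflection m z"]
          by (auto simp: B_def reflection_def)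
      qed
      have "glue T \<inter> A \<times> UNIV = \<Theta> (V T) \<inter> A \<times> UNIV"
        using WP[OF T] A by (auto simp: glue_def)
      then have "max_ne (glue T \<inter> A \<times> UNIV) = max_ne (V T \<inter> reflection m -` A \<times> UNIV)"
        using \<Theta>A[OF VP[OF T]] A by simp
      also have "V T \<inter> reflection m -` A \<times> UNIV = T \<inter> B \<times> UNIV" by (auto simp: V_def B_def)
      also have "max_ne (T \<inter> B \<times> UNIV) = max_ne (S \<inter> reflection (Suc m) -` B \<times> UNIV)"
        unfolding T_def by (rule \<Psi>A[OF SP B])
      also have "reflection (Suc m) -` B = Suc ` A"
      proof
        show "reflection (Suc m) -` B \<subseteq> Suc ` A"
        proof
          fix i assume "i \<in> reflection (Suc m) -` B"
          then have i: "reflection (Suc m) i < m" "reflection m (reflection (Suc m) i) \<in> A" by (auto simp: B_def)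
          then have "0 < i" "i < Suc m" by (auto simp: reflection_def split: if_splits)
          then have "i = Suc (reflection m (reflection (Suc m) i))" using i by (auto simp: reflection_def)
          then show "i \<in> Suc ` A" using i by blast
        qed
        show "Suc ` A \<subseteq> reflection (Suc m) -` B" using A by (auto simp: B_def reflection_def)
      qed
      finally show ?thesis by (simp add: T_def)
    qed
  qed
  ultimately show ?thesis by blast
qed

lemma int_rectangle_shift:
  fixes p q a b :: int
  assumes "p \<le> q"
  shows "\<exists>\<phi>. bij_betw \<phi> (Pow ({p..q} \<times> {a..b})) (Pow ({p..q} \<times> {a..b})) \<and>
     (\<forall>S\<in>Pow ({p..q} \<times> {a..b}). (\<forall>j. card (\<phi> S \<inter> UNIV \<times> {j}) = card (S \<inter> UNIV \<times> {j})) \<and>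
        (\<forall>J. ord_convex J \<longrightarrow> max_ne (\<phi> S \<inter> UNIV \<times> J) = max_ne (S \<inter> UNIV \<times> J)) \<and>
        (\<forall>A. ord_convex A \<and> A \<subseteq> {p..<q} \<longrightarrow>
           max_ne (\<phi> S \<inter> A \<times> UNIV) = max_ne (S \<inter> (\<lambda>i. i + 1) ` A \<times> UNIV)))"
proof -
  define m where "m = nat (q - p)"
  define n where "n = nat (b - a + 1)"
  let ?P = "Pow ({..<Suc m} \<times> {..<n})" and ?R = "Pow ({p..q} \<times> {a..b})"
  obtain \<phi> where \<phi>: "bij_betw \<phi> ?P ?P" "\<And>S. S \<in> ?P \<Longrightarrow> row_count (\<phi> S) = row_count S"
    and \<phi>J: "\<And>S J. S \<in> ?P \<Longrightarrow> ord_convex J \<Longrightarrow> max_ne (\<phi> S \<inter> UNIV \<times> J) = max_ne (S \<inter> UNIV \<times> J)"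
    and \<phi>A: "\<And>S A. S \<in> ?P \<Longrightarrow> ord_convex A \<Longrightarrow> A \<subseteq> {..<m} \<Longrightarrow> max_ne (\<phi> S \<inter> A \<times> UNIV) = max_ne (S \<inter> Suc ` A \<times> UNIV)"
    using rectangle_shift[of m n] by blast
  define e where "e = (\<lambda>(i, j). (p + int i, a + int j))"
  have inj: "inj e" by (auto simp: e_def inj_on_def)
  have e_im: "e ` ({..<Suc m} \<times> {..<n}) = {p..q} \<times> {a..b}"
  proof
    show "{p..q} \<times> {a..b} \<subseteq> e ` ({..<Suc m} \<times> {..<n})"
    proof clarify
      fix i j assume "i \<in> {p..q}" "j \<in> {a..b}"
      then have "(i, j) = e (nat (i - p), nat (j - a))" "nat (i - p) < Suc m" "nat (j - a) < n"
        by (auto simp: e_def m_def n_def)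
      then show "(i, j) \<in> e ` ({..<Suc m} \<times> {..<n})" by blast
    qed
  qed (use assms in \<open>auto simp: e_def m_def n_def\<close>)
  have bij_e: "bij_betw ((`) e) ?P ?R"
  proof -
    have "bij_betw e ({..<Suc m} \<times> {..<n}) ({p..q} \<times> {a..b})"
      using inj_on_subset[OF inj subset_UNIV] e_im by (simp add: bij_betw_def)
    then show ?thesis by (rule bij_betw_Pow)
  qed
  have vim: "e -` (e ` S) = S" for S using inj by (simp add: inj_vimage_image_eq)
  define \<phi>' where "\<phi>' S = e ` \<phi> (e -` S)" for S
  have fin: "finite S" if "S \<in> ?P" for S using that finite_subset by blast
  have maxe: "max_ne (e ` S \<inter> A \<times> J) = max_ne (S \<inter> {i. p + int i \<in> A} \<times> {j. a + int j \<in> J})"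
    if "finite S" for S and A J :: "int set"
  proof -
    have "e ` S \<inter> A \<times> J = e ` (S \<inter> {i. p + int i \<in> A} \<times> {j. a + int j \<in> J})"
      by (auto simp: e_def)
    moreover have "max_ne (e ` (S \<inter> {i. p + int i \<in> A} \<times> {j. a + int j \<in> J})) = max_ne (S \<inter> {i. p + int i \<in> A} \<times> {j. a + int j \<in> J})"
      using that by (intro max_ne_image) (auto simp: e_def ne_comparable_Pair)
    ultimately show ?thesis by simp
  qed
  have conv: "ord_convex {i. c + int i \<in> A}" if "ord_convex A" for c A
    unfolding ord_convex_def
  proof (intro ballI allI impI)
    fix x y z assume "x \<in> {i. c + int i \<in> A}" "y \<in> {i. c + int i \<in> A}" "x \<le> z \<and> z \<le> y"
    then show "z \<in> {i. c + int i \<in> A}" using ord_convexD[OF that, of "c + int x" "c + int y" "c + int z"] by simp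
  qed
  have "bij_betw \<phi>' ?R ?R"
  proof -
    have inv: "bij_betw (\<lambda>S. e -` S) ?R ?P"
    proof (rule bij_betw_byWitness[of _ "(`) e"])
      show "\<forall>S\<in>?R. e ` (e -` S) = S"
      proof
        fix S assume "S \<in> ?R"
        then have "S \<in> (`) e ` ?P" by (simp only: bij_betw_imp_surj_on[OF bij_e])
        then obtain T where "S = e ` T" by blast
        then show "e ` (e -` S) = S" by (simp add: vim)
      qed
      show "(\<lambda>S. e -` S) ` ?R \<subseteq> ?P"
        unfolding bij_betw_imp_surj_on[OF bij_e, symmetric] image_image vim by simp
      show "(`) e ` ?P \<subseteq> ?R" by (simp only: bij_betw_imp_surj_on[OF bij_e])
    qed (simp add: vim)
    have "\<phi>' = (`) e \<circ> \<phi> \<circ> (\<lambda>S. e -` S)" by (simp add: \<phi>'_def fun_eq_iff)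
    then show ?thesis using bij_betw_trans[OF bij_betw_trans[OF inv \<phi>(1)] bij_e] by (simp add: comp_assoc)
  qed
  moreover have "(\<forall>j. card (\<phi>' S \<inter> UNIV \<times> {j}) = card (S \<inter> UNIV \<times> {j})) \<and>
        (\<forall>J. ord_convex J \<longrightarrow> max_ne (\<phi>' S \<inter> UNIV \<times> J) = max_ne (S \<inter> UNIV \<times> J)) \<and>
        (\<forall>A. ord_convex A \<and> A \<subseteq> {p..<q} \<longrightarrow>
           max_ne (\<phi>' S \<inter> A \<times> UNIV) = max_ne (S \<inter> (\<lambda>i. i + 1) ` A \<times> UNIV))"
    if SR: "S \<in> ?R" for S
  proof -
    have "S \<in> (`) e ` ?P" using SR by (simp only: bij_betw_imp_surj_on[OF bij_e])
    then obtain T where T: "T \<in> ?P" "S = e ` T" by blast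
    have \<phi>'S: "\<phi>' (e ` T) = e ` \<phi> T" by (simp add: \<phi>'_def vim)
    have \<phi>T: "\<phi> T \<in> ?P" using bij_betwE[OF \<phi>(1)] T by blast
    have rows: "card (e ` U \<inter> UNIV \<times> {j}) = (if a \<le> j then row_count U (nat (j - a)) else 0)" for U j
    proof (cases "a \<le> j")
      case True
      then have "e ` U \<inter> UNIV \<times> {j} = (\<lambda>i. (p + int i, j)) ` {i. (i, nat (j - a)) \<in> U}"
        by (force simp: e_def image_iff)
      then show ?thesis using True by (simp add: row_count_def card_image inj_on_def)
    next
      case False
      then have "e ` U \<inter> UNIV \<times> {j} = {}" by (auto simp: e_def)
      then show ?thesis using False by simp
    qed
    have "max_ne (\<phi>' S \<inter> UNIV \<times> J) = max_ne (S \<inter> UNIV \<times> J)" if "ord_convex J" for J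
      using \<phi>J[OF T(1) conv[OF that]] maxe[OF fin[OF T(1)], of UNIV J] maxe[OF fin[OF \<phi>T], of UNIV J]
      by (simp add: \<phi>'S T(2))
    moreover have "max_ne (\<phi>' S \<inter> A \<times> UNIV) = max_ne (S \<inter> (\<lambda>i. i + 1) ` A \<times> UNIV)"
      if A: "ord_convex A" "A \<subseteq> {p..<q}" for A
    proof -
      have "{i. p + int i \<in> (\<lambda>i. i + 1) ` A} = Suc ` {i. p + int i \<in> A}"
      proof
        show "{i. p + int i \<in> (\<lambda>i. i + 1) ` A} \<subseteq> Suc ` {i. p + int i \<in> A}"
        proof
          fix i assume "i \<in> {i. p + int i \<in> (\<lambda>i. i + 1) ` A}"
          then have *: "p + int i - 1 \<in> A" by auto
          then have "i \<noteq> 0" using A by (auto intro: ccontr)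
          then have "i = Suc (i - 1)" "p + int (i - 1) \<in> A" using * by (auto simp: of_nat_diff algebra_simps)
          then show "i \<in> Suc ` {i. p + int i \<in> A}" by blast
        qed
      qed (auto simp: algebra_simps)
      moreover have "{i. p + int i \<in> A} \<subseteq> {..<m}" using A by (auto simp: m_def)
      ultimately show ?thesis
        using \<phi>A[OF T(1) conv[OF A(1)]] maxe[OF fin[OF T(1)], of "(\<lambda>i. i + 1) ` A" UNIV] maxe[OF fin[OF \<phi>T], of A UNIV]
        by (simp add: \<phi>'S T(2))
    qed
    ultimately show ?thesis using \<phi>(2)[OF T(1)] rows by (simp add: \<phi>'S T(2))
  qed
  ultimately show ?thesis by blast
qed

section \<open>Moving a column\<close>

text \<open>The box is empty unless \<open>c\<close> is weakly south-west of \<open>d\<close>. For a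
  finite nonempty chain the condition says that the box spanned by its lowest and its highest cell,
  the bounding rectangle, lies in \<open>M\<close>.\<close>

definition box_closed :: "cell set \<Rightarrow> cell set \<Rightarrow> bool" where
  "box_closed M X \<longleftrightarrow> (\<forall>c\<in>X. \<forall>d\<in>X. {fst c..fst d} \<times> {snd c..snd d} \<subseteq> M)"

definition max_ne_in :: "cell set \<Rightarrow> cell set \<Rightarrow> nat" where
  "max_ne_in M S = Max (card ` {X. X \<subseteq> S \<and> ne_set X \<and> box_closed M X})"

lemma finite_boxed_subsets: "finite S \<Longrightarrow> finite {X. X \<subseteq> S \<and> ne_set X \<and> box_closed M X}"
  by (rule finite_subset[of _ "Pow S"]) auto

lemma max_ne_in_ge: "finite S \<Longrightarrow> X \<subseteq> S \<Longrightarrow> ne_set X \<Longrightarrow> box_closed M X \<Longrightarrow> card X \<le> max_ne_in M S"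
  unfolding max_ne_in_def by (rule Max_ge) (auto intro: finite_boxed_subsets)

lemma max_ne_in_witness:
  assumes "finite S"
  obtains X where "X \<subseteq> S" "ne_set X" "box_closed M X" "card X = max_ne_in M S"
proof -
  have "{} \<in> {X. X \<subseteq> S \<and> ne_set X \<and> box_closed M X}" by (simp add: ne_set_def box_closed_def)
  then have "max_ne_in M S \<in> card ` {X. X \<subseteq> S \<and> ne_set X \<and> box_closed M X}"
    unfolding max_ne_in_def using finite_boxed_subsets[OF assms] by (intro Max_in) auto
  then show ?thesis using that by auto
qed

lemma max_ne_le_max_ne_in:
  assumes "finite S" "A \<times> J \<subseteq> M" "ord_convex A" "ord_convex J"
  shows "max_ne (S \<inter> A \<times> J) \<le> max_ne_in M S"
proof -
  obtain X where X: "X \<subseteq> S \<inter> A \<times> J" "ne_set X" "card X = max_ne (S \<inter> A \<times> J)"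
    using max_ne_witness[of "S \<inter> A \<times> J"] assms(1) by auto
  have "box_closed M X"
    unfolding box_closed_def
  proof (intro ballI subsetI)
    fix c d e assume cd: "c \<in> X" "d \<in> X" and e: "e \<in> {fst c..fst d} \<times> {snd c..snd d}"
    have "c \<in> A \<times> J" "d \<in> A \<times> J" using X cd by blast+
    then have "fst e \<in> A" "snd e \<in> J"
      using e ord_convexD[OF assms(3), of "fst c" "fst d"] ord_convexD[OF assms(4), of "snd c" "snd d"] by auto
    then show "e \<in> M" using assms(2) by (metis SigmaI prod.collapse subsetD)
  qed
  then show ?thesis using max_ne_in_ge[of S X M] X assms(1) by auto
qed

lemma max_ne_in_le_rectangle:
  assumes "finite S"
  obtains "max_ne_in M S = 0"
  | A J where "ord_convex A" "ord_convex J" "A \<noteq> {}" "J \<noteq> {}" "A \<times> J \<subseteq> M" "max_ne_in M S \<le> max_ne (S \<inter> A \<times> J)"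
proof -
  obtain X where X: "X \<subseteq> S" "ne_set X" "box_closed M X" "card X = max_ne_in M S"
    using max_ne_in_witness[OF assms] .
  have finX: "finite X" using X assms finite_subset by blast
  show ?thesis
  proof (cases "X = {}")
    case True
    then show ?thesis using X that(1) by simp
  next
    case False
    then have "Min (fst ` X) \<in> fst ` X" "Max (fst ` X) \<in> fst ` X" using finX by (simp_all add: Min_in Max_in)
    then obtain c d where cd: "c \<in> X" "fst c = Min (fst ` X)" "d \<in> X" "fst d = Max (fst ` X)" by (metis imageE)
    have le: "fst c \<le> fst e \<and> fst e \<le> fst d" if "e \<in> X" for e using cd finX that by simp
    have snd: "snd c \<le> snd e \<and> snd e \<le> snd d" if e: "e \<in> X" for e
      using ne_set_less_iff[OF X(2) e cd(1)] ne_set_less_iff[OF X(2) cd(3) e] le[OF e] by linarith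
    let ?A = "{fst c..fst d}" and ?J = "{snd c..snd d}"
    have "X \<subseteq> S \<inter> ?A \<times> ?J"
    proof
      fix e assume "e \<in> X"
      then show "e \<in> S \<inter> ?A \<times> ?J" using le[of e] snd[of e] X by (cases e) auto
    qed
    then have "card X \<le> max_ne (S \<inter> ?A \<times> ?J)" using X assms by (intro max_ne_ge) auto
    moreover have "?A \<times> ?J \<subseteq> M" using X(3) cd unfolding box_closed_def by blast
    moreover have "?A \<noteq> {}" "?J \<noteq> {}" using le[OF cd(1)] snd[OF cd(1)] by auto
    ultimately show ?thesis using that(2)[of ?A ?J] X by simp
  qed
qed

text \<open>A longest chain lives in its bounding rectangle, and every rectangle inside a polyomino
  bounds the longest chain from below. So it suffices to compare rectangles, where the chain
  condition no longer mentions the polyomino.\<close>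

lemma max_ne_in_le:
  assumes "finite S" "finite T"
    and "\<And>A J. ord_convex A \<Longrightarrow> ord_convex J \<Longrightarrow> A \<noteq> {} \<Longrightarrow> J \<noteq> {} \<Longrightarrow> A \<times> J \<subseteq> M \<Longrightarrow>
      \<exists>A' J'. ord_convex A' \<and> ord_convex J' \<and> A' \<times> J' \<subseteq> N \<and> max_ne (S \<inter> A \<times> J) \<le> max_ne (T \<inter> A' \<times> J')"
  shows "max_ne_in M S \<le> max_ne_in N T"
proof (rule max_ne_in_le_rectangle[OF assms(1), of M])
  fix A J assume AJ: "ord_convex A" "ord_convex J" "A \<noteq> {}" "J \<noteq> {}" "A \<times> J \<subseteq> M" "max_ne_in M S \<le> max_ne (S \<inter> A \<times> J)"
  from assms(3)[OF this(1-5)] obtain A' J' where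
    "ord_convex A'" "ord_convex J'" "A' \<times> J' \<subseteq> N" "max_ne (S \<inter> A \<times> J) \<le> max_ne (T \<inter> A' \<times> J')" by blast
  then show ?thesis using max_ne_le_max_ne_in[OF assms(2), of A' J' N] AJ(6) by simp
qed simp

definition cols :: "cell set \<Rightarrow> int \<Rightarrow> int set" where
  "cols M i = {j. (i, j) \<in> M}"

definition row_equiv :: "cell set \<Rightarrow> cell set \<Rightarrow> bool" where
  "row_equiv M N \<longleftrightarrow> (\<exists>\<phi>. bij_betw \<phi> (Pow M) (Pow N) \<and>
     (\<forall>S\<in>Pow M. max_ne_in N (\<phi> S) = max_ne_in M S \<and>
        (\<forall>j. card (\<phi> S \<inter> UNIV \<times> {j}) = card (S \<inter> UNIV \<times> {j}))))"

definition total_equiv :: "cell set \<Rightarrow> cell set \<Rightarrow> bool" where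
  "total_equiv M N \<longleftrightarrow> (\<exists>\<phi>. bij_betw \<phi> (Pow M) (Pow N) \<and>
     (\<forall>S\<in>Pow M. max_ne_in N (\<phi> S) = max_ne_in M S \<and> card (\<phi> S) = card S))"

lemma row_equiv_refl [simp]: "row_equiv M M"
  unfolding row_equiv_def by (intro exI[of _ id]) simp

lemma row_equiv_sym:
  assumes "row_equiv M N" shows "row_equiv N M"
proof -
  obtain \<phi> where \<phi>: "bij_betw \<phi> (Pow M) (Pow N)"
    "\<And>S. S \<in> Pow M \<Longrightarrow> max_ne_in N (\<phi> S) = max_ne_in M S \<and> (\<forall>j. card (\<phi> S \<inter> UNIV \<times> {j}) = card (S \<inter> UNIV \<times> {j}))"
    using assms unfolding row_equiv_def by blast
  let ?i = "inv_into (Pow M) \<phi>"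
  have i: "?i T \<in> Pow M" "\<phi> (?i T) = T" if "T \<in> Pow N" for T
    using bij_betwE[OF bij_betw_inv_into[OF \<phi>(1)]] bij_betw_inv_into_right[OF \<phi>(1)] that by blast+
  show ?thesis
    unfolding row_equiv_def
    using bij_betw_inv_into[OF \<phi>(1)] \<phi>(2)[OF i(1)] i(2) by (intro exI[of _ ?i]) simp
qed

lemma row_equiv_trans [trans]:
  assumes "row_equiv M N" "row_equiv N K" shows "row_equiv M K"
proof -
  obtain \<phi> where \<phi>: "bij_betw \<phi> (Pow M) (Pow N)"
    "\<And>S. S \<in> Pow M \<Longrightarrow> max_ne_in N (\<phi> S) = max_ne_in M S \<and> (\<forall>j. card (\<phi> S \<inter> UNIV \<times> {j}) = card (S \<inter> UNIV \<times> {j}))"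
    using assms unfolding row_equiv_def by blast
  obtain \<psi> where \<psi>: "bij_betw \<psi> (Pow N) (Pow K)"
    "\<And>S. S \<in> Pow N \<Longrightarrow> max_ne_in K (\<psi> S) = max_ne_in N S \<and> (\<forall>j. card (\<psi> S \<inter> UNIV \<times> {j}) = card (S \<inter> UNIV \<times> {j}))"
    using assms unfolding row_equiv_def by blast
  have "\<phi> S \<in> Pow N" if "S \<in> Pow M" for S using bij_betwE[OF \<phi>(1)] that by blast
  then show ?thesis
    unfolding row_equiv_def using bij_betw_trans[OF \<phi>(1) \<psi>(1)] \<phi>(2) \<psi>(2) by (intro exI[of _ "\<psi> \<circ> \<phi>"]) simp
qed

lemma total_equiv_sym:
  assumes "total_equiv M N" shows "total_equiv N M"
proof -
  obtain \<phi> where \<phi>: "bij_betw \<phi> (Pow M) (Pow N)"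
    "\<And>S. S \<in> Pow M \<Longrightarrow> max_ne_in N (\<phi> S) = max_ne_in M S \<and> card (\<phi> S) = card S"
    using assms unfolding total_equiv_def by blast
  let ?i = "inv_into (Pow M) \<phi>"
  have i: "?i T \<in> Pow M" "\<phi> (?i T) = T" if "T \<in> Pow N" for T
    using bij_betwE[OF bij_betw_inv_into[OF \<phi>(1)]] bij_betw_inv_into_right[OF \<phi>(1)] that by blast+
  show ?thesis
    unfolding total_equiv_def
    using bij_betw_inv_into[OF \<phi>(1)] \<phi>(2)[OF i(1)] i(2) by (intro exI[of _ ?i]) simp
qed

lemma total_equiv_trans [trans]:
  assumes "total_equiv M N" "total_equiv N K" shows "total_equiv M K"
proof -
  obtain \<phi> where \<phi>: "bij_betw \<phi> (Pow M) (Pow N)"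
    "\<And>S. S \<in> Pow M \<Longrightarrow> max_ne_in N (\<phi> S) = max_ne_in M S \<and> card (\<phi> S) = card S"
    using assms unfolding total_equiv_def by blast
  obtain \<psi> where \<psi>: "bij_betw \<psi> (Pow N) (Pow K)"
    "\<And>S. S \<in> Pow N \<Longrightarrow> max_ne_in K (\<psi> S) = max_ne_in N S \<and> card (\<psi> S) = card S"
    using assms unfolding total_equiv_def by blast
  have "\<phi> S \<in> Pow N" if "S \<in> Pow M" for S using bij_betwE[OF \<phi>(1)] that by blast
  then show ?thesis
    unfolding total_equiv_def using bij_betw_trans[OF \<phi>(1) \<psi>(1)] \<phi>(2) \<psi>(2) by (intro exI[of _ "\<psi> \<circ> \<phi>"]) simp
qed

lemma card_eq_sum_rows:
  assumes "finite S" "finite J" "snd ` S \<subseteq> J"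
  shows "card S = (\<Sum>j\<in>J. card (S \<inter> UNIV \<times> {j}))"
proof -
  have "(\<Sum>j\<in>J. \<Sum>c\<in>{c \<in> S. snd c = j}. 1) = (\<Sum>c\<in>S. 1 :: nat)"
    by (rule sum.group) (use assms in auto)
  moreover have "{c \<in> S. snd c = j} = S \<inter> UNIV \<times> {j}" for j by auto
  ultimately show ?thesis by simp
qed

lemma row_equiv_imp_total_equiv:
  assumes "row_equiv M N" "finite M" "finite N"
  shows "total_equiv M N"
proof -
  obtain \<phi> where \<phi>: "bij_betw \<phi> (Pow M) (Pow N)"
    "\<And>S. S \<in> Pow M \<Longrightarrow> max_ne_in N (\<phi> S) = max_ne_in M S \<and> (\<forall>j. card (\<phi> S \<inter> UNIV \<times> {j}) = card (S \<inter> UNIV \<times> {j}))"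
    using assms unfolding row_equiv_def by blast
  have "card (\<phi> S) = card S" if S: "S \<in> Pow M" for S
  proof -
    have \<phi>S: "\<phi> S \<subseteq> N" using bij_betwE[OF \<phi>(1)] S by blast
    have "card (\<phi> S) = (\<Sum>j\<in>snd ` (M \<union> N). card (\<phi> S \<inter> UNIV \<times> {j}))"
      by (rule card_eq_sum_rows) (use assms \<phi>S finite_subset in auto)
    also have "\<dots> = (\<Sum>j\<in>snd ` (M \<union> N). card (S \<inter> UNIV \<times> {j}))" using \<phi>(2)[OF S] by simp
    also have "\<dots> = card S"
      by (rule card_eq_sum_rows[symmetric]) (use assms S finite_subset in auto)
    finally show ?thesis .
  qed
  then show ?thesis unfolding total_equiv_def using \<phi> by blast
qed

text \<open>Column indices are pulled back: column \<open>p\<close> reappears at \<open>q\<close>,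
  and the columns after \<open>p\<close> up to \<open>q\<close> move one step to the left.\<close>

definition rotate_index :: "int \<Rightarrow> int \<Rightarrow> int \<Rightarrow> int" where
  "rotate_index p q i = (if p \<le> i \<and> i < q then i + 1 else if i = q then p else i)"

definition move_column :: "int \<Rightarrow> int \<Rightarrow> cell set \<Rightarrow> cell set" where
  "move_column p q M = {(i, j). (rotate_index p q i, j) \<in> M}"

lemma cols_move_column: "cols (move_column p q M) i = cols M (rotate_index p q i)"
  by (simp add: cols_def move_column_def)

text \<open>Outside the columns \<open>p\<close> to \<open>q\<close> the set is kept, above and
  below the rectangle it moves along with its column, and inside the rectangle the shift bijection
  is applied. Every rectangle of the polyomino can be enlarged until it contains all of
  \<open>{p..q}\<close> or all of \<open>{a..b}\<close> in the other direction, and such strips are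
  controlled by the shift.\<close>

lemma row_equiv_move_column:
  assumes fin: "finite M" and conv: "convex_polyomino M" and pq: "p \<le> q"
    and first: "cols M p = {a..b}" and inner: "{p..q} \<times> {a..b} \<subseteq> M"
    and outer: "\<And>i. i \<notin> {p..q} \<Longrightarrow> cols M i \<subseteq> {a..b}"
  shows "row_equiv M (move_column p q M)"
proof -
  let ?R = "{p..q} \<times> {a..b}"
  let ?M' = "move_column p q M"
  define O' where "O' = {c \<in> M. fst c \<notin> {p..q}}"
  \<comment> \<open>Column \<open>p\<close> has the rows \<open>{a..b}\<close> only and contributes
    nothing here, so moving one step to the left stays within \<open>{p..<q}\<close>.\<close>
  define D where "D = {c \<in> M. p < fst c \<and> fst c \<le> q \<and> snd c \<notin> {a..b}}"
  define s where "s = (\<lambda>(i, j). (i - 1 :: int, j :: int))"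
  obtain \<phi> where \<phi>: "bij_betw \<phi> (Pow ?R) (Pow ?R)"
    and \<phi>c: "\<And>S j. S \<in> Pow ?R \<Longrightarrow> card (\<phi> S \<inter> UNIV \<times> {j}) = card (S \<inter> UNIV \<times> {j})"
    and \<phi>J: "\<And>S J. S \<in> Pow ?R \<Longrightarrow> ord_convex J \<Longrightarrow> max_ne (\<phi> S \<inter> UNIV \<times> J) = max_ne (S \<inter> UNIV \<times> J)"
    and \<phi>A: "\<And>S A. S \<in> Pow ?R \<Longrightarrow> ord_convex A \<Longrightarrow> A \<subseteq> {p..<q} \<Longrightarrow>
        max_ne (\<phi> S \<inter> A \<times> UNIV) = max_ne (S \<inter> (\<lambda>i. i + 1) ` A \<times> UNIV)"
    using int_rectangle_shift[OF pq, of a b] by blast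
  have injs: "inj s" by (auto simp: s_def inj_on_def)
  have M: "M = O' \<union> D \<union> ?R"
    using inner first by (auto simp: O'_def D_def cols_def set_eq_iff)
  have colM': "(i, j) \<in> ?M' \<longleftrightarrow> (i, j) \<in> O' \<or> (i, j) \<in> s ` D \<or> (i, j) \<in> ?R" for i j
  proof -
    have sD: "(i, j) \<in> s ` D \<longleftrightarrow> (i + 1, j) \<in> D"
    proof
      assume "(i + 1, j) \<in> D"
      then show "(i, j) \<in> s ` D" by (intro image_eqI[of _ s "(i + 1, j)"]) (auto simp: s_def)
    qed (auto simp: s_def)
    consider "p \<le> i" "i < q" | "i = q" | "i \<notin> {p..q}" by fastforce
    then show ?thesis
    proof cases
      case 1
      then have "(i + 1, j) \<in> M \<longleftrightarrow> (i + 1, j) \<in> D \<or> j \<in> {a..b}" using inner by (auto simp: D_def)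
      then show ?thesis using 1 by (auto simp: sD move_column_def rotate_index_def O'_def)
    next
      case 2
      have "(p, j) \<in> M \<longleftrightarrow> j \<in> {a..b}"
        using arg_cong[OF first, of "\<lambda>X. j \<in> X"] by (simp add: cols_def)
      moreover have "(i, j) \<notin> s ` D" unfolding sD using 2 by (simp add: D_def)
      ultimately show ?thesis using 2 pq by (simp add: move_column_def rotate_index_def O'_def)
    next
      case 3
      then have "rotate_index p q i = i" using pq by (auto simp: rotate_index_def)
      moreover have "(i, j) \<notin> s ` D" unfolding sD using 3 by (auto simp: D_def)
      moreover have "(i, j) \<in> O' \<longleftrightarrow> (i, j) \<in> M" using 3 by (simp add: O'_def)
      ultimately show ?thesis using 3 by (auto simp: move_column_def)
    qed
  qed
  then have M': "?M' = O' \<union> s ` D \<union> ?R" by auto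
  have disj: "O' \<inter> D = {}" "O' \<inter> ?R = {}" "D \<inter> ?R = {}" "O' \<inter> s ` D = {}" "s ` D \<inter> ?R = {}"
    by (auto simp: O'_def D_def s_def)
  have finP: "finite O'" "finite D" "finite ?R" using fin by (auto simp: O'_def D_def)
  define hat where "hat S = (S \<inter> O') \<union> s ` (S \<inter> D) \<union> \<phi> (S \<inter> ?R)" for S
  have \<phi>R: "\<phi> (S \<inter> ?R) \<subseteq> ?R" for S using bij_betwE[OF \<phi>] by blast
  have parts: "(X \<union> Y \<union> Z) \<inter> A = X \<and> (X \<union> Y \<union> Z) \<inter> B = Y \<and> (X \<union> Y \<union> Z) \<inter> C = Z"
    if "X \<subseteq> A" "Y \<subseteq> B" "Z \<subseteq> C" "A \<inter> B = {}" "A \<inter> C = {}" "B \<inter> C = {}" for A B C X Y Z :: "cell set"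
    using that by blast
  have hO: "hat S \<inter> O' = S \<inter> O'" and hD: "hat S \<inter> s ` D = s ` (S \<inter> D)" and hR: "hat S \<inter> ?R = \<phi> (S \<inter> ?R)" for S
    using parts[of "S \<inter> O'" O' "s ` (S \<inter> D)" "s ` D" "\<phi> (S \<inter> ?R)" ?R] disj \<phi>R[of S]
    unfolding hat_def by (simp_all add: image_mono)
  have finhat: "finite (hat S)" for S
    using finP finite_subset[OF \<phi>R finP(3)] by (simp add: hat_def)
  have "bij_betw hat (Pow M) (Pow ?M')"
    unfolding bij_betw_def
  proof
    show "inj_on hat (Pow M)"
    proof (rule inj_onI)
      fix S T assume ST: "S \<in> Pow M" "T \<in> Pow M" "hat S = hat T"
      have "S \<inter> O' = T \<inter> O'" using hO ST(3) by metis
      moreover have "S \<inter> D = T \<inter> D" using hD[of S] hD[of T] ST(3) injs by (simp add: inj_image_eq_iff)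
      moreover have "S \<inter> ?R = T \<inter> ?R"
      proof (rule inj_onD[OF bij_betw_imp_inj_on[OF \<phi>]])
        show "\<phi> (S \<inter> ?R) = \<phi> (T \<inter> ?R)" using hR[of S] hR[of T] ST(3) by simp
      qed auto
      moreover have "S = S \<inter> O' \<union> S \<inter> D \<union> S \<inter> ?R" "T = T \<inter> O' \<union> T \<inter> D \<union> T \<inter> ?R"
        using ST M by blast+
      ultimately show "S = T" by metis
    qed
    show "hat ` Pow M = Pow ?M'"
    proof
      show "hat ` Pow M \<subseteq> Pow ?M'" using \<phi>R unfolding M' by (auto simp: hat_def)
      show "Pow ?M' \<subseteq> hat ` Pow M"
      proof
        fix T assume "T \<in> Pow ?M'"
        then have T: "T = T \<inter> O' \<union> T \<inter> s ` D \<union> T \<inter> ?R" unfolding M' by blast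
        have "T \<inter> ?R \<in> \<phi> ` Pow ?R" by (simp only: bij_betw_imp_surj_on[OF \<phi>]) blast
        then obtain U where U: "U \<subseteq> ?R" "\<phi> U = T \<inter> ?R" by blast
        define S where "S = (T \<inter> O') \<union> {c \<in> D. s c \<in> T} \<union> U"
        have "S \<inter> O' = T \<inter> O'" "S \<inter> D = {c \<in> D. s c \<in> T}" "S \<inter> ?R = U"
          using disj U by (auto simp: S_def)
        moreover have "s ` {c \<in> D. s c \<in> T} = T \<inter> s ` D" by auto
        ultimately have "hat S = T" using T U by (simp add: hat_def)
        moreover have "S \<subseteq> M" using U M by (auto simp: S_def)
        ultimately show "T \<in> hat ` Pow M" by blast
      qed
    qed
  qed
  moreover have "card (hat S \<inter> UNIV \<times> {j}) = card (S \<inter> UNIV \<times> {j})" if S: "S \<in> Pow M" for S j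
  proof -
    let ?j = "UNIV \<times> {j}"
    have split: "card (T \<inter> ?j) = card (T1 \<inter> ?j) + card (T2 \<inter> ?j) + card (T3 \<inter> ?j)"
      if "T = T1 \<union> T2 \<union> T3" "T1 \<inter> T2 = {}" "T1 \<inter> T3 = {}" "T2 \<inter> T3 = {}" "finite T1" "finite T2" "finite T3"
      for T T1 T2 T3 :: "cell set"
    proof -
      have "T \<inter> ?j = (T1 \<inter> ?j \<union> T2 \<inter> ?j) \<union> T3 \<inter> ?j" using that by blast
      moreover have "card ((T1 \<inter> ?j \<union> T2 \<inter> ?j) \<union> T3 \<inter> ?j) = card (T1 \<inter> ?j \<union> T2 \<inter> ?j) + card (T3 \<inter> ?j)"
        using that by (intro card_Un_disjoint) auto
      moreover have "card (T1 \<inter> ?j \<union> T2 \<inter> ?j) = card (T1 \<inter> ?j) + card (T2 \<inter> ?j)"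
        using that by (intro card_Un_disjoint) auto
      ultimately show ?thesis by simp
    qed
    have "card (hat S \<inter> ?j) = card (S \<inter> O' \<inter> ?j) + card (s ` (S \<inter> D) \<inter> ?j) + card (\<phi> (S \<inter> ?R) \<inter> ?j)"
      by (rule split) (use disj \<phi>R[of S] finP finite_subset[OF \<phi>R finP(3)] in \<open>auto simp: hat_def\<close>)
    moreover have "card (S \<inter> ?j) = card (S \<inter> O' \<inter> ?j) + card (S \<inter> D \<inter> ?j) + card (S \<inter> ?R \<inter> ?j)"
      by (rule split) (use disj S M finP in auto)
    moreover have "s ` (S \<inter> D) \<inter> ?j = s ` (S \<inter> D \<inter> ?j)" by (auto simp: s_def)
    ultimately show ?thesis
      using \<phi>c[of "S \<inter> ?R" j] by (simp add: card_image inj_on_subset[OF injs])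
  qed
  moreover have "max_ne_in ?M' (hat S) = max_ne_in M S" if S: "S \<in> Pow M" for S
  proof -
    have finS: "finite S" using S fin finite_subset by blast
    have SR: "S \<inter> ?R \<in> Pow ?R" by blast
    \<comment> \<open>Strips of full width: cells to the left and to the right of the rectangle are
      unchanged, so the middle can be exchanged by horizontal gluing.\<close>
    have key1: "max_ne (hat S \<inter> A \<times> J) = max_ne (S \<inter> A \<times> J)"
      if A: "{p..q} \<subseteq> A" and J: "ord_convex J" "J \<subseteq> {a..b}" for A J
    proof -
      define L where "L = S \<inter> (A \<inter> {..<p}) \<times> J"
      define U where "U = S \<inter> (A \<inter> {q<..}) \<times> J"
      define T where "T = S \<inter> ?R \<inter> UNIV \<times> J"
      define T' where "T' = \<phi> (S \<inter> ?R) \<inter> UNIV \<times> J"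
      have "S \<inter> A \<times> J = L \<union> T \<union> U"
        using A J(2) by (auto simp: L_def U_def T_def not_le not_less)
      moreover have "hat S \<inter> A \<times> J = L \<union> T' \<union> U"
      proof -
        have "s ` (S \<inter> D) \<inter> A \<times> J = {}" using J(2) by (auto simp: s_def D_def)
        moreover have "\<phi> (S \<inter> ?R) \<inter> A \<times> J = T'" using \<phi>R[of S] A by (auto simp: T'_def)
        moreover have "S \<inter> O' \<inter> A \<times> J = L \<union> U" using S by (auto simp: O'_def L_def U_def not_le)
        ultimately show ?thesis
          by (simp only: hat_def Int_Un_distrib2 Un_empty_left Un_empty_right Un_assoc Un_commute[of U])
      qed
      moreover have "max_ne (L \<union> T \<union> U) = max_ne (L \<union> T' \<union> U)"
      proof (rule max_ne_glue)
        fix K :: "int set" assume "ord_convex K"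
        then have "max_ne (\<phi> (S \<inter> ?R) \<inter> UNIV \<times> (J \<inter> K)) = max_ne (S \<inter> ?R \<inter> UNIV \<times> (J \<inter> K))"
          by (intro \<phi>J[OF SR] ord_convex_Int J)
        moreover have "T \<inter> UNIV \<times> K = S \<inter> ?R \<inter> UNIV \<times> (J \<inter> K)" "T' \<inter> UNIV \<times> K = \<phi> (S \<inter> ?R) \<inter> UNIV \<times> (J \<inter> K)"
          by (auto simp: T_def T'_def)
        ultimately show "max_ne (T \<inter> UNIV \<times> K) = max_ne (T' \<inter> UNIV \<times> K)" by simp
      next
        have sub: "T \<union> T' \<subseteq> ?R" using \<phi>R[of S] by (auto simp: T_def T'_def)
        show "fst c < fst d" if "c \<in> L" "d \<in> T \<union> T'" for c d
        proof -
          have "d \<in> ?R" using sub that by blast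
          then show ?thesis using that(1) by (auto simp: L_def)
        qed
        show "fst c < fst d" if "c \<in> T \<union> T'" "d \<in> U" for c d
        proof -
          have "c \<in> ?R" using sub that by blast
          then show ?thesis using that(2) by (auto simp: U_def)
        qed
        show "finite (L \<union> T \<union> U \<union> T')"
          using finS finite_subset[OF \<phi>R finP(3)] by (simp add: L_def T_def U_def T'_def)
      qed
      ultimately show ?thesis by simp
    qed
    \<comment> \<open>Strips of full height: once the shift is undone by \<open>r\<close>, the sets
      differ only in the rows \<open>{a..b}\<close>, so vertical gluing applies.\<close>
    have key2: "max_ne (hat S \<inter> A \<times> J) = max_ne (S \<inter> (\<lambda>i. i + 1) ` A \<times> J)"
      if A: "ord_convex A" "A \<subseteq> {p..<q}" and J: "{a..b} \<subseteq> J" for A J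
    proof -
      define A1 where "A1 = (\<lambda>i. i + 1) ` A"
      define r where "r = (\<lambda>(i, j). (i + 1 :: int, j :: int))"
      define L where "L = S \<inter> A1 \<times> (J \<inter> {..<a})"
      define U where "U = S \<inter> A1 \<times> (J \<inter> {b<..})"
      define T where "T = S \<inter> ?R \<inter> A1 \<times> UNIV"
      define T' where "T' = r ` (\<phi> (S \<inter> ?R) \<inter> A \<times> UNIV)"
      have A1: "i \<in> A1 \<longleftrightarrow> i - 1 \<in> A" for i
      proof
        assume "i - 1 \<in> A"
        then show "i \<in> A1" unfolding A1_def by (intro image_eqI[of _ _ "i - 1"]) simp_all
      qed (auto simp: A1_def)
      have r_im: "(i, j) \<in> r ` X \<longleftrightarrow> (i - 1, j) \<in> X" for i j X
      proof
        assume "(i - 1, j) \<in> X"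
        then show "(i, j) \<in> r ` X" by (intro image_eqI[of _ _ "(i - 1, j)"]) (simp_all add: r_def)
      qed (auto simp: r_def)
      have r_max: "max_ne (r ` X) = max_ne X" if "finite X" for X
        using that by (intro max_ne_image) (auto simp: r_def ne_comparable_Pair)
      have sDi: "(i - 1, j) \<in> s ` (S \<inter> D) \<longleftrightarrow> (i, j) \<in> S \<inter> D" for i j
      proof
        assume "(i, j) \<in> S \<inter> D"
        then show "(i - 1, j) \<in> s ` (S \<inter> D)" by (intro image_eqI[of _ _ "(i, j)"]) (simp_all add: s_def)
      qed (auto simp: s_def)
      have pq1: "p < i" "i \<le> q" if "i - 1 \<in> A" for i using A(2) that by (force simp: subset_iff)+
      have "S \<inter> A1 \<times> J = L \<union> T \<union> U"
      proof -
        have "(i, j) \<in> S \<inter> A1 \<times> J \<longleftrightarrow> (i, j) \<in> L \<union> T \<union> U" for i j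
          using pq1[of i] J by (auto simp: L_def U_def T_def A1 not_le not_less)
        then show ?thesis by auto
      qed
      moreover have "r ` (hat S \<inter> A \<times> J) = L \<union> T' \<union> U"
      proof -
        have "(i, j) \<in> r ` (hat S \<inter> A \<times> J) \<longleftrightarrow> (i, j) \<in> L \<union> T' \<union> U" for i j
        proof (cases "i - 1 \<in> A")
          case True
          note i = pq1[OF True]
          have "(i - 1, j) \<in> hat S \<longleftrightarrow> (i, j) \<in> S \<inter> D \<or> (i - 1, j) \<in> \<phi> (S \<inter> ?R)"
            using i by (auto simp: hat_def O'_def sDi)
          moreover have "(i, j) \<in> S \<inter> D \<longleftrightarrow> (i, j) \<in> S \<and> j \<notin> {a..b}"
            using S i by (auto simp: D_def)
          moreover have "j \<in> {a..b}" if "(i - 1, j) \<in> \<phi> (S \<inter> ?R)" using \<phi>R[of S] that by auto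
          ultimately show ?thesis using True J
            by (auto simp: r_im L_def U_def T'_def A1)
        qed (auto simp: r_im L_def U_def T'_def A1)
        then show ?thesis by auto
      qed
      moreover have "max_ne (L \<union> T \<union> U) = max_ne (L \<union> T' \<union> U)"
      proof (rule max_ne_glue_rows)
        fix K :: "int set" assume K: "ord_convex K"
        define A2 where "A2 = A \<inter> {i. i + 1 \<in> K}"
        have "ord_convex {i. i + 1 \<in> K}"
          unfolding ord_convex_def
        proof (intro ballI allI impI)
          fix x y z assume "x \<in> {i. i + 1 \<in> K}" "y \<in> {i. i + 1 \<in> K}" "x \<le> z \<and> z \<le> y"
          then show "z \<in> {i. i + 1 \<in> K}" using ord_convexD[OF K, of "x + 1" "y + 1" "z + 1"] by simp
        qed
        then have "ord_convex A2" unfolding A2_def by (intro ord_convex_Int A)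
        then have "max_ne (\<phi> (S \<inter> ?R) \<inter> A2 \<times> UNIV) = max_ne (S \<inter> ?R \<inter> (\<lambda>i. i + 1) ` A2 \<times> UNIV)"
          using A(2) by (intro \<phi>A[OF SR]) (auto simp: A2_def)
        moreover have "T \<inter> K \<times> UNIV = S \<inter> ?R \<inter> (\<lambda>i. i + 1) ` A2 \<times> UNIV"
          by (auto simp: T_def A1_def A2_def)
        moreover have "T' \<inter> K \<times> UNIV = r ` (\<phi> (S \<inter> ?R) \<inter> A2 \<times> UNIV)"
          by (auto simp: T'_def r_def A2_def)
        ultimately show "max_ne (T \<inter> K \<times> UNIV) = max_ne (T' \<inter> K \<times> UNIV)"
          using finite_subset[OF \<phi>R finP(3)] by (simp add: r_max)
      next
        have sub: "a \<le> snd c \<and> snd c \<le> b" if "c \<in> T \<union> T'" for c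
          using \<phi>R[of S] that by (auto simp: T_def T'_def r_def)
        show "snd c < snd d" if "c \<in> L" "d \<in> T \<union> T'" for c d
          using sub[OF that(2)] that(1) by (auto simp: L_def)
        show "snd c < snd d" if "c \<in> T \<union> T'" "d \<in> U" for c d
          using sub[OF that(1)] that(2) by (auto simp: U_def)
        show "finite (L \<union> T \<union> U \<union> T')"
          using finS finite_subset[OF \<phi>R finP(3)] by (simp add: L_def T_def U_def T'_def)
      qed
      moreover have "max_ne (r ` (hat S \<inter> A \<times> J)) = max_ne (hat S \<inter> A \<times> J)" using finhat by (simp add: r_max)
      ultimately show ?thesis by (simp add: A1_def)
    qed
    have hconv: "(k, j) \<in> M" if "(i, j) \<in> M" "(i', j) \<in> M" "i \<le> k" "k \<le> i'" for i i' j k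
      using conjunct2[OF conv[unfolded convex_polyomino_def]] that by blast
    have vconv: "(i, k) \<in> M" if "(i, j) \<in> M" "(i, j') \<in> M" "j \<le> k" "k \<le> j'" for i j j' k
      using conjunct1[OF conv[unfolded convex_polyomino_def]] that by blast
    have wide: "ord_convex {i. {i} \<times> J \<subseteq> M}" for J
      unfolding ord_convex_def
    proof (intro ballI allI impI, clarify)
      fix x y z j assume "{x} \<times> J \<subseteq> M" "{y} \<times> J \<subseteq> M" "x \<le> z" "z \<le> y" "j \<in> J"
      then show "(z, j) \<in> M" using hconv[of x j y z] by blast
    qed
    have tall: "ord_convex {j. A \<times> {j} \<subseteq> M}" for A
      unfolding ord_convex_def
    proof (intro ballI allI impI, clarify)
      fix x y z i assume "A \<times> {x} \<subseteq> M" "A \<times> {y} \<subseteq> M" "x \<le> z" "z \<le> y" "i \<in> A"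
      then show "(i, z) \<in> M" using vconv[of i x y z] by blast
    qed
    have same: "{i} \<times> J \<subseteq> ?M' \<longleftrightarrow> {i} \<times> J \<subseteq> M" if "J \<subseteq> {a..b}" for i J
    proof (cases "i \<in> {p..q}")
      case True
      then have "{i} \<times> J \<subseteq> ?R" using that by auto
      then show ?thesis using M M' by blast
    next
      case False
      then have "rotate_index p q i = i" using pq by (auto simp: rotate_index_def)
      then show ?thesis by (auto simp: move_column_def)
    qed
    have pq_wide: "{p..q} \<subseteq> {i. {i} \<times> J \<subseteq> M}" if "J \<subseteq> {a..b}" for J
      using that inner by auto
    have "max_ne_in M S \<le> max_ne_in ?M' (hat S)"
    proof (rule max_ne_in_le[OF finS finhat])
      fix A J assume AJ: "ord_convex A" "ord_convex J" "A \<noteq> {}" "J \<noteq> {}" "A \<times> J \<subseteq> M"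
      show "\<exists>A' J'. ord_convex A' \<and> ord_convex J' \<and> A' \<times> J' \<subseteq> ?M' \<and> max_ne (S \<inter> A \<times> J) \<le> max_ne (hat S \<inter> A' \<times> J')"
      proof (cases "J \<subseteq> {a..b}")
        case True
        \<comment> \<open>The rectangle is widened to all columns that contain the rows
          \<open>J\<close>. These include \<open>{p..q}\<close>, and they are the same before and
          after the move.\<close>
        let ?A = "{i. {i} \<times> J \<subseteq> M}"
        have "max_ne (S \<inter> A \<times> J) \<le> max_ne (S \<inter> ?A \<times> J)" using AJ finS by (intro max_ne_mono) auto
        also have "\<dots> = max_ne (hat S \<inter> ?A \<times> J)" using key1[OF pq_wide[OF True] AJ(2) True] by simp
        finally have "max_ne (S \<inter> A \<times> J) \<le> max_ne (hat S \<inter> ?A \<times> J)" .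
        moreover have "?A \<times> J \<subseteq> ?M'"
        proof clarify
          fix i j assume "{i} \<times> J \<subseteq> M" "j \<in> J"
          then have "{i} \<times> J \<subseteq> ?M'" using same[OF True, of i] by simp
          then show "(i, j) \<in> ?M'" using \<open>j \<in> J\<close> by blast
        qed
        ultimately show ?thesis using wide[of J] AJ(2) by (intro exI[of _ ?A] exI[of _ J] conjI)
      next
        case False
        \<comment> \<open>Some row of \<open>J\<close> is outside \<open>{a..b}\<close>, so
          \<open>A\<close> avoids column \<open>p\<close> and all columns beyond
          \<open>{p..q}\<close>. The rectangle is extended to all rows common to the columns in
          \<open>A\<close>, which include \<open>{a..b}\<close>.\<close>
        let ?J = "{j. A \<times> {j} \<subseteq> M}" and ?A = "(\<lambda>i. i - 1) ` A"
        have A: "p < i \<and> i \<le> q" if "i \<in> A" for i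
        proof -
          have "J \<subseteq> cols M i" using AJ(5) that by (auto simp: cols_def)
          then have "i \<in> {p..q}" "i \<noteq> p" using False outer[of i] first by auto
          then show ?thesis by auto
        qed
        have "{i} \<times> {a..b} \<subseteq> M" if "i \<in> A" for i using A[OF that] inner by auto
        then have abJ: "{a..b} \<subseteq> ?J" by auto
        have AA: "(\<lambda>i. i + 1) ` ?A = A" by (auto simp: image_image)
        have cA: "ord_convex ?A"
          unfolding ord_convex_def
        proof (intro ballI allI impI)
          fix x y z assume "x \<in> ?A" "y \<in> ?A" "x \<le> z \<and> z \<le> y"
          then have "z + 1 \<in> A" using ord_convexD[OF AJ(1), of "x + 1" "y + 1" "z + 1"] by auto
          then show "z \<in> ?A" by (intro image_eqI[of _ _ "z + 1"]) auto
        qed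
        have "?A \<subseteq> {p..<q}" using A by force
        then have "max_ne (hat S \<inter> ?A \<times> ?J) = max_ne (S \<inter> A \<times> ?J)" using key2[OF cA _ abJ] AA by simp
        moreover have "max_ne (S \<inter> A \<times> J) \<le> max_ne (S \<inter> A \<times> ?J)" using AJ finS by (intro max_ne_mono) auto
        moreover have "?A \<times> ?J \<subseteq> ?M'"
        proof clarify
          fix i j assume i: "i \<in> A" and "A \<times> {j} \<subseteq> M"
          then have "(i, j) \<in> M" by blast
          then show "(i - 1, j) \<in> ?M'" using A[OF i] by (simp add: move_column_def rotate_index_def)
        qed
        ultimately show ?thesis using cA tall[of A] by (intro exI[of _ ?A] exI[of _ ?J] conjI) simp_all
      qed
    qed
    moreover have "max_ne_in ?M' (hat S) \<le> max_ne_in M S"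
    proof (rule max_ne_in_le[OF finhat finS])
      fix A J assume AJ: "ord_convex A" "ord_convex J" "A \<noteq> {}" "J \<noteq> {}" "A \<times> J \<subseteq> ?M'"
      show "\<exists>A' J'. ord_convex A' \<and> ord_convex J' \<and> A' \<times> J' \<subseteq> M \<and> max_ne (hat S \<inter> A \<times> J) \<le> max_ne (S \<inter> A' \<times> J')"
      proof (cases "J \<subseteq> {a..b}")
        case True
        let ?A = "{i. {i} \<times> J \<subseteq> M}"
        have "A \<subseteq> ?A"
        proof
          fix i assume "i \<in> A"
          then have "{i} \<times> J \<subseteq> ?M'" using AJ(5) by blast
          then show "i \<in> ?A" using same[OF True, of i] by simp
        qed
        then have "max_ne (hat S \<inter> A \<times> J) \<le> max_ne (hat S \<inter> ?A \<times> J)" using finhat by (intro max_ne_mono) auto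
        also have "\<dots> = max_ne (S \<inter> ?A \<times> J)" using key1[OF pq_wide[OF True] AJ(2) True] by simp
        finally have "max_ne (hat S \<inter> A \<times> J) \<le> max_ne (S \<inter> ?A \<times> J)" .
        moreover have "?A \<times> J \<subseteq> M" by auto
        ultimately show ?thesis using wide[of J] AJ(2) by (intro exI[of _ ?A] exI[of _ J] conjI)
      next
        case False
        let ?A = "(\<lambda>i. i + 1) ` A"
        let ?J = "{j. ?A \<times> {j} \<subseteq> M}"
        have A: "p \<le> i \<and> i < q" if "i \<in> A" for i
        proof -
          have "J \<subseteq> cols ?M' i" using AJ(5) that by (auto simp: cols_def)
          then have J: "\<not> cols M (rotate_index p q i) \<subseteq> {a..b}" using False by (auto simp: cols_move_column)
          show ?thesis
          proof (rule ccontr)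
            assume "\<not> ?thesis"
            then have "rotate_index p q i = p \<or> rotate_index p q i \<notin> {p..q}" by (auto simp: rotate_index_def)
            then show False using J first outer by auto
          qed
        qed
        have AM: "(i + 1, j) \<in> M" if "i \<in> A" "j \<in> J" for i j
        proof -
          have "(i, j) \<in> ?M'" using AJ(5) that by blast
          then show ?thesis using A[OF that(1)] by (simp add: move_column_def rotate_index_def)
        qed
        have "{i + 1} \<times> {a..b} \<subseteq> M" if "i \<in> A" for i using A[OF that] inner by auto
        then have abJ: "{a..b} \<subseteq> ?J" by auto
        have cA: "ord_convex ?A"
          unfolding ord_convex_def
        proof (intro ballI allI impI)
          fix x y z assume "x \<in> ?A" "y \<in> ?A" "x \<le> z \<and> z \<le> y"
          then have "z - 1 \<in> A" using ord_convexD[OF AJ(1), of "x - 1" "y - 1" "z - 1"] by auto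
          then show "z \<in> ?A" by (intro image_eqI[of _ _ "z - 1"]) auto
        qed
        have "A \<subseteq> {p..<q}" using A by force
        then have "max_ne (hat S \<inter> A \<times> ?J) = max_ne (S \<inter> ?A \<times> ?J)" using key2[OF AJ(1) _ abJ] by simp
        moreover have "max_ne (hat S \<inter> A \<times> J) \<le> max_ne (hat S \<inter> A \<times> ?J)"
          using AM finhat by (intro max_ne_mono) auto
        moreover have "?A \<times> ?J \<subseteq> M" by auto
        ultimately show ?thesis using cA tall[of ?A] by (intro exI[of _ ?A] exI[of _ ?J] conjI) simp_all
      qed
    qed
    ultimately show ?thesis by simp
  qed
  ultimately show ?thesis unfolding row_equiv_def by blast
qed

section \<open>Normal forms of moon polyominoes\<close>

lemma cols_eq_column: "cols M i = snd ` column M i"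
  by (force simp: cols_def column_def)

lemma cols_empty_iff: "cols M i = {} \<longleftrightarrow> i \<notin> fst ` M"
  by (force simp: cols_def)

lemma moon_finite: "moon_polyomino M \<Longrightarrow> finite M"
  by (simp add: moon_polyomino_def polyomino_def)

lemma moon_cols_nested:
  assumes "moon_polyomino M" shows "cols M i \<subseteq> cols M i' \<or> cols M i' \<subseteq> cols M i"
proof (cases "i \<in> fst ` M \<and> i' \<in> fst ` M")
  case True
  then show ?thesis using assms
    unfolding moon_polyomino_def intersection_free_def column_indices_def cols_eq_column by blast
next
  case False
  then show ?thesis using cols_empty_iff[of M i] cols_empty_iff[of M i'] by auto
qed

lemma moonI:
  assumes "finite M" "\<And>i. ord_convex (cols M i)" "\<And>j. ord_convex {i. (i, j) \<in> M}"
    "\<And>i i'. cols M i \<subseteq> cols M i' \<or> cols M i' \<subseteq> cols M i"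
  shows "moon_polyomino M"
  unfolding moon_polyomino_def polyomino_def convex_polyomino_def intersection_free_def
proof (intro conjI allI impI ballI)
  show "(i, k) \<in> M" if "(i, j) \<in> M \<and> (i, j') \<in> M \<and> j \<le> k \<and> k \<le> j'" for i j j' k
    using ord_convexD[OF assms(2)[of i], of j j' k] that by (simp add: cols_def)
  show "(k, j) \<in> M" if "(i, j) \<in> M \<and> (i', j) \<in> M \<and> i \<le> k \<and> k \<le> i'" for i i' j k
    using ord_convexD[OF assms(3)[of j], of i i' k] that by simp
qed (use assms in \<open>simp_all flip: cols_eq_column\<close>)

lemma moon_cols_convex: "moon_polyomino M \<Longrightarrow> ord_convex (cols M i)"
  unfolding moon_polyomino_def convex_polyomino_def ord_convex_def cols_def by blast

lemma moon_rows_convex: "moon_polyomino M \<Longrightarrow> ord_convex {i. (i, j) \<in> M}"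
  unfolding moon_polyomino_def convex_polyomino_def ord_convex_def by blast

lemma finite_cols: "finite M \<Longrightarrow> finite (cols M i)"
  unfolding cols_def using finite_vimageI[of M "\<lambda>j. (i, j)"] by (simp add: inj_on_def vimage_def)

lemma ord_convex_eq_atLeastAtMost:
  fixes J :: "int set"
  assumes "finite J" "J \<noteq> {}" "ord_convex J"
  shows "J = {Min J..Max J}"
proof
  show "J \<subseteq> {Min J..Max J}" using assms(1) by auto
  show "{Min J..Max J} \<subseteq> J"
    using ord_convexD[OF assms(3) Min_in[OF assms(1,2)] Max_in[OF assms(1,2)]] by auto
qed

lemma cols_ext: "(\<And>i. cols M i = cols N i) \<Longrightarrow> M = N"
  by (auto simp: cols_def set_eq_iff)

lemma moon_fst_convex:
  assumes M: "moon_polyomino M" shows "ord_convex (fst ` M)"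
  unfolding ord_convex_def
proof (intro ballI allI impI)
  fix x y z assume xy: "x \<in> fst ` M" "y \<in> fst ` M" "x \<le> z \<and> z \<le> y"
  then have "cols M x \<noteq> {}" "cols M y \<noteq> {}" using cols_empty_iff by blast+
  then have "cols M x \<inter> cols M y \<noteq> {}" using moon_cols_nested[OF M, of x y] by auto
  then obtain j where "j \<in> cols M x" "j \<in> cols M y" by blast
  then have "(x, j) \<in> M" "(y, j) \<in> M" by (simp_all add: cols_def)
  then have "(z, j) \<in> M" using ord_convexD[OF moon_rows_convex[OF M, of j], of x y z] xy by simp
  then show "z \<in> fst ` M" using image_eqI[of z fst "(z, j)" M] by simp
qed

text \<open>Finer than the content, as it also records the vertical positions. Moving columns
  preserves it.\<close>

definition column_mset :: "cell set \<Rightarrow> int set multiset" where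
  "column_mset M = image_mset (cols M) (mset_set (fst ` M))"

lemma content_eq: "content M = image_mset card (column_mset M)"
proof -
  have "card (column M i) = card (cols M i)" for i
  proof -
    have "column M i = Pair i ` cols M i" by (auto simp: column_def cols_def)
    then show ?thesis by (simp add: card_image inj_on_def)
  qed
  then show ?thesis by (simp add: content_def column_mset_def column_indices_def multiset.map_comp comp_def)
qed

lemma inj_rotate_index: "p \<le> q \<Longrightarrow> inj (rotate_index p q)"
  by (auto simp: inj_on_def rotate_index_def split: if_splits)

lemma cols_permuted:
  assumes "\<And>i. cols N i = cols M (\<tau> i)" "\<tau> permutes F" "fst ` M = F"
  shows "fst ` N = F" "column_mset N = column_mset M"
proof -
  have "i \<in> fst ` N \<longleftrightarrow> i \<in> F" for i
    using cols_empty_iff[of N i] cols_empty_iff[of M "\<tau> i"] assms permutes_in_image[OF assms(2), of i] by simp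
  then show F: "fst ` N = F" by blast
  have "cols N = cols M \<circ> \<tau>" using assms(1) by auto
  then have "column_mset N = image_mset (cols M) (image_mset \<tau> (mset_set F))"
    by (simp add: column_mset_def F multiset.map_comp)
  also have "image_mset \<tau> (mset_set F) = mset_set F"
    using image_mset_mset_set[of \<tau> F] permutes_inj_on[OF assms(2)] permutes_image[OF assms(2)] by simp
  finally show "column_mset N = column_mset M" by (simp add: column_mset_def assms(3))
qed

lemma rotate_index_permutes:
  assumes "p \<le> q" "{p..q} \<subseteq> F" shows "rotate_index p q permutes F"
proof -
  have "rotate_index p q permutes {p..q}"
  proof (rule bij_imp_permutes)
    have "inj_on (rotate_index p q) {p..q}" using inj_rotate_index[OF assms(1)] inj_on_subset by blast
    moreover have "rotate_index p q ` {p..q} \<subseteq> {p..q}" using assms(1) by (auto simp: rotate_index_def)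
    ultimately show "bij_betw (rotate_index p q) {p..q} {p..q}"
      by (simp add: bij_betw_def endo_inj_surj)
  qed (use assms(1) in \<open>auto simp: rotate_index_def\<close>)
  then show ?thesis using assms(2) permutes_subset by blast
qed

text \<open>Let \<open>q\<close> be the last column that contains column \<open>p\<close>. The
  columns in between contain it by convexity of rows, later ones are contained in it because columns
  are nested, and there are none before \<open>p\<close>. So the rectangle needed for the move
  exists.\<close>

lemma move_first_column:
  assumes M: "moon_polyomino M" and p: "p \<in> fst ` M" "\<And>i. i \<in> fst ` M \<Longrightarrow> p \<le> i"
    and t: "p < t" "cols M p \<subseteq> cols M t"
  obtains q where "t \<le> q" "row_equiv M (move_column p q M)" "moon_polyomino (move_column p q M)"
    "fst ` move_column p q M = fst ` M" "column_mset (move_column p q M) = column_mset M"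
proof -
  have finM: "finite M" using M by (rule moon_finite)
  define I where "I = cols M p"
  have I: "finite I" "I \<noteq> {}" "ord_convex I"
    using finite_cols[OF finM] cols_empty_iff[of M p] p(1) moon_cols_convex[OF M] by (auto simp: I_def)
  define Q where "Q = {i. I \<subseteq> cols M i}"
  have QM: "Q \<subseteq> fst ` M"
  proof
    fix i assume "i \<in> Q"
    then have "cols M i \<noteq> {}" using I(2) by (auto simp: Q_def)
    then show "i \<in> fst ` M" using cols_empty_iff by blast
  qed
  then have finQ: "finite Q" using finM finite_subset by blast
  define q where "q = Max Q"
  have tQ: "t \<in> Q" "p \<in> Q" using t by (auto simp: Q_def I_def)
  have qQ: "q \<in> Q" using Max_in[OF finQ] tQ by (auto simp: q_def)
  have tq: "t \<le> q" using Max_ge[OF finQ tQ(1)] by (simp add: q_def)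
  then have pq: "p \<le> q" using t by simp
  have inner: "{p..q} \<times> I \<subseteq> M"
  proof clarify
    fix i j assume "i \<in> {p..q}" "j \<in> I"
    then show "(i, j) \<in> M"
      using ord_convexD[OF moon_rows_convex[OF M, of j], of p q i] tQ(2) qQ by (auto simp: Q_def cols_def)
  qed
  have outer: "cols M i \<subseteq> I" if "i \<notin> {p..q}" for i
  proof (cases "i \<in> fst ` M")
    case True
    then have "q < i" using p(2)[of i] that by auto
    then have "i \<notin> Q" using Max_ge[OF finQ, of i] by (auto simp: q_def)
    then show ?thesis using moon_cols_nested[OF M, of p i] by (auto simp: Q_def I_def)
  next
    case False
    then show ?thesis using cols_empty_iff[of M i] by simp
  qed
  have Ieq: "I = {Min I..Max I}" using ord_convex_eq_atLeastAtMost I by blast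
  have "row_equiv M (move_column p q M)"
  proof (rule row_equiv_move_column[OF finM _ pq])
    show "convex_polyomino M" using M by (simp add: moon_polyomino_def)
    show "cols M p = {Min I..Max I}" using Ieq by (simp add: I_def)
    show "{p..q} \<times> {Min I..Max I} \<subseteq> M" using inner Ieq by simp
    show "cols M i \<subseteq> {Min I..Max I}" if "i \<notin> {p..q}" for i using outer[OF that] Ieq by simp
  qed
  have "{p..q} \<subseteq> fst ` M" using inner I(2) by force
  then have perm: "rotate_index p q permutes fst ` M" using rotate_index_permutes pq by blast
  note moved = cols_permuted[OF cols_move_column perm refl]
  have "moon_polyomino (move_column p q M)"
  proof (rule moonI)
    have "move_column p q M \<subseteq> fst ` M \<times> snd ` M"
    proof clarify
      fix i j assume ij: "(i, j) \<in> move_column p q M"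
      then have "i \<in> fst ` move_column p q M" by force
      moreover have "j \<in> snd ` M" using ij by (force simp: move_column_def)
      ultimately show "i \<in> fst ` M \<and> j \<in> snd ` M" by (simp add: moved)
    qed
    then show "finite (move_column p q M)" using finM finite_subset by blast
    show "ord_convex (cols (move_column p q M) i)" for i by (simp add: cols_move_column moon_cols_convex[OF M])
    show "cols (move_column p q M) i \<subseteq> cols (move_column p q M) i' \<or> cols (move_column p q M) i' \<subseteq> cols (move_column p q M) i" for i i'
      by (simp add: cols_move_column moon_cols_nested[OF M])
    \<comment> \<open>A row that meets column \<open>p\<close> is unchanged. Any other row meeting
      the moved polyomino lies in \<open>{p<..q}\<close> before the move and is translated as a
      whole.\<close>
    show "ord_convex {i. (i, j) \<in> move_column p q M}" for j
    proof (cases "j \<in> I")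
      case True
      have "(i, j) \<in> move_column p q M \<longleftrightarrow> (i, j) \<in> M" for i
      proof (cases "i \<in> {p..q}")
        case True
        then have "rotate_index p q i \<in> {p..q}" by (auto simp: rotate_index_def)
        then have "(rotate_index p q i, j) \<in> M" "(i, j) \<in> M" using inner True \<open>j \<in> I\<close> by blast+
        then show ?thesis by (simp add: move_column_def)
      next
        case False
        then have "rotate_index p q i = i" using pq by (auto simp: rotate_index_def)
        then show ?thesis by (simp add: move_column_def)
      qed
      then show ?thesis using moon_rows_convex[OF M, of j] by simp
    next
      case False
      have in_pq: "p \<le> i \<and> i < q \<and> (i + 1, j) \<in> M" if "(i, j) \<in> move_column p q M" for i
      proof -
        have *: "(rotate_index p q i, j) \<in> M" using that by (simp add: move_column_def)
        then have "rotate_index p q i \<in> {p..q}" "rotate_index p q i \<noteq> p"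
          using False outer[of "rotate_index p q i"] by (auto simp: cols_def I_def)
        then have "p \<le> i \<and> i < q" by (auto simp: rotate_index_def split: if_splits)
        then show ?thesis using * by (auto simp: rotate_index_def)
      qed
      show ?thesis
        unfolding ord_convex_def
      proof (intro ballI allI impI)
        fix x y z assume xyz: "x \<in> {i. (i, j) \<in> move_column p q M}" "y \<in> {i. (i, j) \<in> move_column p q M}" "x \<le> z \<and> z \<le> y"
        then have "p \<le> z" "z < q" "(x + 1, j) \<in> M" "(y + 1, j) \<in> M" using in_pq[of x] in_pq[of y] by auto
        moreover have "(z + 1, j) \<in> M"
          using ord_convexD[OF moon_rows_convex[OF M, of j], of "x + 1" "y + 1" "z + 1"] calculation xyz by simp
        ultimately show "z \<in> {i. (i, j) \<in> move_column p q M}" by (simp add: move_column_def rotate_index_def)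
      qed
    qed
  qed
  then show ?thesis using that tq \<open>row_equiv M (move_column p q M)\<close> moved by blast
qed

text \<open>Repeatedly moving the first column behind the last column containing it makes the first
  column a largest one; then the columns decrease from left to right.\<close>

definition canonical :: "cell set \<Rightarrow> bool" where
  "canonical M \<longleftrightarrow> moon_polyomino M \<and> (\<forall>i\<in>fst ` M. \<forall>i'. i \<le> i' \<longrightarrow> cols M i' \<subseteq> cols M i)"

text \<open>\<open>k\<close> is the distance from the first column to a largest one, and each move
  shortens it by one. For \<open>k = 0\<close> every row starts in the first column, so by convexity
  of rows the columns decrease.\<close>

lemma ex_canonical_aux:
  assumes "moon_polyomino M" "p \<in> fst ` M" "\<And>i. i \<in> fst ` M \<Longrightarrow> p \<le> i"
    "\<And>i. cols M i \<subseteq> cols M (p + int k)"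
  shows "\<exists>N. row_equiv M N \<and> canonical N \<and> fst ` N = fst ` M \<and> column_mset N = column_mset M"
  using assms
proof (induction k arbitrary: M)
  case 0
  have "cols M i' \<subseteq> cols M i" if i: "i \<in> fst ` M" "i \<le> i'" for i i'
  proof
    fix j assume "j \<in> cols M i'"
    moreover then have "j \<in> cols M p" using 0 by auto
    ultimately show "j \<in> cols M i"
      using ord_convexD[OF moon_rows_convex[OF 0(1), of j], of p i' i] 0(3)[OF i(1)] i by (simp add: cols_def)
  qed
  then show ?case using 0 by (intro exI[of _ M]) (auto simp: canonical_def)
next
  case (Suc k)
  let ?t = "p + int (Suc k)"
  have "p < ?t" "cols M p \<subseteq> cols M ?t" using Suc.prems by auto
  then obtain q where q: "?t \<le> q" "row_equiv M (move_column p q M)" "moon_polyomino (move_column p q M)"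
    "fst ` move_column p q M = fst ` M" "column_mset (move_column p q M) = column_mset M"
    using move_first_column[OF Suc.prems(1-3)] by blast
  have "rotate_index p q (p + int k) = ?t" using q(1) by (auto simp: rotate_index_def)
  then have "cols (move_column p q M) i \<subseteq> cols (move_column p q M) (p + int k)" for i
    using Suc.prems(4) by (simp add: cols_move_column)
  then obtain N where "row_equiv (move_column p q M) N" "canonical N" "fst ` N = fst ` M" "column_mset N = column_mset M"
    using Suc.IH[of "move_column p q M"] q Suc.prems(2,3) by auto
  then show ?case using row_equiv_trans[OF q(2)] by blast
qed

lemma ex_canonical:
  assumes M: "moon_polyomino M"
  shows "\<exists>N. row_equiv M N \<and> canonical N \<and> fst ` N = fst ` M \<and> column_mset N = column_mset M"
proof (cases "M = {}")
  case True
  then show ?thesis using M by (intro exI[of _ M]) (simp add: canonical_def)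
next
  case False
  have finM: "finite M" using M by (rule moon_finite)
  define p where "p = Min (fst ` M)"
  have p: "p \<in> fst ` M" "\<And>i. i \<in> fst ` M \<Longrightarrow> p \<le> i" using finM False by (auto simp: p_def Min_in intro: Min_in)
  obtain t where t: "t \<in> fst ` M" "\<forall>i\<in>fst ` M. card (cols M i) \<le> card (cols M t)"
  proof -
    have "Max ((\<lambda>i. card (cols M i)) ` fst ` M) \<in> (\<lambda>i. card (cols M i)) ` fst ` M"
      using finM False by (intro Max_in) auto
    then obtain t where "Max ((\<lambda>i. card (cols M i)) ` fst ` M) = card (cols M t)" "t \<in> fst ` M"
      by (rule imageE)
    moreover have "card (cols M i) \<le> Max ((\<lambda>i. card (cols M i)) ` fst ` M)" if "i \<in> fst ` M" for i
      using finM that by (intro Max_ge) auto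
    ultimately show ?thesis using that[of t] by simp
  qed
  have "cols M i \<subseteq> cols M t" for i
  proof (cases "i \<in> fst ` M")
    case True
    then show ?thesis
      using moon_cols_nested[OF M, of i t] t finite_cols[OF finM] by (metis card_seteq order_refl)
  next
    case False
    then show ?thesis using cols_empty_iff[of M i] by simp
  qed
  moreover have "t = p + int (nat (t - p))" using p t by simp
  ultimately show ?thesis using ex_canonical_aux[OF M p] by metis
qed

lemma sorted_wrt_ge_unique:
  fixes xs ys :: "'a::order list"
  assumes "sorted_wrt (\<ge>) xs" "sorted_wrt (\<ge>) ys" "mset xs = mset ys"
  shows "xs = ys"
  using assms
proof (induction xs arbitrary: ys)
  case (Cons x xs)
  then obtain y ys' where ys: "ys = y # ys'" by (cases ys) auto
  have "set (x # xs) = set ys" using Cons.prems(3) by (metis set_mset_mset)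
  then have "x \<in> set (y # ys')" "y \<in> set (x # xs)" using ys by auto
  then have "x = y" using Cons.prems(1,2) ys by auto (metis order_antisym)
  then show ?case using Cons.IH[of ys'] Cons.prems ys by simp
qed simp

lemma canonical_unique:
  assumes "canonical M" "canonical N" "fst ` M = fst ` N" "column_mset M = column_mset N"
  shows "M = N"
proof -
  have finM: "finite M" using assms(1) moon_finite by (auto simp: canonical_def)
  define xs where "xs = sorted_list_of_set (fst ` M)"
  have xs: "set xs = fst ` M" "sorted_wrt (\<le>) xs" "mset xs = mset_set (fst ` M)"
    using finM mset_set_set[of xs] by (simp_all add: xs_def)
  have srt: "sorted_wrt (\<ge>) (map (cols K) xs)" if "canonical K" "fst ` K = fst ` M" for K
  proof -
    have "cols K i' \<subseteq> cols K i" if "i \<in> fst ` K" "i \<le> i'" for i i'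
      using \<open>canonical K\<close> that unfolding canonical_def by blast
    then show ?thesis
      unfolding sorted_wrt_map
      by (intro sorted_wrt_mono_rel[OF _ xs(2)]) (simp add: xs(1) that(2))
  qed
  have "mset (map (cols M) xs) = mset (map (cols N) xs)"
    using assms(3,4) by (simp add: xs(3) column_mset_def)
  then have "map (cols M) xs = map (cols N) xs"
    by (rule sorted_wrt_ge_unique[OF srt[OF assms(1) refl] srt[OF assms(2) assms(3)[symmetric]]])
  then have "\<forall>i\<in>fst ` M. cols M i = cols N i" by (simp only: map_eq_conv xs(1))
  then have "cols M i = cols N i" if "i \<in> fst ` M" for i using that by (rule bspec)
  moreover have "cols M i = cols N i" if "i \<notin> fst ` M" for i
    using that assms(3) cols_empty_iff[of M i] cols_empty_iff[of N i] by simp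
  ultimately have "cols M i = cols N i" for i by (cases "i \<in> fst ` M") simp_all
  then show ?thesis by (rule cols_ext)
qed

lemma moon_row_equiv:
  assumes "moon_polyomino M" "moon_polyomino N" "fst ` M = fst ` N" "column_mset M = column_mset N"
  shows "row_equiv M N"
proof -
  obtain M' where M': "row_equiv M M'" "canonical M'" "fst ` M' = fst ` M" "column_mset M' = column_mset M"
    using ex_canonical[OF assms(1)] by blast
  obtain N' where N': "row_equiv N N'" "canonical N'" "fst ` N' = fst ` N" "column_mset N' = column_mset N"
    using ex_canonical[OF assms(2)] by blast
  have "M' = N'" by (rule canonical_unique[OF M'(2) N'(2)]) (simp_all add: M' N' assms)
  then show ?thesis using row_equiv_trans[OF M'(1)] row_equiv_sym[OF N'(1)] by simp
qed

section \<open>Transposition and translation\<close>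

lemma total_equiv_image:
  assumes inj: "inj h"
    and cmp: "\<And>c d. ne_comparable (h c) (h d) \<longleftrightarrow> ne_comparable c d"
    and box: "\<And>c d. h ` ({fst c..fst d} \<times> {snd c..snd d}) = {fst (h c)..fst (h d)} \<times> {snd (h c)..snd (h d)}"
  shows "total_equiv M (h ` M)"
proof -
  have "max_ne_in (h ` M) (h ` S) = max_ne_in M S" for S
  proof -
    have ne: "ne_set (h ` X) \<longleftrightarrow> ne_set X" for X
      using inj by (auto simp: ne_set_def cmp inj_eq)
    have bc: "box_closed (h ` M) (h ` X) \<longleftrightarrow> box_closed M X" for X
      by (auto simp: box_closed_def inj_image_subset_iff[OF inj] simp flip: box)
    have "{Y. Y \<subseteq> h ` S \<and> ne_set Y \<and> box_closed (h ` M) Y} = (`) h ` {X. X \<subseteq> S \<and> ne_set X \<and> box_closed M X}"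
      by (auto simp: subset_image_iff ne bc)
    moreover have "card (h ` X) = card X" for X using inj by (simp add: card_image inj_on_subset)
    ultimately show ?thesis by (simp add: max_ne_in_def image_image)
  qed
  moreover have "bij_betw ((`) h) (Pow M) (Pow (h ` M))"
    using inj_on_subset[OF inj subset_UNIV] by (intro bij_betw_Pow) (simp add: bij_betw_def)
  moreover have "card (h ` S) = card S" for S using inj by (simp add: card_image inj_on_subset)
  ultimately show ?thesis unfolding total_equiv_def by blast
qed

definition shift_columns :: "int \<Rightarrow> cell \<Rightarrow> cell" where
  "shift_columns a = (\<lambda>(i, j). (i + a, j))"

lemma mem_shift_columns: "(i, j) \<in> shift_columns a ` X \<longleftrightarrow> (i - a, j) \<in> X"
proof
  assume "(i - a, j) \<in> X"
  then show "(i, j) \<in> shift_columns a ` X"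
    by (intro image_eqI[of _ _ "(i - a, j)"]) (simp_all add: shift_columns_def)
qed (auto simp: shift_columns_def)

lemma total_equiv_swap: "total_equiv M (prod.swap ` M)"
  by (rule total_equiv_image) (auto simp: ne_comparable_Pair ne_comparable_def ne_less_def)

lemma total_equiv_shift: "total_equiv M (shift_columns a ` M)"
proof (rule total_equiv_image)
  show "inj (shift_columns a)" by (auto simp: shift_columns_def inj_on_def)
  show "ne_comparable (shift_columns a c) (shift_columns a d) \<longleftrightarrow> ne_comparable c d" for c d
    by (cases c; cases d) (simp add: shift_columns_def ne_comparable_Pair)
  show "shift_columns a ` ({fst c..fst d} \<times> {snd c..snd d}) =
      {fst (shift_columns a c)..fst (shift_columns a d)} \<times> {snd (shift_columns a c)..snd (shift_columns a d)}" for c d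
    by (auto simp: set_eq_iff mem_shift_columns) (auto simp: shift_columns_def split_beta)
qed

lemma cols_shift: "cols (shift_columns a ` M) i = cols M (i - a)"
  by (simp add: cols_def mem_shift_columns)

lemma fst_shift: "fst ` shift_columns a ` M = (\<lambda>i. i + a) ` fst ` M"
  by (force simp: shift_columns_def)

lemma column_mset_shift: "column_mset (shift_columns a ` M) = column_mset M"
proof -
  have "mset_set ((\<lambda>i. i + a) ` fst ` M) = image_mset (\<lambda>i. i + a) (mset_set (fst ` M))"
    by (rule image_mset_mset_set[symmetric]) simp
  then show ?thesis by (simp add: column_mset_def fst_shift multiset.map_comp comp_def cols_shift)
qed

lemma moon_shift:
  assumes M: "moon_polyomino M" shows "moon_polyomino (shift_columns a ` M)"
proof (rule moonI)
  show "finite (shift_columns a ` M)" using moon_finite[OF M] by simp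
  show "ord_convex (cols (shift_columns a ` M) i)" for i by (simp add: cols_shift moon_cols_convex[OF M])
  show "cols (shift_columns a ` M) i \<subseteq> cols (shift_columns a ` M) i' \<or> cols (shift_columns a ` M) i' \<subseteq> cols (shift_columns a ` M) i" for i i'
    by (simp add: cols_shift moon_cols_nested[OF M])
  show "ord_convex {i. (i, j) \<in> shift_columns a ` M}" for j
    unfolding ord_convex_def
  proof (intro ballI allI impI)
    fix x y z assume "x \<in> {i. (i, j) \<in> shift_columns a ` M}" "y \<in> {i. (i, j) \<in> shift_columns a ` M}" "x \<le> z \<and> z \<le> y"
    then show "z \<in> {i. (i, j) \<in> shift_columns a ` M}"
      using ord_convexD[OF moon_rows_convex[OF M, of j], of "x - a" "y - a" "z - a"] by (simp add: mem_shift_columns)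
  qed
qed

lemma moon_swap:
  assumes M: "moon_polyomino M" shows "moon_polyomino (prod.swap ` M)"
proof (rule moonI)
  have cs: "cols (prod.swap ` M) j = {i. (i, j) \<in> M}" for j by (force simp: cols_def)
  have sw: "{j. (j, i) \<in> prod.swap ` M} = cols M i" for i by (force simp: cols_def)
  show "finite (prod.swap ` M)" using moon_finite[OF M] by simp
  show "ord_convex (cols (prod.swap ` M) j)" for j by (simp add: cs moon_rows_convex[OF M])
  show "ord_convex {j. (j, i) \<in> prod.swap ` M}" for i unfolding sw by (rule moon_cols_convex[OF M])
  show "cols (prod.swap ` M) j \<subseteq> cols (prod.swap ` M) j' \<or> cols (prod.swap ` M) j' \<subseteq> cols (prod.swap ` M) j" for j j'
    using moon_cols_nested[OF M] by (fastforce simp: cs cols_def)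
qed

text \<open>Multiplicities are differences of consecutive tail counts; for the value 0 the full size
  of \<open>J\<close> takes the place of the preceding tail.\<close>

lemma image_mset_eq_by_tails:
  fixes f g :: "int \<Rightarrow> nat"
  assumes "finite J" and "\<And>i. card {j \<in> J. i < f j} = card {j \<in> J. i < g j}"
  shows "image_mset f (mset_set J) = image_mset g (mset_set J)"
proof (rule multiset_eqI)
  have count: "count (image_mset f (mset_set J)) x = card {j \<in> J. f j = x}" for f :: "int \<Rightarrow> nat" and x
    using assms(1) by (simp add: count_image_mset_eq_card_vimage)
  have tail: "card {j \<in> J. f j = x} + card {j \<in> J. x < f j} = (case x of 0 \<Rightarrow> card J | Suc y \<Rightarrow> card {j \<in> J. y < f j})"
    for f :: "int \<Rightarrow> nat" and x
  proof -
    have "card {j \<in> J. f j = x} + card {j \<in> J. x < f j} = card ({j \<in> J. f j = x} \<union> {j \<in> J. x < f j})"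
      using assms(1) by (intro card_Un_disjoint[symmetric]) auto
    also have "{j \<in> J. f j = x} \<union> {j \<in> J. x < f j} = (case x of 0 \<Rightarrow> J | Suc y \<Rightarrow> {j \<in> J. y < f j})"
      by (auto split: nat.splits)
    finally show ?thesis by (simp split: nat.splits)
  qed
  fix x
  show "count (image_mset f (mset_set J)) x = count (image_mset g (mset_set J)) x"
    using tail[of f x] tail[of g x] assms(2) by (simp add: count split: nat.splits)
qed

text \<open>Once the columns are sorted, all rows start in the first column. After transposition and
  translation the columns are therefore initial intervals. Their lengths form the partition
  conjugate to \<open>hs\<close>, so their multiset depends on the content alone, while their order
  is still arbitrary.\<close>

lemma moon_normal_form:
  assumes M: "moon_polyomino M" and ne: "M \<noteq> {}"
    and hs: "sorted_wrt (\<ge>) hs" "mset hs = content M"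
  shows "\<exists>N f. total_equiv M N \<and> moon_polyomino N \<and> fst ` N = {0..<int (hs ! 0)} \<and>
    column_mset N = image_mset (\<lambda>k. {0..<int k}) (image_mset f (mset_set {0..<int (hs ! 0)})) \<and>
    (\<forall>i. card {j \<in> {0..<int (hs ! 0)}. i < f j} = (if i < length hs then hs ! i else 0))"
proof -
  have finM: "finite M" using M by (rule moon_finite)
  define lo where "lo = Min (fst ` M)"
  define M0 where "M0 = shift_columns (- lo) ` M"
  define m where "m = card (fst ` M)"
  have M0: "moon_polyomino M0" "total_equiv M M0" "column_mset M0 = column_mset M"
    using moon_shift[OF M] total_equiv_shift column_mset_shift by (simp_all add: M0_def)
  have "fst ` M = {lo..Max (fst ` M)}" unfolding lo_def
    using finM ne moon_fst_convex[OF M] by (intro ord_convex_eq_atLeastAtMost) auto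
  then have "fst ` M = {lo..<lo + int m}"
  proof -
    assume *: "fst ` M = {lo..Max (fst ` M)}"
    have "m = nat (Max (fst ` M) - lo + 1)" unfolding m_def by (subst *) simp
    moreover have "lo \<le> Max (fst ` M)" using * ne by fastforce
    ultimately show ?thesis by (subst *) auto
  qed
  then have fst0: "fst ` M0 = {0..<int m}"
    unfolding M0_def fst_shift by (simp only: image_add_atLeastLessThan') simp
  obtain M1 where M1: "row_equiv M0 M1" "canonical M1" "fst ` M1 = {0..<int m}" "column_mset M1 = column_mset M"
    using ex_canonical[OF M0(1)] fst0 M0(3) by metis
  have moon1: "moon_polyomino M1" and dec: "\<And>i i'. 0 \<le> i \<Longrightarrow> i < int m \<Longrightarrow> i \<le> i' \<Longrightarrow> cols M1 i' \<subseteq> cols M1 i"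
    using M1(2,3) by (auto simp: canonical_def)
  have fin1: "finite M1" using moon1 by (rule moon_finite)
  have tot1: "total_equiv M M1"
    using total_equiv_trans[OF M0(2)] row_equiv_imp_total_equiv[OF M1(1)] moon_finite[OF M0(1)] fin1 by blast
  have m0: "0 < m" using finM ne by (simp add: m_def card_gt_0_iff)
  have hs_eq: "hs = map (\<lambda>i. card (cols M1 (int i))) [0..<m]"
  proof (rule sorted_wrt_ge_unique[OF hs(1)])
    show "sorted_wrt (\<ge>) (map (\<lambda>i. card (cols M1 (int i))) [0..<m])"
      unfolding sorted_wrt_map
    proof (rule sorted_wrt_mono_rel[of _ "(<)"])
      show "card (cols M1 (int y)) \<le> card (cols M1 (int x))" if "x \<in> set [0..<m]" "y \<in> set [0..<m]" "x < y" for x y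
        using dec[of "int x" "int y"] that finite_cols[OF fin1] by (intro card_mono) auto
    qed simp
    have "mset_set {0..<int m} = image_mset int (mset_set {0..<m})"
      by (subst image_mset_mset_set) (auto simp: image_int_atLeastLessThan)
    then have "column_mset M1 = image_mset (\<lambda>i. cols M1 (int i)) (mset_set {0..<m})"
      by (simp add: column_mset_def M1(3) multiset.map_comp comp_def)
    then show "mset hs = mset (map (\<lambda>i. card (cols M1 (int i))) [0..<m])"
      by (simp add: hs(2) content_eq flip: M1(4)) (simp add: multiset.map_comp comp_def)
  qed
  define h where "h = hs ! 0"
  have h: "h = card (cols M1 0)" using m0 by (simp add: h_def hs_eq)
  have rows1: "snd ` M1 = cols M1 0"
  proof
    show "snd ` M1 \<subseteq> cols M1 0"
    proof
      fix j assume "j \<in> snd ` M1"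
      then obtain i where ij: "(i, j) \<in> M1" by force
      then have "i \<in> fst ` M1" by force
      then have "cols M1 i \<subseteq> cols M1 0" using dec[of 0 i] M1(3) m0 by simp
      then show "j \<in> cols M1 0" using ij by (auto simp: cols_def)
    qed
  qed (force simp: cols_def)
  define M2 where "M2 = prod.swap ` M1"
  have M2: "moon_polyomino M2" "total_equiv M1 M2"
    using moon_swap[OF moon1] total_equiv_swap by (simp_all add: M2_def)
  have fst2: "fst ` M2 = cols M1 0" by (simp add: M2_def image_image rows1)
  have cols2: "cols M2 j = {i. (i, j) \<in> M1}" for j by (force simp: M2_def cols_def)
  define c where "c = Min (cols M1 0)"
  have "0 \<in> fst ` M1" using M1(3) m0 by simp
  then have col0: "cols M1 0 \<noteq> {}" using cols_empty_iff by blast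
  have col0_eq: "cols M1 0 = {c..<c + int h}"
  proof -
    have *: "cols M1 0 = {c..Max (cols M1 0)}" unfolding c_def
      using ord_convex_eq_atLeastAtMost finite_cols[OF fin1] col0 moon_cols_convex[OF moon1] by blast
    have "h = nat (Max (cols M1 0) - c + 1)" unfolding h by (subst *) simp
    moreover have "c \<le> Max (cols M1 0)" using * col0 by fastforce
    ultimately show ?thesis by (subst *) auto
  qed
  define N where "N = shift_columns (- c) ` M2"
  have N: "moon_polyomino N" "total_equiv M2 N"
    using moon_shift[OF M2(1)] total_equiv_shift by (simp_all add: N_def)
  have fstN: "fst ` N = {0..<int h}"
    unfolding N_def fst_shift fst2 col0_eq image_add_atLeastLessThan' by simp
  define f where "f j = card {i. (i, j + c) \<in> M1}" for j
  have colsN: "cols N j = {i. (i, j + c) \<in> M1}" for j by (simp add: N_def cols_shift cols2)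
  have colsN_eq: "cols N j = {0..<int (f j)}" for j
  proof -
    let ?X = "{i. (i, j + c) \<in> M1}"
    have finX: "finite ?X" using finite_cols[OF moon_finite[OF N(1)]] by (simp flip: colsN)
    have nonneg: "0 \<le> i" "i < int m" if "i \<in> ?X" for i
      using that M1(3) by force+
    show ?thesis
    proof (cases "?X = {}")
      case True
      then show ?thesis by (simp add: colsN f_def)
    next
      case False
      have X: "?X = {0..Max ?X}"
      proof
        show "{0..Max ?X} \<subseteq> ?X"
        proof
          fix i assume i: "i \<in> {0..Max ?X}"
          have mx: "Max ?X \<in> ?X" using finX False by (rule Max_in)
          then have "i < int m" using nonneg(2)[OF mx] i by simp
          then have "cols M1 (Max ?X) \<subseteq> cols M1 i" using dec[of i "Max ?X"] i by simp
          then show "i \<in> ?X" using mx by (auto simp: cols_def)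
        qed
      qed (use finX nonneg in auto)
      have "f j = nat (Max ?X + 1)" using arg_cong[OF X, of card] by (simp add: f_def)
      moreover have "0 \<le> Max ?X" using nonneg(1)[OF Max_in[OF finX False]] .
      ultimately have "{0..Max ?X} = {0..<int (f j)}" by auto
      then show ?thesis using X colsN[of j] by metis
    qed
  qed
  have "column_mset N = image_mset (\<lambda>k. {0..<int k}) (image_mset f (mset_set {0..<int h}))"
  proof -
    have "cols N = (\<lambda>j. {0..<int (f j)})" using colsN_eq by blast
    then show ?thesis by (simp add: column_mset_def fstN multiset.map_comp comp_def)
  qed
  moreover have "card {j \<in> {0..<int h}. i < f j} = (if i < length hs then hs ! i else 0)" for i
  proof -
    have "i < f j \<longleftrightarrow> (int i, j + c) \<in> M1" for j
      using arg_cong[OF trans[OF colsN[of j, symmetric] colsN_eq], of "\<lambda>X. int i \<in> X"] by simp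
    then have X: "j \<in> {j \<in> {0..<int h}. i < f j} \<longleftrightarrow> j + c \<in> cols M1 0 \<inter> cols M1 (int i)" for j
      unfolding col0_eq by (auto simp: cols_def)
    have "bij_betw (\<lambda>j. j + c) {j \<in> {0..<int h}. i < f j} (cols M1 0 \<inter> cols M1 (int i))"
    proof (rule bij_betw_byWitness[of _ "\<lambda>j. j - c"])
      show "(\<lambda>j. j + c) ` {j \<in> {0..<int h}. i < f j} \<subseteq> cols M1 0 \<inter> cols M1 (int i)"
        using X by blast
      show "(\<lambda>j. j - c) ` (cols M1 0 \<inter> cols M1 (int i)) \<subseteq> {j \<in> {0..<int h}. i < f j}"
      proof (rule image_subsetI)
        fix k assume "k \<in> cols M1 0 \<inter> cols M1 (int i)"
        then show "k - c \<in> {j \<in> {0..<int h}. i < f j}" by (subst X) simp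
      qed
    qed simp_all
    then have "card {j \<in> {0..<int h}. i < f j} = card (cols M1 0 \<inter> cols M1 (int i))"
      by (rule bij_betw_same_card)
    also have "cols M1 0 \<inter> cols M1 (int i) = cols M1 (int i)"
      using dec[of 0 "int i"] m0 by auto
    also have "card (cols M1 (int i)) = (if i < length hs then hs ! i else 0)"
    proof (cases "i < m")
      case False
      then have "cols M1 (int i) = {}" using cols_empty_iff[of M1 "int i"] M1(3) by simp
      then show ?thesis using False by (simp add: hs_eq)
    qed (simp add: hs_eq)
    finally show ?thesis .
  qed
  moreover have "total_equiv M N" using total_equiv_trans tot1 M2(2) N(2) by blast
  ultimately show ?thesis using N(1) fstN unfolding h_def by blast
qed

text \<open>The columns of the normal forms are the former rows, so \<open>moon_row_equiv\<close>
  rearranges the rows here. The row counts are lost in the transposition; the total number of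
  nonzero cells survives.\<close>

lemma moon_total_equiv:
  assumes M: "moon_polyomino M" and N: "moon_polyomino N" and eq: "content N = content M"
  shows "total_equiv M N"
proof (cases "M = {}")
  case True
  then have "content N = {#}" using eq by (simp add: content_def column_indices_def)
  then have "N = {}" using moon_finite[OF N] by (simp add: content_def column_indices_def mset_set_empty_iff)
  then show ?thesis using True row_equiv_imp_total_equiv[of M N] by simp
next
  case False
  then have "content M \<noteq> {#}" using moon_finite[OF M] by (simp add: content_def column_indices_def mset_set_empty_iff)
  then have neN: "N \<noteq> {}" using eq by (auto simp: content_def column_indices_def)
  define hs where "hs = rev (sorted_list_of_multiset (content M))"
  have hs: "sorted_wrt (\<ge>) hs" "mset hs = content M" "mset hs = content N"
    using eq by (simp_all add: hs_def sorted_wrt_rev)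
  obtain M' f where M': "total_equiv M M'" "moon_polyomino M'" "fst ` M' = {0..<int (hs ! 0)}"
    "column_mset M' = image_mset (\<lambda>k. {0..<int k}) (image_mset f (mset_set {0..<int (hs ! 0)}))"
    "\<And>i. card {j \<in> {0..<int (hs ! 0)}. i < f j} = (if i < length hs then hs ! i else 0)"
    using moon_normal_form[OF M False hs(1,2)] by blast
  obtain N' g where N': "total_equiv N N'" "moon_polyomino N'" "fst ` N' = {0..<int (hs ! 0)}"
    "column_mset N' = image_mset (\<lambda>k. {0..<int k}) (image_mset g (mset_set {0..<int (hs ! 0)}))"
    "\<And>i. card {j \<in> {0..<int (hs ! 0)}. i < g j} = (if i < length hs then hs ! i else 0)"
    using moon_normal_form[OF N neN hs(1,3)] by blast
  have "image_mset f (mset_set {0..<int (hs ! 0)}) = image_mset g (mset_set {0..<int (hs ! 0)})"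
    by (rule image_mset_eq_by_tails) (simp_all only: M'(5) N'(5) finite_atLeastLessThan_int)
  then have "row_equiv M' N'" using M' N' by (intro moon_row_equiv) simp_all
  then have "total_equiv M' N'"
    using row_equiv_imp_total_equiv moon_finite M'(2) N'(2) by blast
  then show ?thesis using M'(1) N'(1) total_equiv_trans total_equiv_sym by blast
qed

section \<open>From sets of cells to fillings\<close>

lemma longest_ne_chain_eq:
  assumes "finite M"
  shows "longest_ne_chain M f = max_ne_in M (nonzero_cells M f)"
proof -
  let ?S = "nonzero_cells M f"
  have "{length cs |cs. ne_chain M f cs} = card ` {X. X \<subseteq> ?S \<and> ne_set X \<and> box_closed M X}"
  proof
    show "{length cs |cs. ne_chain M f cs} \<subseteq> card ` {X. X \<subseteq> ?S \<and> ne_set X \<and> box_closed M X}"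
    proof clarify
      fix cs assume cs: "ne_chain M f cs"
      have srt: "sorted_wrt ne_less cs"
        using cs unfolding ne_chain_def
        by (subst (asm) successively_conv_sorted_wrt) (auto intro!: transpI simp: ne_less_def[abs_def])
      then have "distinct cs" by (induction cs) (auto simp: ne_less_def)
      then have "card (set cs) = length cs" by (rule distinct_card)
      moreover have "ne_set (set cs)"
        unfolding ne_set_def ne_comparable_def using sorted_wrt_memD[OF srt] by blast
      moreover have "box_closed M (set cs)"
        unfolding box_closed_def
      proof (intro ballI)
        fix c d assume cd: "c \<in> set cs" "d \<in> set cs"
        have "{fst c..fst d} \<times> {snd c..snd d} \<subseteq> rectangle hull set cs"
          unfolding hull_def
        proof (rule Inter_greatest)
          fix R assume "R \<in> {t. rectangle t \<and> set cs \<subseteq> t}"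
          then obtain x y u v where "R = {x..y} \<times> {u..v}" "set cs \<subseteq> R" by (auto simp: rectangle_def)
          moreover then have "c \<in> {x..y} \<times> {u..v}" "d \<in> {x..y} \<times> {u..v}" using cd by blast+
          ultimately show "{fst c..fst d} \<times> {snd c..snd d} \<subseteq> R" by auto
        qed
        then show "{fst c..fst d} \<times> {snd c..snd d} \<subseteq> M"
          using cs by (auto simp: ne_chain_def is_chain_def)
      qed
      ultimately show "length cs \<in> card ` {X. X \<subseteq> ?S \<and> ne_set X \<and> box_closed M X}"
        using cs by (intro image_eqI[of _ card "set cs"]) (auto simp: ne_chain_def is_chain_def)
    qed
    show "card ` {X. X \<subseteq> ?S \<and> ne_set X \<and> box_closed M X} \<subseteq> {length cs |cs. ne_chain M f cs}"
    proof clarify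
      fix X assume X: "X \<subseteq> ?S" "ne_set X" "box_closed M X"
      have finX: "finite X" using X(1) assms by (auto simp: nonzero_cells_def intro: finite_subset)
      \<comment> \<open>A chain is listed from left to right: its leftmost cell is also its lowest
        one and becomes the head.\<close>
      have "\<exists>cs. set cs = X \<and> sorted_wrt ne_less cs"
        using finX X(2)
      proof (induction "card X" arbitrary: X)
        case 0
        then show ?case by (intro exI[of _ "[]"]) simp
      next
        case (Suc n)
        then have "X \<noteq> {}" by auto
        then have "Min (fst ` X) \<in> fst ` X" using Suc by (intro Min_in) auto
        then obtain c where c: "c \<in> X" "fst c = Min (fst ` X)" by (metis imageE)
        have "card (X - {c}) = n" "ne_set (X - {c})" using Suc c ne_set_subset[of X "X - {c}"] by auto
        then obtain cs where cs: "set cs = X - {c}" "sorted_wrt ne_less cs" using Suc.hyps(1)[of "X - {c}"] Suc by auto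
        have "ne_less c d" if "d \<in> X - {c}" for d
        proof -
          have "ne_less c d \<or> ne_less d c" using Suc.prems(2) c that by (auto simp: ne_set_def ne_comparable_def)
          moreover have "fst c \<le> fst d" using c(2) Suc.prems(1) that by simp
          ultimately show ?thesis by (auto simp: ne_less_def)
        qed
        then have "set (c # cs) = X \<and> sorted_wrt ne_less (c # cs)" using cs c by auto
        then show ?case by blast
      qed
      then obtain cs where cs: "set cs = X" "sorted_wrt ne_less cs" by blast
      then have "distinct cs" by (induction cs arbitrary: X) (auto simp: ne_less_def)
      then have len: "length cs = card X" using cs(1) distinct_card by metis
      have "rectangle hull X \<subseteq> M"
      proof (cases cs)
        case Nil
        then have "X = {}" using cs by simp
        then show ?thesis using ne_chain_Nil[of M f] by (simp add: ne_chain_def is_chain_def)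
      next
        case (Cons c cs')
        \<comment> \<open>The first and the last cell are opposite corners of the bounding
          rectangle, so one instance of \<open>box_closed\<close> covers the whole hull.\<close>
        let ?d = "last cs"
        let ?B = "{fst c..fst ?d} \<times> {snd c..snd ?d}"
        have d: "?d \<in> X" "c \<in> X" using cs Cons by auto
        have "e \<in> ?B" if "e \<in> X" for e
        proof -
          have "e = c \<or> ne_less c e" using cs that Cons by auto
          moreover have "e = ?d \<or> ne_less e ?d"
          proof -
            have "cs = butlast cs @ [?d]" using Cons by simp
            then have "e \<in> set (butlast cs) \<or> e = ?d" "sorted_wrt ne_less (butlast cs @ [?d])"
              using cs that by (metis Un_iff empty_iff empty_set list.set_intros set_ConsD set_append, metis)
            then show ?thesis by (auto simp: sorted_wrt_append)
          qed
          ultimately show ?thesis by (auto simp: ne_less_def mem_Times_iff)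
        qed
        then have "rectangle hull X \<subseteq> ?B"
          by (intro hull_minimal) (auto simp: rectangle_def)
        also have "?B \<subseteq> M" using X(3) d by (auto simp: box_closed_def)
        finally show ?thesis .
      qed
      then have "ne_chain M f cs"
        using X(1) cs unfolding ne_chain_def is_chain_def
        by (auto simp: successively_conv_sorted_wrt transp_def ne_less_def[abs_def])
      then show "\<exists>cs. card X = length cs \<and> ne_chain M f cs" using len by metis
    qed
  qed
  then show ?thesis by (simp add: longest_ne_chain_def max_ne_in_def)
qed

lemma bij_nonzero_cells: "bij_betw (nonzero_cells M) (fillings01 M) (Pow M)"
proof (rule bij_betw_byWitness[of _ "\<lambda>S c. if c \<in> M then if c \<in> S then 1 else 0 else undefined"])
  show "\<forall>f\<in>fillings01 M. (\<lambda>c. if c \<in> M then if c \<in> nonzero_cells M f then 1 else 0 else undefined) = f"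
  proof (intro ballI ext)
    fix f c assume "f \<in> fillings01 M"
    then have "f c \<in> {0, 1}" if "c \<in> M" using that unfolding fillings01_def by (rule PiE_mem)
    moreover have "f c = undefined" if "c \<notin> M"
      using \<open>f \<in> fillings01 M\<close> that unfolding fillings01_def by (rule PiE_arb)
    ultimately show "(if c \<in> M then if c \<in> nonzero_cells M f then 1 else 0 else undefined) = f c"
      by (auto simp: nonzero_cells_def)
  qed
qed (auto simp: fillings01_def nonzero_cells_def split: if_splits)

lemma card_transfer:
  assumes "bij_betw \<phi> A B" "\<And>S. S \<in> A \<Longrightarrow> Q (\<phi> S) \<longleftrightarrow> P S"
  shows "card {S \<in> A. P S} = card {S \<in> B. Q S}"
proof (rule bij_betw_same_card)
  have "\<phi> ` {S \<in> A. P S} = {S \<in> B. Q S}"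
  proof
    show "{S \<in> B. Q S} \<subseteq> \<phi> ` {S \<in> A. P S}"
    proof
      fix T assume T: "T \<in> {S \<in> B. Q S}"
      then have "T \<in> \<phi> ` A" using bij_betw_imp_surj_on[OF assms(1)] by simp
      then show "T \<in> \<phi> ` {S \<in> A. P S}" using T assms(2) by auto
    qed
  qed (use assms bij_betwE in fastforce)
  then show "bij_betw \<phi> {S \<in> A. P S} {S \<in> B. Q S}"
    using inj_on_subset[OF bij_betw_imp_inj_on[OF assms(1)]] by (auto simp: bij_betw_def)
qed

lemma card_fillings:
  assumes "finite M"
  shows "card {f \<in> fillings01 M. longest_ne_chain M f = l \<and> P (nonzero_cells M f)} =
     card {S \<in> Pow M. max_ne_in M S = l \<and> P S}"
  by (rule card_transfer[OF bij_nonzero_cells]) (simp add: longest_ne_chain_eq[OF assms])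

lemma card_F01_ne_eq:
  assumes "row_equiv M N" "finite M" "finite N" "snd ` M = snd ` N"
  shows "card (F01_ne M l r) = card (F01_ne N l r)"
proof -
  have row: "nonzero_cells (row K j) f = nonzero_cells K f \<inter> UNIV \<times> {j}" for K j f
    by (auto simp: nonzero_cells_def row_def)
  obtain \<phi> where \<phi>: "bij_betw \<phi> (Pow M) (Pow N)"
    "\<And>S. S \<in> Pow M \<Longrightarrow> max_ne_in N (\<phi> S) = max_ne_in M S \<and> (\<forall>j. card (\<phi> S \<inter> UNIV \<times> {j}) = card (S \<inter> UNIV \<times> {j}))"
    using assms(1) unfolding row_equiv_def by blast
  have "card (F01_ne M l r) =
      card {S \<in> Pow M. max_ne_in M S = l \<and> (\<forall>j\<in>snd ` M. card (S \<inter> UNIV \<times> {j}) = r j)}"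
    unfolding F01_ne_def row row_indices_def by (rule card_fillings[OF assms(2)])
  also have "\<dots> = card {S \<in> Pow N. max_ne_in N S = l \<and> (\<forall>j\<in>snd ` N. card (S \<inter> UNIV \<times> {j}) = r j)}"
    by (rule card_transfer[OF \<phi>(1)]) (use \<phi>(2) assms(4) in auto)
  also have "\<dots> = card (F01_ne N l r)"
    unfolding F01_ne_def row row_indices_def by (rule card_fillings[OF assms(3), symmetric])
  finally show ?thesis .
qed

lemma card_F01_ne_total_eq:
  assumes "total_equiv M N" "finite M" "finite N"
  shows "card (F01_ne_total M l n) = card (F01_ne_total N l n)"
proof -
  obtain \<phi> where \<phi>: "bij_betw \<phi> (Pow M) (Pow N)"
    "\<And>S. S \<in> Pow M \<Longrightarrow> max_ne_in N (\<phi> S) = max_ne_in M S \<and> card (\<phi> S) = card S"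
    using assms(1) unfolding total_equiv_def by blast
  have "card (F01_ne_total M l n) = card {S \<in> Pow M. max_ne_in M S = l \<and> card S = n}"
    unfolding F01_ne_total_def by (rule card_fillings[OF assms(2)])
  also have "\<dots> = card {S \<in> Pow N. max_ne_in N S = l \<and> card S = n}"
    by (rule card_transfer[OF \<phi>(1)]) (use \<phi>(2) in auto)
  also have "\<dots> = card (F01_ne_total N l n)"
    unfolding F01_ne_total_def by (rule card_fillings[OF assms(3), symmetric])
  finally show ?thesis .
qed

theorem theorem5p1:
  fixes M :: "cell set"
  assumes "moon_polyomino M"
  shows "(\<forall>(l :: nat) (r :: int \<Rightarrow> nat) (\<sigma> :: int \<Rightarrow> int).
            \<sigma> permutes column_indices M \<and> moon_polyomino (permute_columns \<sigma> M) \<longrightarrow>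
            card (F01_ne M l r) = card (F01_ne (permute_columns \<sigma> M) l r)) \<and>
         (\<forall>(N :: cell set) (n :: nat) (l :: nat).
            moon_polyomino N \<and> content N = content M \<longrightarrow>
            card (F01_ne_total M l n) = card (F01_ne_total N l n))"
proof (intro conjI allI impI)
  fix l r \<sigma> assume \<sigma>: "\<sigma> permutes column_indices M \<and> moon_polyomino (permute_columns \<sigma> M)"
  let ?N = "permute_columns \<sigma> M"
  have perm: "\<sigma> permutes fst ` M" using \<sigma> by (simp add: column_indices_def)
  \<comment> \<open>Cells are pushed forward along \<open>\<sigma>\<close>, so columns are pulled
    back along its inverse, which is the form required by \<open>cols_permuted\<close>.\<close>
  have cols: "cols ?N i = cols M (inv \<sigma> i)" for i
    using permutes_inverses[OF perm] by (auto simp: cols_def permute_columns_def) (metis permutes_inverses(1)[OF perm])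
  note permuted = cols_permuted[OF cols permutes_inv[OF perm] refl]
  have "row_equiv M ?N"
    using moon_row_equiv[OF assms conjunct2[OF \<sigma>]] permuted by simp
  moreover have "snd ` M = snd ` ?N" by (force simp: permute_columns_def)
  ultimately show "card (F01_ne M l r) = card (F01_ne ?N l r)"
    using card_F01_ne_eq moon_finite assms \<sigma> by blast
next
  fix N n l assume N: "moon_polyomino N \<and> content N = content M"
  then have "total_equiv M N" using moon_total_equiv assms by blast
  then show "card (F01_ne_total M l n) = card (F01_ne_total N l n)"
    using card_F01_ne_total_eq moon_finite assms N by blast
qed

end
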